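(* Let $X$ be a $\mathrm{CAT}(-1)$-space, and let $(Y,|\cdot\,\cdot|)$ be its boundary endowed with a Bourdon metric or a Hamenstädt metric; that is, either $Y=\partial_\infty X$ and $|yy'|=\rho_o(y,y')$ for some $o\in X$, or $Y=\partial_\infty X\setminus\{\omega\}$ and $|yy'|=\rho_b(y,y')$ for some $\omega\in\partial_\infty X$ and some Busemann function $b$ for $\omega$. Let $y_1,y_2,y_3,y_4\in Y$. Then $$|y_1y_3|\,|y_2y_4|\le |y_1y_2|\,|y_3y_4|+|y_2y_3|\,|y_4y_1|.$$ Equality holds if and only if the convex hull of the four points is isometric to an ideal quadrilateral in the hyperbolic plane $\mathbb{H}^2$ such that the geodesics $y_1y_3$ and $y_2y_4$ are the diagonals.
   Context: A $\mathrm{CAT}(-1)$-space is a complete geodesic metric space $X$ in which every geodesic triangle is at least as thin as its comparison triangle in $\mathbb{H}^2$. Distances in $X$ are written $|xx'|$. For $o,x,x'\in X$ the Gromov product is $(x|x')_o=\frac12(|ox|+|ox'|-|xx'|)$. A sequence $(x_i)$ in $X$ converges to infinity if $(x_i|x_j)_o\to\infty$ as $i,j\to\infty$; two such sequences $(x_i),(x_i')$ are equivalent if $(x_i|x_i')_o\to\infty$; $\partial_\infty X$ is the set of equivalence classes. For $y,y'\in\partial_\infty X$, $(y|y')_o=\inf\liminf_{i\to\infty}(x_i|x_i')_o$, the infimum being over all $(x_i)\in y$, $(x'_i)\in y'$ (with value $\infty$ iff $y=y'$), and for $x\in X$, $(y|x)_o=\inf\liminf_{i\to\infty}(x_i|x)_o$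 over all $(x_i)\in y$. Any two different points $y,y'\in\partial_\infty X$ are joined by a unique geodesic line, denoted $yy'$. Bourdon metric with basepoint $o\in X$: $\rho_o(y,y')=e^{-(y|y')_o}$ on $\partial_\infty X$ (with $e^{-\infty}=0$). Hamenstädt metric: let $\omega\in\partial_\infty X$ and let $b$ be a Busemann function for $\omega$ (up to an additive constant, $b(x)=|ox|-2(\omega|x)_o$ is the Busemann function with $b(o)=0$). Put $(x|x')_b=\frac12(b(x)+b(x')-|xx'|)$, extended to points at infinity as for the usual Gromov product; then $\rho_b(y,y')=e^{-(y|y')_b}$ on $\partial_\infty X\setminus\{\omega\}$. If $b(o)=0$, then $\rho_b(y,y')=\dfrac{\rho_o(y,y')}{\rho_o(y,\omega)\rho_o(y',\omega)}$. The convex hull of points of $\partial_\infty X$ is the smallest convex subset of $X$ containing the geodesic lines joining these points pairwise. An ideal quadrilateral in $\mathbb{H}^2$ is a quadrilateral whose four vertices lie in $\partial_\infty\mathbb{H}^2$, i.e. the convex hull of these vertices; its diagonals are the geodesics joining opposite vertices.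
   Formalization: The equality characterization is stated for four pairwise distinct points; if y1 = y2, equality always holds although the convex hull (e.g. a tripod in a tree) need not be an ideal quadrilateral, and y1y3 is undefined if y1 = y3. The inequality is stated for all points. *)

theory Defs
  imports "HOL-Analysis.Analysis"
begin

section \<open>The hyperbolic plane\<close>

text \<open>Upper half-plane model, curvature $-1$.\<close>

typedef hyp_plane = "{z::complex. 0 < Im z}"
  morphisms hp_coord hp_point
  by (rule exI[of _ \<i>]) simp

lemma Im_hp_coord_pos: "0 < Im (hp_coord p)"
  using hp_coord[of p] by simp

lemma arcosh_eq_two_arsinh:
  fixes s :: real
  assumes "0 \<le> s"
  shows "arcosh (1 + 2 * s\<^sup>2) = 2 * arsinh s"
proof -
  have "cosh (2 * arsinh s) = 1 + 2 * s\<^sup>2"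
    by (simp add: cosh_double cosh_arsinh_real)
  moreover have "0 \<le> 2 * arsinh s"
    using assms by (simp flip: sinh_real_nonneg_iff[of "arsinh s"])
  ultimately show ?thesis
    by (metis arcosh_cosh_real)
qed

instantiation hyp_plane :: metric_space
begin

definition dist_hyp_plane :: "hyp_plane \<Rightarrow> hyp_plane \<Rightarrow> real" where
  "dist_hyp_plane p q =
     arcosh (1 + (cmod (hp_coord p - hp_coord q))\<^sup>2 / (2 * Im (hp_coord p) * Im (hp_coord q)))"

definition uniformity_hyp_plane :: "(hyp_plane \<times> hyp_plane) filter" where
  "uniformity_hyp_plane = (INF e\<in>{0<..}. principal {(p, q). dist p q < e})"

definition open_hyp_plane :: "hyp_plane set \<Rightarrow> bool" where
  "open_hyp_plane U \<longleftrightarrow> (\<forall>x\<in>U. eventually (\<lambda>(x', y). x' = x \<longrightarrow> y \<in> U) uniformity)"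

instance
proof
  define S where "S p q = cmod (hp_coord p - hp_coord q)
      / (2 * (sqrt (Im (hp_coord p)) * sqrt (Im (hp_coord q))))" for p q
  have S0: "0 \<le> S p q" for p q
    using Im_hp_coord_pos[of p] Im_hp_coord_pos[of q] by (simp add: S_def)
  have S2: "(S p q)\<^sup>2 = (cmod (hp_coord p - hp_coord q))\<^sup>2 / (4 * (Im (hp_coord p) * Im (hp_coord q)))" for p q
    using Im_hp_coord_pos[of p] Im_hp_coord_pos[of q]
    by (simp add: S_def power_divide power_mult_distrib)
  have dist_S: "dist p q = 2 * arsinh (S p q)" for p q
  proof -
    have "dist p q = arcosh (1 + 2 * (S p q)\<^sup>2)"
      unfolding dist_hyp_plane_def S2 by (simp add: field_simps)
    then show ?thesis
      by (simp only: arcosh_eq_two_arsinh[OF S0])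
  qed
  fix p q r :: hyp_plane
  show "dist p q = 0 \<longleftrightarrow> p = q"
    using Im_hp_coord_pos[of p] Im_hp_coord_pos[of q]
    by (auto simp: dist_S S_def hp_coord_inject)
  show "dist p q \<le> dist p r + dist q r"
  proof -
    define C where "C p q = cmod (hp_coord p - cnj (hp_coord q))
      / (2 * (sqrt (Im (hp_coord p)) * sqrt (Im (hp_coord q))))" for p q
    have C: "sqrt ((S p q)\<^sup>2 + 1) = C p q" for p q
    proof (rule real_sqrt_unique)
      have "(cmod (hp_coord p - cnj (hp_coord q)))\<^sup>2
          = (cmod (hp_coord p - hp_coord q))\<^sup>2 + 4 * (Im (hp_coord p) * Im (hp_coord q))"
        unfolding cmod_power2 by (simp add: power2_eq_square algebra_simps)
      then show "(C p q)\<^sup>2 = (S p q)\<^sup>2 + 1"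
        using Im_hp_coord_pos[of p] Im_hp_coord_pos[of q] unfolding S2
        by (simp add: C_def power_divide power_mult_distrib add_divide_distrib)
      show "0 \<le> C p q"
        using Im_hp_coord_pos[of p] Im_hp_coord_pos[of q] by (simp add: C_def)
    qed
    let ?z = "hp_coord p" and ?w = "hp_coord q" and ?u = "hp_coord r"
    have "(?z - ?w) * (?u - cnj ?u) = (?z - ?u) * (?w - cnj ?u) - (?z - cnj ?u) * (?w - ?u)"
      by (simp add: algebra_simps)
    then have "cmod (?z - ?w) * cmod (?u - cnj ?u)
        \<le> cmod (?z - ?u) * cmod (?w - cnj ?u) + cmod (?z - cnj ?u) * cmod (?w - ?u)"
      by (metis norm_mult norm_triangle_ineq4)
    moreover have "cmod (?u - cnj ?u) = 2 * Im ?u"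
      using Im_hp_coord_pos[of r] by (simp add: complex_diff_cnj norm_mult)
    ultimately have ptol: "cmod (?z - ?w) * (2 * Im ?u)
        \<le> cmod (?z - ?u) * cmod (?w - cnj ?u) + cmod (?z - cnj ?u) * cmod (?w - ?u)"
      by simp
    define a b c where "a = sqrt (Im ?z)" and "b = sqrt (Im ?w)" and "c = sqrt (Im ?u)"
    have pos: "0 < a" "0 < b" "0 < c" and cc: "Im ?u = c * c"
      using Im_hp_coord_pos by (simp_all add: a_def b_def c_def less_imp_le)
    have "S p q = cmod (?z - ?w) * (2 * Im ?u) / (4 * (a * b * (c * c)))"
      using pos by (simp add: S_def cc flip: a_def b_def)
    also have "\<dots> \<le> (cmod (?z - ?u) * cmod (?w - cnj ?u) + cmod (?z - cnj ?u) * cmod (?w - ?u))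
        / (4 * (a * b * (c * c)))"
      using ptol pos by (intro divide_right_mono) auto
    also have "\<dots> = S p r * C q r + C p r * S q r"
      using pos by (simp add: S_def C_def field_simps flip: a_def b_def c_def)
    also have "\<dots> = sinh (arsinh (S p r) + arsinh (S q r))"
      by (simp add: sinh_add cosh_arsinh_real C)
    finally have "arsinh (S p q) \<le> arsinh (S p r) + arsinh (S q r)"
      by (metis sinh_arsinh_real sinh_real_le_iff)
    then show ?thesis
      by (simp add: dist_S)
  qed
qed (simp_all add: uniformity_hyp_plane_def open_hyp_plane_def)

end


section \<open>Geodesics and CAT(-1)-spaces\<close>

definition geodesic_path :: "(real \<Rightarrow> 'a::metric_space) \<Rightarrow> 'a \<Rightarrow> 'a \<Rightarrow> bool" where
  "geodesic_path \<gamma> x y \<longleftrightarrow> \<gamma> 0 = x \<and> \<gamma> (dist x y) = y \<and>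
     (\<forall>s\<in>{0..dist x y}. \<forall>t\<in>{0..dist x y}. dist (\<gamma> s) (\<gamma> t) = \<bar>s - t\<bar>)"

text \<open>In the thinness condition \<open>\<alpha>\<close> and \<open>\<beta>\<close> are two sides of a geodesic triangle \<open>x y z\<close>,
  issuing from a common vertex. Any two sides of a triangle arise in this way, since the names
  of the vertices and the paths are arbitrary, and for two points on the same side there is
  nothing to require. The points \<open>\<alpha> s\<close> and \<open>\<alpha>' s\<close> correspond to each other under the
  comparison map. Comparison triangles exist in the hyperbolic plane and are unique up to
  isometry.\<close>

definition cat_minus_one :: "'a::metric_space itself \<Rightarrow> bool" where
  "cat_minus_one T \<longleftrightarrow>
     complete (UNIV :: 'a set) \<and>
     (\<forall>x y :: 'a. \<exists>\<gamma>. geodesic_path \<gamma> x y) \<and>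
     (\<forall>(x::'a) y z \<alpha> \<beta> (x'::hyp_plane) y' z' \<alpha>' \<beta>'.
        geodesic_path \<alpha> x y \<and> geodesic_path \<beta> x z \<and>
        dist x' y' = dist x y \<and> dist x' z' = dist x z \<and> dist y' z' = dist y z \<and>
        geodesic_path \<alpha>' x' y' \<and> geodesic_path \<beta>' x' z' \<longrightarrow>
        (\<forall>s\<in>{0..dist x y}. \<forall>t\<in>{0..dist x z}. dist (\<alpha> s) (\<beta> t) \<le> dist (\<alpha>' s) (\<beta>' t)))"


section \<open>The boundary at infinity\<close>

definition gromov_product :: "'a::metric_space \<Rightarrow> 'a \<Rightarrow> 'a \<Rightarrow> real" where
  "gromov_product p x y = (dist p x + dist p y - dist x y) / 2"

text \<open>Changing the basepoint \<open>p\<close> changes the Gromov product by a bounded amount, so below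
  "for all \<open>p\<close>" is equivalent to "for one \<open>p\<close>".\<close>

definition converges_to_infinity :: "(nat \<Rightarrow> 'a::metric_space) \<Rightarrow> bool" where
  "converges_to_infinity X \<longleftrightarrow>
     (\<forall>p. filterlim (\<lambda>(i, j). gromov_product p (X i) (X j)) at_top (sequentially \<times>\<^sub>F sequentially))"

definition asymptotic_rel :: "((nat \<Rightarrow> 'a::metric_space) \<times> (nat \<Rightarrow> 'a)) set" where
  "asymptotic_rel = {(X, X'). converges_to_infinity X \<and> converges_to_infinity X' \<and>
     (\<forall>p. filterlim (\<lambda>i. gromov_product p (X i) (X' i)) at_top sequentially)}"

text \<open>A point at infinity is a class of sequences, hence a set of sequences.\<close>

type_synonym 'a ideal_point = "(nat \<Rightarrow> 'a) set"

definition boundary_at_infinity :: "'a::metric_space ideal_point set" where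
  "boundary_at_infinity = {X. converges_to_infinity X} // asymptotic_rel"

definition product_at_infinity ::
  "('a \<Rightarrow> 'a \<Rightarrow> real) \<Rightarrow> 'a ideal_point \<Rightarrow> 'a ideal_point \<Rightarrow> ereal" where
  "product_at_infinity P y y' = (INF (X, X')\<in>y \<times> y'. liminf (\<lambda>i. ereal (P (X i) (X' i))))"

definition gromov_product_point :: "'a::metric_space \<Rightarrow> 'a ideal_point \<Rightarrow> 'a \<Rightarrow> ereal" where
  "gromov_product_point p y x = (INF X\<in>y. liminf (\<lambda>i. ereal (gromov_product p (X i) x)))"


section \<open>Bourdon and Hamenstaedt metrics\<close>

text \<open>The value $-\infty$ does not occur for points at which the metrics below are considered.\<close>

definition exp_minus :: "ereal \<Rightarrow> real" where
  "exp_minus g = (if g = \<infinity> then 0 else exp (- real_of_ereal g))"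

definition bourdon_metric ::
  "'a::metric_space \<Rightarrow> 'a ideal_point \<Rightarrow> 'a ideal_point \<Rightarrow> real" where
  "bourdon_metric p y y' = exp_minus (product_at_infinity (gromov_product p) y y')"

definition busemann_function :: "'a::metric_space ideal_point \<Rightarrow> ('a \<Rightarrow> real) \<Rightarrow> bool" where
  "busemann_function \<omega> b \<longleftrightarrow>
     (\<exists>p c. \<forall>x. b x = dist p x - 2 * real_of_ereal (gromov_product_point p \<omega> x) + c)"

definition busemann_product :: "('a::metric_space \<Rightarrow> real) \<Rightarrow> 'a \<Rightarrow> 'a \<Rightarrow> real" where
  "busemann_product b x y = (b x + b y - dist x y) / 2"

definition hamenstaedt_metric ::
  "('a::metric_space \<Rightarrow> real) \<Rightarrow> 'a ideal_point \<Rightarrow> 'a ideal_point \<Rightarrow> real" where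
  "hamenstaedt_metric b y y' = exp_minus (product_at_infinity (busemann_product b) y y')"


section \<open>Convex hulls of ideal points and ideal quadrilaterals\<close>

definition line_joining ::
  "'a::metric_space ideal_point \<Rightarrow> 'a ideal_point \<Rightarrow> 'a set \<Rightarrow> bool" where
  "line_joining y y' L \<longleftrightarrow> (\<exists>\<gamma>::real \<Rightarrow> 'a. (\<forall>s t. dist (\<gamma> s) (\<gamma> t) = \<bar>s - t\<bar>) \<and>
     (\<lambda>n. \<gamma> (- real n)) \<in> y \<and> (\<lambda>n. \<gamma> (real n)) \<in> y' \<and> L = range \<gamma>)"

text \<open>In a CAT(-1)-space two different points at infinity are joined by a unique line.\<close>

definition geodesic_line :: "'a::metric_space ideal_point \<Rightarrow> 'a ideal_point \<Rightarrow> 'a set" where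
  "geodesic_line y y' = (THE L. line_joining y y' L)"

definition geodesically_convex :: "'a::metric_space set \<Rightarrow> bool" where
  "geodesically_convex C \<longleftrightarrow>
     (\<forall>x\<in>C. \<forall>y\<in>C. \<forall>\<gamma>. geodesic_path \<gamma> x y \<longrightarrow> \<gamma> ` {0..dist x y} \<subseteq> C)"

definition ideal_hull :: "'a::metric_space ideal_point set \<Rightarrow> 'a set" where
  "ideal_hull V =
     geodesically_convex hull (\<Union>{geodesic_line v w | v w. v \<in> V \<and> w \<in> V \<and> v \<noteq> w})"

text \<open>\<open>Q\<close> is the ideal quadrilateral with vertices $v_1, v_2, v_3, v_4$ in this cyclic order, that
  is, the lines joining successive vertices are sides, lying on the boundary curve of \<open>Q\<close>. The
  diagonals are then the lines $v_1 v_3$ and $v_2 v_4$.\<close>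

definition ideal_quadrilateral ::
  "hyp_plane ideal_point \<Rightarrow> hyp_plane ideal_point \<Rightarrow> hyp_plane ideal_point \<Rightarrow>
   hyp_plane ideal_point \<Rightarrow> hyp_plane set \<Rightarrow> bool" where
  "ideal_quadrilateral v1 v2 v3 v4 Q \<longleftrightarrow>
     {v1, v2, v3, v4} \<subseteq> boundary_at_infinity \<and> distinct [v1, v2, v3, v4] \<and>
     Q = ideal_hull {v1, v2, v3, v4} \<and>
     geodesic_line v1 v2 \<subseteq> frontier Q \<and> geodesic_line v2 v3 \<subseteq> frontier Q \<and>
     geodesic_line v3 v4 \<subseteq> frontier Q \<and> geodesic_line v4 v1 \<subseteq> frontier Q"

definition isometry_between ::
  "('a::metric_space \<Rightarrow> 'b::metric_space) \<Rightarrow> 'a set \<Rightarrow> 'b set \<Rightarrow> bool" where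
  "isometry_between f A B \<longleftrightarrow>
     bij_betw f A B \<and> (\<forall>x\<in>A. \<forall>y\<in>A. dist (f x) (f y) = dist x y)"

end

theory Submission
  imports Defs
begin

text \<open>On a segment the hyperbolic cosine of the distance to a fixed point is bounded by its value
  in the hyperbolic plane, where it is a combination of $e^t$ and $e^{-t}$. Travelling between two
  opposite ones of four points through the optimal point of the segment joining the other two, one
  obtains a four point inequality whose limit at infinity is Ptolemy's inequality. It also shows
  that Gromov products extend continuously to the boundary, and a Hamenstaedt metric differs from
  a Bourdon metric by factors depending on one point each, which cancel.

  In the case of equality let $\gamma$ join $y_1$ to $y_3$. The exponentials of the Busemann
  functions of $y_2$ and $y_4$ lie along $\gamma$ below combinations $A e^t + B e^{-t}$ whose
  coefficients are given by distances at infinity. Equality in Ptolemy's inequality means that both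
  bounds are attained at one point, hence everywhere by convexity, and the two diagonals cross
  there. The same argument determines all distances between points of the two diagonals: they are
  those of two crossing lines of the hyperbolic plane. Convexity and rigidity then propagate the
  isometry to all segments between the diagonals, and by completeness to the ideal quadrilateral.

  Conversely the cross ratios are determined by the distances between points of the diagonals. In
  the hyperbolic plane the Pluecker relation gives equality for one of the three pairings of four
  ideal points, and the lines of the pairing that takes the role of the diagonals cross in the
  interior of the hull. As the sides lie on the frontier, this pairing is the one of the
  diagonals.\<close>

section \<open>The hyperbolic plane in linear coordinates\<close>

text \<open>Hyperbolic cosines are used instead of angles because they turn every comparison into a
  statement about linear combinations. Two obstacles shape the proof. Ptolemy's inequality appears
  only in the limit, so equality says nothing about any finite quadruple of points; it has to be
  caught on Busemann functions, where the limiting bounds are sharp and one point of contact can be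
  propagated. Moreover \<open>X\<close> is not assumed to be proper, so lines between ideal points
  and the sides of the quadrilateral come from Cauchy sequences rather than from compactness. The
  isometry is built from the diagonals outwards, since the distances between the diagonals are what
  equality yields directly, whereas the sides are reached only as limits of interior points. In the
  converse direction the isometry of the hulls is known to match the diagonals only as sets, without
  a choice of direction; this is harmless because interchanging the two ends of a diagonal merely
  permutes the two products on the right-hand side.\<close>

text \<open>A point $x + iy$ is encoded by the positive definite symmetric matrix of determinant one
  with entries $1/y$, $(x^2+y^2)/y$ and $x/y$; the hyperbolic cosine of the distance is then
  bilinear.\<close>

definition hP :: "hyp_plane \<Rightarrow> real" where "hP z = 1 / Im (hp_coord z)"
definition hQ :: "hyp_plane \<Rightarrow> real" where "hQ z = (cmod (hp_coord z))\<^sup>2 / Im (hp_coord z)"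
definition hR :: "hyp_plane \<Rightarrow> real" where "hR z = Re (hp_coord z) / Im (hp_coord z)"

text \<open>Two coordinates suffice to name a point, as determinant one forces the third.\<close>

definition hmk :: "real \<Rightarrow> real \<Rightarrow> hyp_plane" where
  "hmk p r = hp_point (Complex (r / p) (1 / p))"

lemma hP_pos: "0 < hP z"
  by (simp add: hP_def Im_hp_coord_pos)

lemma hPQR: "hP z * hQ z - (hR z)\<^sup>2 = 1"
  using Im_hp_coord_pos[of z]
  unfolding hP_def hQ_def hR_def cmod_power2 by (simp add: field_simps power2_eq_square)

lemma cosh_dist_hyp:
  "cosh (dist z w) = (hP z * hQ w + hQ z * hP w) / 2 - hR z * hR w"
proof -
  have z: "0 < Im (hp_coord z)" and w: "0 < Im (hp_coord w)"
    by (simp_all add: Im_hp_coord_pos)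
  have "cosh (dist z w) = 1 + (cmod (hp_coord z - hp_coord w))\<^sup>2 / (2 * Im (hp_coord z) * Im (hp_coord w))"
    unfolding dist_hyp_plane_def using z w by (intro cosh_arcosh_real) simp
  also have "\<dots> = (hP z * hQ w + hQ z * hP w) / 2 - hR z * hR w"
    using z w unfolding hP_def hQ_def hR_def cmod_power2
    by (simp add: field_simps power2_eq_square)
  finally show ?thesis .
qed

lemma hP_hmk [simp]: "0 < p \<Longrightarrow> hP (hmk p r) = p"
  by (simp add: hP_def hmk_def hp_point_inverse)

lemma hR_hmk [simp]: "0 < p \<Longrightarrow> hR (hmk p r) = r"
  by (simp add: hR_def hmk_def hp_point_inverse)

lemma hQ_hmk: "0 < p \<Longrightarrow> p * q - r\<^sup>2 = 1 \<Longrightarrow> hQ (hmk p r) = q"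
  unfolding hQ_def hmk_def cmod_power2
  by (simp add: hp_point_inverse field_simps power2_eq_square)

lemma dist_eq_if_cosh_le: "cosh (dist x y) \<le> cosh d \<Longrightarrow> 0 \<le> d \<Longrightarrow> dist x y \<le> d"
  by (simp add: cosh_real_nonneg_le_iff)

lemma cosh_dist_le_1D: "cosh (dist x y) \<le> 1 \<Longrightarrow> x = y"
  using dist_eq_if_cosh_le[of x y 0] by simp

text \<open>Barycentric coordinates on a segment of length \<open>D\<close>: the point at distance \<open>r\<close> from the
  first end has coordinates $\sinh(D-r)/\sinh D$ and $\sinh r/\sinh D$.\<close>

lemma barycentric_param:
  fixes D l m :: real
  assumes "0 \<le> D" "0 \<le> l" "0 \<le> m" "l\<^sup>2 + m\<^sup>2 + 2 * l * m * cosh D = 1"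
  obtains r where "0 \<le> r" "r \<le> D" "cosh r = l + m * cosh D" "cosh (D - r) = l * cosh D + m"
    "sinh r = m * sinh D" "sinh (D - r) = l * sinh D"
proof -
  define r where "r = arsinh (m * sinh D)"
  have s: "sinh r = m * sinh D" by (simp add: r_def)
  have "(l + m * cosh D)\<^sup>2 = (sinh r)\<^sup>2 + 1"
  proof -
    have "(l + m * cosh D)\<^sup>2 = (l\<^sup>2 + m\<^sup>2 + 2 * l * m * cosh D) + m\<^sup>2 * ((cosh D)\<^sup>2 - 1)"
      by (simp add: power2_eq_square algebra_simps)
    then show ?thesis unfolding assms(4) s by (simp add: cosh_square_eq power_mult_distrib)
  qed
  then have "(l + m * cosh D)\<^sup>2 = (cosh r)\<^sup>2" by (simp add: cosh_square_eq)
  then have c: "cosh r = l + m * cosh D"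
    using assms by (simp add: power2_eq_iff_nonneg)
  have sd: "sinh (D - r) = l * sinh D"
    by (simp add: sinh_diff s c algebra_simps)
  have cd: "cosh (D - r) = l * cosh D + m"
  proof -
    have "cosh (D - r) = l * cosh D + m * ((cosh D)\<^sup>2 - (sinh D)\<^sup>2)"
      unfolding cosh_diff s c by (simp add: power2_eq_square algebra_simps)
    then show ?thesis by (simp add: cosh_square_eq)
  qed
  have "0 \<le> sinh r" "0 \<le> sinh (D - r)" using assms by (simp_all add: s sd)
  then have "0 \<le> r" "r \<le> D" by simp_all
  with s c sd cd that show ?thesis by blast
qed

lemma barycentric_exists:
  fixes D r :: real
  assumes "0 \<le> r" "r \<le> D"
  obtains l m where "0 \<le> l" "0 \<le> m" "l\<^sup>2 + m\<^sup>2 + 2 * l * m * cosh D = 1"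
    "cosh r = l + m * cosh D" "cosh (D - r) = l * cosh D + m"
    "sinh r = m * sinh D" "sinh (D - r) = l * sinh D"
proof (cases "D = 0")
  case True
  then show ?thesis using that[of 1 0] assms by simp
next
  case False
  then have D: "0 < sinh D" using assms by simp
  define l m where "l = sinh (D - r) / sinh D" and "m = sinh r / sinh D"
  have s: "sinh r = m * sinh D" "sinh (D - r) = l * sinh D"
    using D by (simp_all add: l_def m_def)
  have "sinh D * cosh r = sinh (D - r) + sinh r * cosh D"
    by (simp add: sinh_diff)
  then have "sinh D * cosh r = sinh D * (l + m * cosh D)"
    unfolding s by (simp add: algebra_simps)
  then have c: "cosh r = l + m * cosh D" using D by simp
  have cd: "cosh (D - r) = l * cosh D + m"
  proof -
    have "cosh (D - r) = l * cosh D + m * ((cosh D)\<^sup>2 - (sinh D)\<^sup>2)"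
      unfolding cosh_diff s c by (simp add: power2_eq_square algebra_simps)
    then show ?thesis by (simp add: cosh_square_eq)
  qed
  have e: "l\<^sup>2 + m\<^sup>2 + 2 * l * m * cosh D = 1"
  proof -
    have "l\<^sup>2 + m\<^sup>2 + 2 * l * m * cosh D = (cosh r)\<^sup>2 - m\<^sup>2 * ((cosh D)\<^sup>2 - 1)"
      unfolding c by (simp add: power2_eq_square algebra_simps)
    also have "\<dots> = (cosh r)\<^sup>2 - (sinh r)\<^sup>2"
      unfolding s by (simp add: cosh_square_eq power_mult_distrib)
    finally show ?thesis by (simp add: cosh_square_eq)
  qed
  have "0 \<le> l" "0 \<le> m" unfolding l_def m_def using assms D by simp_all
  from that[OF this e c cd s] show ?thesis .
qed

text \<open>The determinant is a quadratic form whose polar form is the hyperbolic cosine of the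
  distance, so the last hypothesis says exactly that the combined coordinates have determinant
  one.\<close>

lemma hmk_combination:
  assumes "0 \<le> l" "0 \<le> m" "l\<^sup>2 + m\<^sup>2 + 2 * l * m * cosh (dist x y) = 1"
  obtains v where "hP v = l * hP x + m * hP y" "hQ v = l * hQ x + m * hQ y"
    "hR v = l * hR x + m * hR y"
proof -
  let ?p = "l * hP x + m * hP y" and ?q = "l * hQ x + m * hQ y" and ?r = "l * hR x + m * hR y"
  have "l \<noteq> 0 \<or> m \<noteq> 0" using assms by auto
  then have p: "0 < ?p"
    using assms(1,2) hP_pos[of x] hP_pos[of y]
    by (metis add_nonneg_pos add_pos_nonneg less_eq_real_def mult_nonneg_nonneg mult_pos_pos)
  have "?p * ?q - ?r\<^sup>2 = l\<^sup>2 * (hP x * hQ x - (hR x)\<^sup>2) + m\<^sup>2 * (hP y * hQ y - (hR y)\<^sup>2)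
      + 2 * l * m * cosh (dist x y)"
    unfolding cosh_dist_hyp by (simp add: power2_eq_square algebra_simps)
  also have "\<dots> = 1" unfolding hPQR using assms by simp
  finally show ?thesis
    using that[of "hmk ?p ?r"] p hQ_hmk[of ?p ?q ?r] by simp
qed

lemma cosh_dist_combination:
  assumes "hP v = l * hP x + m * hP y" "hQ v = l * hQ x + m * hQ y" "hR v = l * hR x + m * hR y"
  shows "cosh (dist z v) = l * cosh (dist z x) + m * cosh (dist z y)"
  unfolding cosh_dist_hyp assms by (simp add: algebra_simps add_divide_distrib)

text \<open>The combination with the barycentric coordinates of \<open>v\<close> is some point
  \<open>w\<close>. By bilinearity \<open>cosh (dist v w)\<close> equals the normalising quadratic
  form, that is one, so \<open>w\<close> is \<open>v\<close>.\<close>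

lemma hyp_between_coords:
  fixes x y v :: hyp_plane
  assumes "dist x v + dist v y = dist x y"
  obtains l m where "0 \<le> l" "0 \<le> m" 
    "sinh (dist x v) = m * sinh (dist x y)" "sinh (dist v y) = l * sinh (dist x y)"
    "hP v = l * hP x + m * hP y" "hQ v = l * hQ x + m * hQ y" "hR v = l * hR x + m * hR y"
proof -
  have "dist x v \<le> dist x y" using assms zero_le_dist[of v y] by linarith
  then obtain l m where lm: "0 \<le> l" "0 \<le> m" "l\<^sup>2 + m\<^sup>2 + 2 * l * m * cosh (dist x y) = 1"
    "cosh (dist x v) = l + m * cosh (dist x y)"
    "cosh (dist x y - dist x v) = l * cosh (dist x y) + m"
    "sinh (dist x v) = m * sinh (dist x y)" "sinh (dist x y - dist x v) = l * sinh (dist x y)"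
    by (rule barycentric_exists[OF zero_le_dist])
  have d: "dist x y - dist x v = dist v y" using assms by linarith
  obtain w where w: "hP w = l * hP x + m * hP y" "hQ w = l * hQ x + m * hQ y"
    "hR w = l * hR x + m * hR y"
    using hmk_combination[OF lm(1-3)] .
  have "cosh (dist v w) = l * cosh (dist v x) + m * cosh (dist v y)"
    by (rule cosh_dist_combination[OF w])
  also have "\<dots> = l * (l + m * cosh (dist x y)) + m * (l * cosh (dist x y) + m)"
    using lm(4,5) by (simp only: d dist_commute[of v x])
  also have "\<dots> = l\<^sup>2 + m\<^sup>2 + 2 * l * m * cosh (dist x y)" 
    by (simp add: power2_eq_square algebra_simps)
  also have "\<dots> = 1" by (rule lm(3))
  finally have "w = v" by (intro cosh_dist_le_1D[symmetric]) simp
  have "sinh (dist v y) = l * sinh (dist x y)" using lm(7) unfolding d .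
  from that[OF lm(1,2,6) this w[unfolded \<open>w = v\<close>]] show ?thesis .
qed

text \<open>In the hyperbolic plane the comparison holds with equality; this makes the plane itself
  an instance of the general theory.\<close>

lemma hyp_between_cosh:
  fixes x y v p :: hyp_plane
  assumes "dist x v + dist v y = dist x y"
  shows "cosh (dist p v) * sinh (dist x y)
    = sinh (dist v y) * cosh (dist p x) + sinh (dist x v) * cosh (dist p y)"
proof -
  obtain l m where lm: "0 \<le> l" "0 \<le> m" 
    "sinh (dist x v) = m * sinh (dist x y)" "sinh (dist v y) = l * sinh (dist x y)"
    and v: "hP v = l * hP x + m * hP y" "hQ v = l * hQ x + m * hQ y" "hR v = l * hR x + m * hR y"
    by (rule hyp_between_coords[OF assms])
  have "cosh (dist p v) = l * cosh (dist p x) + m * cosh (dist p y)"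
    by (rule cosh_dist_combination[OF v])
  with lm(3,4) show ?thesis by algebra
qed

text \<open>The unit speed line through $i$ whose initial direction is given by the unit vector
  \<open>(l, k)\<close>.\<close>

definition hray :: "real \<Rightarrow> real \<Rightarrow> real \<Rightarrow> hyp_plane" where
  "hray k l t = hmk (cosh t - k * sinh t) (l * sinh t)"

lemma hray_coords:
  assumes "k\<^sup>2 + l\<^sup>2 = 1"
  shows "hP (hray k l t) = cosh t - k * sinh t" "hQ (hray k l t) = cosh t + k * sinh t"
    "hR (hray k l t) = l * sinh t"
proof -
  have "k\<^sup>2 \<le> 1" using assms by (metis le_add_same_cancel1 zero_le_power2)
  then have k: "-1 \<le> k" "k \<le> 1" by (simp_all add: abs_square_le_1 abs_le_iff)
  \<comment> \<open>Both coefficients on the right are nonnegative and they do not vanish together,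
    so positivity of \<open>hP\<close> is visible in this form.\<close>
  have e: "2 * (cosh t - k * sinh t) = (1 - k) * exp t + (1 + k) * exp (- t)"
    by (simp add: cosh_field_def sinh_field_def field_simps)
  have "0 < (1 - k) * exp t + (1 + k) * exp (- t)"
  proof (cases "k = 1")
    case False
    then show ?thesis using k by (intro add_pos_nonneg mult_pos_pos mult_nonneg_nonneg) simp_all
  qed simp
  then have p: "0 < cosh t - k * sinh t" unfolding e[symmetric] by simp
  have "(cosh t - k * sinh t) * (cosh t + k * sinh t) - (l * sinh t)\<^sup>2 
     = (cosh t)\<^sup>2 - (k\<^sup>2 + l\<^sup>2) * (sinh t)\<^sup>2"
    by (simp add: power2_eq_square algebra_simps)
  also have "\<dots> = 1" by (simp add: assms cosh_square_eq)
  finally show "hQ (hray k l t) = cosh t + k * sinh t"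
    unfolding hray_def by (intro hQ_hmk p) 
  show "hP (hray k l t) = cosh t - k * sinh t" "hR (hray k l t) = l * sinh t"
    using p by (simp_all add: hray_def)
qed

lemma cosh_dist_hray:
  assumes "k\<^sup>2 + l\<^sup>2 = 1" "k'\<^sup>2 + l'\<^sup>2 = 1"
  shows "cosh (dist (hray k l s) (hray k' l' t))
    = cosh s * cosh t - (k * k' + l * l') * (sinh s * sinh t)"
  unfolding cosh_dist_hyp hray_coords[OF assms(1)] hray_coords[OF assms(2)]
  by (simp add: algebra_simps add_divide_distrib diff_divide_distrib)

lemma dist_hray:
  assumes "k\<^sup>2 + l\<^sup>2 = 1"
  shows "dist (hray k l s) (hray k l t) = \<bar>s - t\<bar>"
proof -
  have "cosh (dist (hray k l s) (hray k l t)) = cosh (s - t)"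
    using assms by (simp add: cosh_dist_hray cosh_diff power2_eq_square)
  then show ?thesis by simp
qed

text \<open>Coordinates are recovered linearly from distances to fixed points, so a Cauchy sequence
  has convergent coordinates. The determinant survives in the limit and excludes that
  \<open>hP\<close> tends to zero.\<close>

lemma complete_hyp: "complete (UNIV :: hyp_plane set)"
proof (rule completeI)
  fix z :: "nat \<Rightarrow> hyp_plane"
  assume "\<forall>n. z n \<in> UNIV" and C: "Cauchy z"
  have D: "\<exists>L. (\<lambda>n. cosh (dist (z n) p)) \<longlonglongrightarrow> L" for p
  proof -
    have "Cauchy (\<lambda>n. dist (z n) p)"
    proof (rule CauchyI)
      fix e :: real assume "0 < e"
      then obtain M where M: "\<forall>m\<ge>M. \<forall>n\<ge>M. dist (z m) (z n) < e"
        using C by (metis Cauchy_def)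
      have "\<bar>dist (z m) p - dist (z n) p\<bar> \<le> dist (z m) (z n)" for m n
        using dist_triangle[of "z m" p "z n"] dist_triangle[of "z n" p "z m"] dist_commute[of "z n" "z m"]
        by linarith
      then show "\<exists>M. \<forall>m\<ge>M. \<forall>n\<ge>M. norm (dist (z m) p - dist (z n) p) < e"
        using M by (intro exI[of _ M]) (metis le_less_trans real_norm_def)
    qed
    then obtain L where "(\<lambda>n. dist (z n) p) \<longlonglongrightarrow> L" by (auto simp: Cauchy_convergent_iff convergent_def)
    then show ?thesis by (auto intro: tendsto_cosh)
  qed
  \<comment> \<open>Three reference points with linearly independent coordinates; the hyperbolic
    cosines of the distances to them can be solved for the coordinates of
    \<open>z n\<close>.\<close>
  have c: "hP (hmk 1 0) = 1" "hQ (hmk 1 0) = 1" "hR (hmk 1 0) = 0"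
     "hP (hmk 2 0) = 2" "hQ (hmk 2 0) = 1/2" "hR (hmk 2 0) = 0"
     "hP (hmk 1 1) = 1" "hQ (hmk 1 1) = 2" "hR (hmk 1 1) = 1"
    using hQ_hmk[of 1 1 0] hQ_hmk[of 2 "1/2" 0] hQ_hmk[of 1 2 1] by simp_all
  obtain L1 L2 L3 where L: "(\<lambda>n. cosh (dist (z n) (hmk 1 0))) \<longlonglongrightarrow> L1"
    "(\<lambda>n. cosh (dist (z n) (hmk 2 0))) \<longlonglongrightarrow> L2" "(\<lambda>n. cosh (dist (z n) (hmk 1 1))) \<longlonglongrightarrow> L3"
    using D by metis
  have "(\<lambda>n. (4 * cosh (dist (z n) (hmk 2 0)) - 2 * cosh (dist (z n) (hmk 1 0))) * (1/3)) \<longlonglongrightarrow> (4 * L2 - 2 * L1) * (1/3)"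
    by (intro tendsto_intros L)
  then have "\<exists>q. (\<lambda>n. hQ (z n)) \<longlonglongrightarrow> q"
    by (intro exI) (erule Lim_transform_eventually, simp add: cosh_dist_hyp c field_simps)
  then obtain q where q: "(\<lambda>n. hQ (z n)) \<longlonglongrightarrow> q" by blast
  have "(\<lambda>n. 2 * cosh (dist (z n) (hmk 1 0)) - hQ (z n)) \<longlonglongrightarrow> 2 * L1 - q"
    by (intro tendsto_intros L q)
  then have "\<exists>p. (\<lambda>n. hP (z n)) \<longlonglongrightarrow> p"
    by (intro exI) (erule Lim_transform_eventually, simp add: cosh_dist_hyp c field_simps)
  then obtain p where p: "(\<lambda>n. hP (z n)) \<longlonglongrightarrow> p" by blast
  have "(\<lambda>n. (2 * hP (z n) + hQ (z n)) / 2 - cosh (dist (z n) (hmk 1 1))) \<longlonglongrightarrow> (2 * p + q) / 2 - L3"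
    by (intro tendsto_intros L q p) simp_all
  then have "\<exists>r. (\<lambda>n. hR (z n)) \<longlonglongrightarrow> r"
    by (intro exI) (erule Lim_transform_eventually, simp add: cosh_dist_hyp c field_simps)
  then obtain r where r: "(\<lambda>n. hR (z n)) \<longlonglongrightarrow> r" by blast
  have "(\<lambda>n. hP (z n) * hQ (z n) - (hR (z n))\<^sup>2) \<longlonglongrightarrow> p * q - r\<^sup>2"
    by (intro tendsto_intros p q r)
  then have pqr: "p * q - r\<^sup>2 = 1"
    unfolding hPQR by (metis LIMSEQ_const_iff)
  have "0 \<le> p" using p hP_pos by (metis LIMSEQ_le_const less_imp_le)
  moreover have "p \<noteq> 0" using pqr zero_le_power2[of r] by fastforce
  ultimately have p0: "0 < p" by simp
  let ?w = "hmk p r"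
  have "(\<lambda>n. (hP (z n) * q + hQ (z n) * p) / 2 - hR (z n) * r) \<longlonglongrightarrow> (p * q + q * p) / 2 - r * r"
    by (intro tendsto_intros p q r) simp
  moreover have "(p * q + q * p) / 2 - r * r = 1" using pqr by (simp add: power2_eq_square)
  ultimately have "(\<lambda>n. cosh (dist (z n) ?w)) \<longlonglongrightarrow> 1"
    by (simp add: cosh_dist_hyp p0 hQ_hmk[OF p0 pqr])
  then have "(\<lambda>n. arcosh (cosh (dist (z n) ?w))) \<longlonglongrightarrow> arcosh 1"
    by (intro continuous_on_tendsto_compose[OF continuous_on_arcosh, of "{1..}"])
      (auto simp: cosh_real_ge_1)
  then have "(\<lambda>n. dist (z n) ?w) \<longlonglongrightarrow> 0" by (simp add: arcosh_cosh_real)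
  then have "z \<longlonglongrightarrow> ?w" by (rule tendsto_dist_iff[THEN iffD2])
  then show "\<exists>l\<in>UNIV. z \<longlonglongrightarrow> l" by blast
qed

section \<open>Spaces satisfying the one-point comparison inequality\<close>

text \<open>Of the CAT(-1) condition only the comparison of a vertex with a point on the opposite side
  is needed; in the linear coordinates of the comparison plane it says that the hyperbolic cosine
  of the distance to \<open>p\<close> is dominated by its affine interpolation.\<close>

locale star_space =
  fixes X :: "'a::metric_space itself"
  assumes complete: "complete (UNIV :: 'a set)"
    and geodesic_exists: "\<exists>\<gamma>. geodesic_path \<gamma> (x :: 'a) y"
    and star: "dist x v + dist v y = dist x y \<Longrightarrow>
      cosh (dist p v) * sinh (dist x y)
        \<le> sinh (dist v y) * cosh (dist p x) + sinh (dist x v) * cosh (dist (p :: 'a) y)"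

text \<open>The point at distance \<open>r\<close> is chosen through its distances to all
  \<open>p\<close> at once. Taking for \<open>p\<close> first the ends and then another chosen point
  gives all distances along the path.\<close>

lemma hyp_geodesic_exists: "\<exists>\<gamma>. geodesic_path \<gamma> (x :: hyp_plane) y"
proof (cases "dist x y = 0")
  case True
  then show ?thesis by (intro exI[of _ "\<lambda>_. x"]) (simp add: geodesic_path_def)
next
  case False
  define d where "d = dist x y"
  have d: "0 < sinh d" using False by (simp add: d_def)
  have "\<exists>v. \<forall>p. cosh (dist p v) * sinh d = sinh (d - r) * cosh (dist p x) + sinh r * cosh (dist p y)"
    if r: "r \<in> {0..d}" for r
  proof -
    obtain l m where lm: "0 \<le> l" "0 \<le> m" "l\<^sup>2 + m\<^sup>2 + 2 * l * m * cosh d = 1"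
      "cosh r = l + m * cosh d" "cosh (d - r) = l * cosh d + m"
      "sinh r = m * sinh d" "sinh (d - r) = l * sinh d"
      using r by (auto elim: barycentric_exists)
    obtain v where "hP v = l * hP x + m * hP y" "hQ v = l * hQ x + m * hQ y"
      "hR v = l * hR x + m * hR y"
      using hmk_combination[OF lm(1-2) lm(3)[unfolded d_def]] .
    then have v: "cosh (dist p v) = l * cosh (dist p x) + m * cosh (dist p y)" for p
      by (rule cosh_dist_combination)
    have "cosh (dist p v) * sinh d = sinh (d - r) * cosh (dist p x) + sinh r * cosh (dist p y)" for p
      unfolding v lm(6,7) by (simp add: algebra_simps)
    then show ?thesis by blast
  qed
  then obtain \<gamma> where g: "\<And>r p. r \<in> {0..d} \<Longrightarrow>
      cosh (dist p (\<gamma> r)) * sinh d = sinh (d - r) * cosh (dist p x) + sinh r * cosh (dist p y)"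
    by metis
  have x: "dist x (\<gamma> r) = r" if r: "r \<in> {0..d}" for r
  proof -
    have "cosh (dist x (\<gamma> r)) * sinh d = sinh d * cosh r"
      unfolding g[OF r] d_def[symmetric] by (simp add: sinh_diff algebra_simps)
    then have "cosh (dist x (\<gamma> r)) = cosh r" using d by simp
    then show ?thesis using r by simp
  qed
  have y: "dist (\<gamma> r) y = d - r" if r: "r \<in> {0..d}" for r
  proof -
    have "cosh (dist y (\<gamma> r)) * sinh d = sinh (d - r) * cosh d + sinh r"
      unfolding g[OF r] dist_commute[of y x] d_def[symmetric] by simp
    also have "\<dots> = cosh (d - r) * sinh d + sinh r * (1 + (sinh d)\<^sup>2 - (cosh d)\<^sup>2)"
      by (simp add: sinh_diff cosh_diff power2_eq_square algebra_simps)
    also have "\<dots> = cosh (d - r) * sinh d" by (simp add: cosh_square_eq)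
    finally have "cosh (dist y (\<gamma> r)) = cosh (d - r)" using d by simp
    then show ?thesis using r by (simp add: dist_commute)
  qed
  have "dist (\<gamma> r) (\<gamma> s) = \<bar>r - s\<bar>" if r: "r \<in> {0..d}" and s: "s \<in> {0..d}" for r s
  proof -
    have "cosh (dist (\<gamma> r) (\<gamma> s)) * sinh d = sinh (d - s) * cosh r + sinh s * cosh (d - r)"
      unfolding g[OF s] dist_commute[of "\<gamma> r" x] x[OF r] y[OF r] ..
    also have "\<dots> = cosh (r - s) * sinh d"
      by (simp add: sinh_diff cosh_diff algebra_simps)
    finally have "cosh (dist (\<gamma> r) (\<gamma> s)) = cosh (r - s)" using d by simp
    then show ?thesis by simp
  qed
  moreover have "\<gamma> 0 = x" using x[of 0] by (simp add: d_def)
  moreover have "\<gamma> d = y" using y[of d] by (simp add: d_def)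
  ultimately have "geodesic_path \<gamma> x y" by (simp add: geodesic_path_def flip: d_def)
  then show ?thesis by blast
qed

interpretation hyp: star_space "TYPE(hyp_plane)"
  by unfold_locales (use complete_hyp hyp_geodesic_exists hyp_between_cosh in \<open>simp_all only: order_refl\<close>)

section \<open>From comparison triangles to the one-point inequality\<close>

text \<open>Puts every point between \<open>x\<close> and \<open>y\<close> on a geodesic path, since
  the comparison condition speaks of paths. Across the joint the triangle inequality is squeezed by
  the total length.\<close>

lemma geodesic_path_concat:
  assumes "geodesic_path \<gamma>1 x v" "geodesic_path \<gamma>2 v y" and b: "dist x v + dist v y = dist x y"
  shows "geodesic_path (\<lambda>t. if t \<le> dist x v then \<gamma>1 t else \<gamma>2 (t - dist x v)) x y"
proof -
  let ?a = "dist x v" and ?b = "dist v y"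
  have g1: "\<gamma>1 0 = x" "\<gamma>1 ?a = v" "\<And>s t. s \<in> {0..?a} \<Longrightarrow> t \<in> {0..?a} \<Longrightarrow> dist (\<gamma>1 s) (\<gamma>1 t) = \<bar>s - t\<bar>"
    using assms(1) by (auto simp: geodesic_path_def)
  have g2: "\<gamma>2 0 = v" "\<gamma>2 ?b = y" "\<And>s t. s \<in> {0..?b} \<Longrightarrow> t \<in> {0..?b} \<Longrightarrow> dist (\<gamma>2 s) (\<gamma>2 t) = \<bar>s - t\<bar>"
    using assms(2) by (auto simp: geodesic_path_def)
  have mixed: "dist (\<gamma>1 s) (\<gamma>2 u) = ?a - s + u" if "s \<in> {0..?a}" "u \<in> {0..?b}" for s u
  proof -
    have "dist (\<gamma>1 s) v = ?a - s" "dist x (\<gamma>1 s) = s" "dist v (\<gamma>2 u) = u" "dist (\<gamma>2 u) y = ?b - u"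
      using g1(3)[of s ?a] g1(3)[of 0 s] g2(3)[of 0 u] g2(3)[of u ?b] g1 g2 that by auto
    then show ?thesis
      using b dist_triangle[of "\<gamma>1 s" "\<gamma>2 u" v] dist_triangle[of x y "\<gamma>1 s"]
        dist_triangle[of "\<gamma>1 s" y "\<gamma>2 u"] by linarith
  qed
  have m: "dist (if s \<le> ?a then \<gamma>1 s else \<gamma>2 (s - ?a)) (if t \<le> ?a then \<gamma>1 t else \<gamma>2 (t - ?a)) = \<bar>s - t\<bar>"
    if s: "0 \<le> s" "s \<le> dist x y" and t: "0 \<le> t" "t \<le> dist x y" for s t
  proof -
    have i: "s - ?a \<le> ?b" "t - ?a \<le> ?b" using s t b by linarith+
    consider "s \<le> ?a" "t \<le> ?a" | "s \<le> ?a" "\<not> t \<le> ?a" | "\<not> s \<le> ?a" "t \<le> ?a" | "\<not> s \<le> ?a" "\<not> t \<le> ?a"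
      by blast
    then show ?thesis
    proof cases
      case 1 then show ?thesis using g1(3)[of s t] s t by simp
    next
      case 2 then show ?thesis using mixed[of s "t - ?a"] s t i by simp
    next
      case 3 then show ?thesis using mixed[of t "s - ?a"] s t i by (simp add: dist_commute)
    next
      case 4 then show ?thesis using g2(3)[of "s - ?a" "t - ?a"] s t i by simp
    qed
  qed
  have e: "(if dist x y \<le> ?a then \<gamma>1 (dist x y) else \<gamma>2 (dist x y - ?a)) = y"
  proof (cases "dist x y \<le> ?a")
    case True
    then have "v = y" using b by (smt (verit) zero_le_dist dist_eq_0_iff)
    with True b show ?thesis using g1 by auto
  next
    case False
    have "dist x y - ?a = ?b" using b by linarith
    then show ?thesis using False g2(2) by (simp only: if_False)
  qed
  show ?thesis unfolding geodesic_path_def using m e g1(1) by simp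
qed

lemma geodesic_path_hray:
  assumes "k\<^sup>2 + l\<^sup>2 = 1" "0 \<le> t"
  shows "geodesic_path (hray k l) (hray 1 0 0) (hray k l t)"
proof -
  have 0: "hray 1 0 0 = hray k l 0" by (simp add: hray_def)
  show ?thesis unfolding 0 geodesic_path_def using dist_hray[OF assms(1)] assms(2) by simp
qed

text \<open>The law of cosines solved for the cosine of the angle; the triangle inequalities amount
  to the bounds on \<open>k\<close>. If a side at the vertex vanishes, the coefficient of
  \<open>k\<close> is zero and \<open>k = 0\<close> serves.\<close>

lemma cosine_exists:
  fixes A b c :: real
  assumes "0 \<le> A" "0 \<le> b" "0 \<le> c" "c \<le> A + b" "A \<le> b + c" "b \<le> A + c"
  obtains k where "-1 \<le> k" "k \<le> 1" "cosh c = cosh A * cosh b - k * (sinh A * sinh b)"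
proof (cases "A = 0 \<or> b = 0")
  case True
  then have "cosh A * cosh b = cosh c"
  proof
    assume "A = 0" then have "c = b" using assms by linarith
    then show ?thesis using \<open>A = 0\<close> by simp
  next
    assume "b = 0" then have "c = A" using assms by linarith
    then show ?thesis using \<open>b = 0\<close> by simp
  qed
  then show ?thesis using that[of 0] by simp
next
  case False
  then have s: "0 < sinh A * sinh b" using assms by simp
  define k where "k = (cosh A * cosh b - cosh c) / (sinh A * sinh b)"
  have "cosh c \<le> cosh (A + b)" "cosh (A - b) \<le> cosh c"
    using assms cosh_real_nonneg_le_iff[of "\<bar>A - b\<bar>" c] by (simp_all add: cosh_real_nonneg_le_iff)
  then have "- 1 \<le> k" "k \<le> 1"
    using s by (simp_all add: k_def cosh_add cosh_diff pos_le_divide_eq pos_divide_le_eq)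
  moreover have "k * (sinh A * sinh b) = cosh A * cosh b - cosh c"
    by (rule iffD1[OF nonzero_eq_divide_eq k_def]) (use s in linarith)
  then have "cosh c = cosh A * cosh b - k * (sinh A * sinh b)" by simp
  ultimately show ?thesis by (rule that)
qed

theorem cat_minus_one_imp_star_space:
  assumes cat: "cat_minus_one TYPE('a::metric_space)"
  shows "star_space TYPE('a)"
proof
  show "complete (UNIV :: 'a set)" "\<exists>\<gamma>. geodesic_path \<gamma> x y" for x y :: 'a
    using cat by (auto simp: cat_minus_one_def)
  fix x v y p :: 'a
  assume b: "dist x v + dist v y = dist x y"
  have geo: "\<exists>\<gamma>. geodesic_path \<gamma> x y" for x y :: 'a
    using cat by (auto simp: cat_minus_one_def)
  have thin: "dist (\<alpha> s) (\<beta> t) \<le> dist (\<alpha>' s) (\<beta>' t)"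
    if "geodesic_path \<alpha> x y" "geodesic_path \<beta> x z"
        "dist x' y' = dist x y" "dist x' z' = dist x z" "dist y' z' = dist y z"
        "geodesic_path \<alpha>' x' y'" "geodesic_path \<beta>' x' z'" "s\<in>{0..dist x y}" "t\<in>{0..dist x z}"
    for x y z :: 'a and x' y' z' :: hyp_plane and \<alpha> \<beta> \<alpha>' \<beta>' s t
    using cat that unfolding cat_minus_one_def by blast
  obtain \<gamma>1 \<gamma>2 \<beta> where g: "geodesic_path \<gamma>1 x v" "geodesic_path \<gamma>2 v y" and be: "geodesic_path \<beta> x p"
    using geo by metis
  define \<alpha> where "\<alpha> = (\<lambda>t. if t \<le> dist x v then \<gamma>1 t else \<gamma>2 (t - dist x v))"
  have al: "geodesic_path \<alpha> x y" unfolding \<alpha>_def by (rule geodesic_path_concat[OF g b])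
  define A B C s where "A = dist x y" and "B = dist x p" and "C = dist y p" and "s = dist x v"
  have s: "0 \<le> s" "s \<le> A" "dist v y = A - s" 
    using b zero_le_dist[of v y] zero_le_dist[of x v] unfolding A_def s_def by linarith+
  have als: "\<alpha> s = v" using g(1) by (simp add: \<alpha>_def s_def geodesic_path_def)
  have beB: "\<beta> B = p" using be by (simp add: B_def geodesic_path_def)
  obtain k where k: "-1 \<le> k" "k \<le> 1" and kC: "cosh C = cosh A * cosh B - k * (sinh A * sinh B)"
  proof (rule cosine_exists[of A B C])
    show "C \<le> A + B" "A \<le> B + C" "B \<le> A + C"
      unfolding A_def B_def C_def by (metis dist_triangle dist_commute add.commute)+
  qed (simp_all add: A_def B_def C_def)
  \<comment> \<open>\<open>k\<close> and \<open>l\<close> are cosine and sine of the comparison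
    angle at \<open>x\<close>. The comparison triangle has this vertex at i and its sides along
    \<open>hray 1 0\<close> and \<open>hray k l\<close>.\<close>
  define l where "l = sqrt (1 - k\<^sup>2)"
  have "k\<^sup>2 \<le> 1" using k by (simp add: abs_square_le_1)
  then have kl: "k\<^sup>2 + l\<^sup>2 = 1" by (simp add: l_def)
  have A0: "0 \<le> A" and B0: "0 \<le> B" and C0: "0 \<le> C" by (simp_all add: A_def B_def C_def)
  have x': "hray 1 0 0 = hray k l 0" by (simp add: hray_def)
  have dA: "dist (hray 1 0 0) (hray 1 0 A) = A" using dist_hray[of 1 0 0 A] A0 by simp
  have dB: "dist (hray 1 0 0) (hray k l B) = B" unfolding x' using dist_hray[OF kl, of 0 B] B0 by simp
  have "cosh (dist (hray 1 0 A) (hray k l B)) = cosh C"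
    using cosh_dist_hray[OF _ kl, of 1 0 A B] kC by simp
  then have dC: "dist (hray 1 0 A) (hray k l B) = C" using C0 by simp
  \<comment> \<open>The second parameter is the full length \<open>B\<close>: the point
    \<open>v\<close> is compared with the vertex \<open>p\<close>.\<close>
  have "dist (\<alpha> s) (\<beta> B) \<le> dist (hray 1 0 s) (hray k l B)"
    using s A0 B0 dA dB dC
    by (intro thin[OF al be, of "hray 1 0 0" "hray 1 0 A" "hray k l B"])
      (simp_all add: A_def B_def C_def geodesic_path_hray kl)
  then have "dist p v \<le> dist (hray 1 0 s) (hray k l B)" by (simp add: als beB dist_commute)
  then have "cosh (dist p v) \<le> cosh (dist (hray 1 0 s) (hray k l B))"
    by (simp add: cosh_real_nonneg_le_iff)
  also have "\<dots> = cosh s * cosh B - k * (sinh s * sinh B)"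
    using cosh_dist_hray[OF _ kl, of 1 0 s B] by simp
  finally have "cosh (dist p v) * sinh A \<le> (cosh s * cosh B - k * (sinh s * sinh B)) * sinh A"
    using A0 by (intro mult_right_mono) simp_all
  also have "\<dots> = sinh A * cosh s * cosh B - sinh s * (k * (sinh A * sinh B))"
    by (simp add: algebra_simps)
  also have "k * (sinh A * sinh B) = cosh A * cosh B - cosh C" using kC by simp
  also have "sinh A * cosh s * cosh B - sinh s * (cosh A * cosh B - cosh C) 
      = sinh (A - s) * cosh B + sinh s * cosh C"
    by (simp add: sinh_diff algebra_simps)
  finally show "cosh (dist p v) * sinh (dist x y)
      \<le> sinh (dist v y) * cosh (dist p x) + sinh (dist x v) * cosh (dist p y)"
    unfolding s(3) by (simp add: A_def B_def C_def s_def dist_commute)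
qed

section \<open>The four point inequality\<close>

context star_space
begin

lemma between_point:
  assumes "0 \<le> r" "r \<le> dist x (y :: 'a)"
  obtains v where "dist x v = r" "dist v y = dist x y - r"
proof -
  obtain \<gamma> where g: "geodesic_path \<gamma> x y" using geodesic_exists by blast
  have e: "\<gamma> 0 = x" "\<gamma> (dist x y) = y"
    and d: "\<And>s t. s \<in> {0..dist x y} \<Longrightarrow> t \<in> {0..dist x y} \<Longrightarrow> dist (\<gamma> s) (\<gamma> t) = \<bar>s - t\<bar>"
    using g unfolding geodesic_path_def by blast+
  show ?thesis using d[of 0 r] d[of r "dist x y"] assms that[of "\<gamma> r"] by (simp add: e)
qed

text \<open>The quotient of sinh c by sinh (a + c) is at most exp (-a). Such coefficients stay
  manageable when the ends of the segment run to infinity, and the loss disappears in the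
  limit.\<close>

lemma cosh_between_le:
  assumes b: "dist x v + dist v y = dist x (y :: 'a)"
  shows "cosh (dist p v) \<le> exp (- dist x v) * cosh (dist p x) + exp (- dist v y) * cosh (dist p y)"
proof (cases "dist x y = 0")
  case True
  then have "dist x v = 0" "dist v y = 0" using b zero_le_dist[of x v] zero_le_dist[of v y] by linarith+
  then show ?thesis by simp
next
  case False
  have ratio: "sinh c \<le> exp (- a) * sinh (a + c)" if "0 \<le> a" "0 \<le> c" for a c :: real
  proof -
    have "sinh c * exp a \<le> sinh a * cosh c + cosh a * sinh c"
      using that mult_left_mono[OF sinh_le_cosh_real[of c], of "sinh a"]
      by (simp add: sinh_plus_cosh[symmetric] algebra_simps)
    then have "sinh c * exp a \<le> sinh (a + c)" by (simp add: sinh_add)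
    then have "exp (- a) * (sinh c * exp a) \<le> exp (- a) * sinh (a + c)" by simp
    then show ?thesis by (simp add: exp_minus field_simps)
  qed
  have D: "0 < sinh (dist x y)" using False by simp
  have "cosh (dist p v) * sinh (dist x y)
        \<le> sinh (dist v y) * cosh (dist p x) + sinh (dist x v) * cosh (dist p y)"
    by (rule star[OF b])
  also have "\<dots> \<le> (exp (- dist x v) * sinh (dist x y)) * cosh (dist p x)
      + (exp (- dist v y) * sinh (dist x y)) * cosh (dist p y)"
    using ratio[of "dist x v" "dist v y"] ratio[of "dist v y" "dist x v"] b
    by (intro add_mono mult_right_mono) (simp_all add: add.commute)
  also have "\<dots> = (exp (- dist x v) * cosh (dist p x) + exp (- dist v y) * cosh (dist p y)) * sinh (dist x y)"
    by (simp add: algebra_simps)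
  finally show ?thesis using D by simp
qed

text \<open>Counterpart of \<open>hmk_combination\<close> in \<open>X\<close>: normalised
  coefficients still define a point on the segment, with the same distances to the ends as in the
  plane, but other distances are only bounded above.\<close>

lemma barycenter:
  assumes "0 \<le> l" "0 \<le> m" "l\<^sup>2 + m\<^sup>2 + 2 * l * m * cosh (dist x (y :: 'a)) = 1"
  obtains v where "dist x v + dist v y = dist x y"
    "cosh (dist x v) = l + m * cosh (dist x y)" "cosh (dist v y) = l * cosh (dist x y) + m"
    "\<And>p. cosh (dist p v) \<le> l * cosh (dist p x) + m * cosh (dist p y)"
proof -
  obtain r where r: "0 \<le> r" "r \<le> dist x y" "cosh r = l + m * cosh (dist x y)"
    "cosh (dist x y - r) = l * cosh (dist x y) + m"
    "sinh r = m * sinh (dist x y)" "sinh (dist x y - r) = l * sinh (dist x y)"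
    by (rule barycentric_param[OF zero_le_dist assms])
  obtain v where v: "dist x v = r" "dist v y = dist x y - r"
    using between_point[OF r(1,2)] .
  have b: "dist x v + dist v y = dist x y" unfolding v by simp
  have "cosh (dist p v) \<le> l * cosh (dist p x) + m * cosh (dist p y)" for p
  proof (cases "x = y")
    case True
    then have "(l + m)\<^sup>2 = 1" using assms(3) by (simp add: power2_eq_square algebra_simps)
    then have "l + m = 1" using assms(1,2) by (simp add: power2_eq_1_iff)
    moreover have "v = y" using b True zero_le_dist[of y v] by (simp add: dist_commute)
    ultimately show ?thesis using True by (simp flip: distrib_right)
  next
    case False
    then have D: "0 < sinh (dist x y)" by simp
    have "cosh (dist p v) * sinh (dist x y) \<le> (l * cosh (dist p x) + m * cosh (dist p y)) * sinh (dist x y)"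
      using star[OF b, of p] unfolding v r(5,6) by (simp add: algebra_simps)
    then show ?thesis using D by simp
  qed
  then show ?thesis using that[OF b] r(3,4) v by simp
qed

text \<open>Travel from \<open>x\<close> to \<open>w\<close> through the optimal point of the segment from \<open>u\<close> to \<open>z\<close>.\<close>

lemma ptolemy_cosh:
  fixes x w u z :: 'a
  shows "exp ((dist x w + dist u z) / 2)
    \<le> 2 * (sqrt (cosh (dist x u)) * sqrt (cosh (dist w z)) + sqrt (cosh (dist x z)) * sqrt (cosh (dist w u)))"
proof -
  define d where "d = dist u z"
  define a b c e where "a = cosh (dist x u)" and "b = cosh (dist x z)"
    and "c = cosh (dist w u)" and "e = cosh (dist w z)"
  have pos: "0 < a" "0 < b" "0 < c" "0 < e" by (simp_all add: a_def b_def c_def e_def)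
  \<comment> \<open>Serves to show that the parameter \<open>s\<close> chosen below lies on the
    segment.\<close>
  have comp: "cosh (dist p q) \<le> exp (dist q r) * cosh (dist p r)" for p q r :: 'a
  proof -
    have "cosh (dist p q) \<le> cosh (dist q r + dist p r)"
      using dist_triangle[of p q r] by (simp add: cosh_real_nonneg_le_iff dist_commute)
    also have "\<dots> \<le> (cosh (dist q r) + sinh (dist q r)) * cosh (dist p r)"
      using mult_left_mono[OF sinh_le_cosh_real[of "dist p r"], of "sinh (dist q r)"]
      by (simp add: cosh_add algebra_simps)
    finally show ?thesis by (simp add: cosh_plus_sinh)
  qed
  have ab: "a \<le> exp d * b" "b \<le> exp d * a" "c \<le> exp d * e" "e \<le> exp d * c"
    unfolding a_def b_def c_def e_def d_def
    using comp[of x u z] comp[of x z u] comp[of w u z] comp[of w z u] by (simp_all add: dist_commute)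
  \<comment> \<open>The product of the bounds \<open>X\<close> and \<open>W\<close> below consists
    of exp (-2s) ac, exp (2(s-d)) be and a term free of \<open>s\<close>. The first two have
    constant product, so their sum is smallest where they agree, which gives this
    \<open>s\<close>.\<close>
  define s where "s = d / 2 + (ln (a * c) - ln (b * e)) / 4"
  have "a * c \<le> (exp d * b) * (exp d * e)" "b * e \<le> (exp d * a) * (exp d * c)"
    using ab pos by (intro mult_mono; simp)+
  then have "a * c \<le> exp (2 * d) * (b * e)" "b * e \<le> exp (2 * d) * (a * c)"
    by (simp_all add: mult_exp_exp mult_ac flip: mult_2)
  then have "ln (a * c) \<le> ln (exp (2 * d) * (b * e))" "ln (b * e) \<le> ln (exp (2 * d) * (a * c))"
    using pos by simp_all
  then have "ln (a * c) \<le> 2 * d + ln (b * e)" "ln (b * e) \<le> 2 * d + ln (a * c)"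
    using pos by (simp_all add: ln_mult)
  then have s: "0 \<le> s" "s \<le> dist u z" by (simp_all add: s_def field_simps flip: d_def)
  then obtain m where m: "dist u m = s" "dist m z = d - s" 
    using between_point unfolding d_def by blast
  have bt: "dist u m + dist m z = dist u z" using m by (simp add: d_def)
  have X: "cosh (dist x m) \<le> exp (- s) * a + exp (s - d) * b"
    using cosh_between_le[OF bt, of x] m by (simp add: a_def b_def)
  have W: "cosh (dist w m) \<le> exp (- s) * c + exp (s - d) * e"
    using cosh_between_le[OF bt, of w] m by (simp add: c_def e_def)
  have ec: "exp t \<le> 2 * cosh t" for t :: real by (simp add: cosh_field_def)
  define g where "g = sqrt (a * c * (b * e))"
  have "exp (2 * s) = exp d * exp ((ln (a * c) - ln (b * e)) / 2)"
    by (simp add: s_def mult_exp_exp)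
  also have "exp ((ln (a * c) - ln (b * e)) / 2) = sqrt (exp (ln (a * c) - ln (b * e)))"
    by (intro real_sqrt_unique[symmetric]) (simp_all add: power2_eq_square mult_exp_exp)
  also have "exp (ln (a * c) - ln (b * e)) = (a * c) / (b * e)" using pos by (simp add: exp_diff)
  finally have e2: "exp (2 * s) = exp d * sqrt ((a * c) / (b * e))" .
  have h1: "sqrt (a * c / (b * e)) * (b * e) = g"
    unfolding g_def
  proof (intro real_sqrt_unique[symmetric])
    have "(sqrt (a * c / (b * e)) * (b * e))\<^sup>2 = a * c / (b * e) * (b * e)\<^sup>2"
      using pos by (subst power_mult_distrib, subst real_sqrt_pow2) simp_all
    also have "\<dots> = a * c * (b * e)" using pos by (simp add: power2_eq_square)
    finally show "(sqrt (a * c / (b * e)) * (b * e))\<^sup>2 = a * c * (b * e)" .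
  qed (use pos in simp)
  have h2: "g * sqrt (a * c / (b * e)) = a * c"
  proof -
    have "g * sqrt (a * c / (b * e)) = (sqrt (a * c / (b * e)) * sqrt (a * c / (b * e))) * (b * e)"
      unfolding h1[symmetric] by (simp only: mult_ac)
    also have "\<dots> = a * c / (b * e) * (b * e)" using pos by (subst real_sqrt_mult_self) simp
    finally show ?thesis using pos by simp
  qed
  have e3: "exp (2 * (s - d)) * (b * e) = exp (- d) * g"
  proof -
    have "exp (2 * (s - d)) = exp (2 * s) * exp (- 2 * d)" by (simp add: mult_exp_exp algebra_simps)
    also have "\<dots> = exp (- d) * sqrt ((a * c) / (b * e))"
      unfolding e2 using exp_add[of d "- 2 * d"] by simp
    finally show ?thesis unfolding h1[symmetric] by (simp only: mult.assoc)
  qed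
  have e4: "exp (- 2 * s) * (a * c) = exp (- d) * g"
  proof -
    have "exp (- 2 * s) = inverse (exp (2 * s))" using exp_minus[of "2 * s"] by simp
    then have "exp (- 2 * s) = exp (- d) * inverse (sqrt (a * c / (b * e)))"
      by (simp add: e2 exp_minus)
    then have "exp (- 2 * s) * (a * c)
        = exp (- d) * inverse (sqrt (a * c / (b * e))) * (g * sqrt (a * c / (b * e)))"
      by (simp only: h2)
    moreover have "sqrt (a * c / (b * e)) \<noteq> 0" using pos by simp
    ultimately show ?thesis by simp
  qed
  have "exp (dist x w) \<le> exp (dist x m) * exp (dist w m)"
    using dist_triangle[of x w m] by (simp add: mult_exp_exp dist_commute)
  also have "\<dots> \<le> (2 * cosh (dist x m)) * (2 * cosh (dist w m))"
    by (intro mult_mono ec) simp_all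
  also have "\<dots> \<le> (2 * (exp (- s) * a + exp (s - d) * b)) * (2 * (exp (- s) * c + exp (s - d) * e))"
    using X W pos by (intro mult_mono) simp_all
  also have "\<dots> = 4 * ((exp (- s) * exp (- s)) * (a * c) + (exp (s - d) * exp (s - d)) * (b * e)
      + (exp (- s) * exp (s - d)) * (a * e + b * c))"
    by (simp add: algebra_simps)
  also have "\<dots> = 4 * (exp (- 2 * s) * (a * c) + exp (2 * (s - d)) * (b * e) + exp (- d) * (a * e + b * c))"
    by (simp add: mult_exp_exp)
  also have "\<dots> = exp (- d) * (4 * (2 * g + a * e + b * c))"
    unfolding e3 e4 by (simp add: algebra_simps)
  \<comment> \<open>With the two terms balanced, the whole sum is a complete square.\<close>
  also have "4 * (2 * g + a * e + b * c) = 4 * (2 * (sqrt a * sqrt e * (sqrt b * sqrt c))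
      + (sqrt a * sqrt a) * (sqrt e * sqrt e) + (sqrt b * sqrt b) * (sqrt c * sqrt c))"
    using pos by (simp add: g_def real_sqrt_mult)
  also have "\<dots> = (2 * (sqrt a * sqrt e + sqrt b * sqrt c))\<^sup>2"
    unfolding power2_eq_square by (simp only: algebra_simps)
  finally have "exp d * exp (dist x w) \<le> exp d * (exp (- d) * (2 * (sqrt a * sqrt e + sqrt b * sqrt c))\<^sup>2)"
    by (intro mult_left_mono) simp_all
  then have "exp (dist x w + d) \<le> (2 * (sqrt a * sqrt e + sqrt b * sqrt c))\<^sup>2"
    by (simp add: mult_exp_exp add.commute flip: mult.assoc)
  moreover have "exp (dist x w + d) = (exp ((dist x w + d) / 2))\<^sup>2"
    by (simp add: power2_eq_square mult_exp_exp)
  ultimately have "(exp ((dist x w + d) / 2))\<^sup>2 \<le> (2 * (sqrt a * sqrt e + sqrt b * sqrt c))\<^sup>2"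
    by (simp only:)
  moreover have "0 \<le> 2 * (sqrt a * sqrt e + sqrt b * sqrt c)" using pos by simp
  ultimately have "exp ((dist x w + d) / 2) \<le> 2 * (sqrt a * sqrt e + sqrt b * sqrt c)"
    by (rule power2_le_imp_le)
  then show ?thesis by (simp add: a_def b_def c_def e_def d_def)
qed

text \<open>The square roots give way to exp (t/2) plus one. After multiplication by
  \<open>eps\<close> at the four points these ones become products of two \<open>eps\<close> values,
  which vanish at infinity.\<close>

lemma ptolemy_exp:
  fixes x w u z :: 'a
  shows "exp ((dist x w + dist u z) / 2)
    \<le> (exp (dist x u / 2) + 1) * (exp (dist w z / 2) + 1) + (exp (dist x z / 2) + 1) * (exp (dist w u / 2) + 1)"
proof -
  have k: "sqrt 2 * sqrt (cosh t) \<le> exp (t / 2) + 1" if "0 \<le> t" for t :: real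
  proof -
    have "2 * cosh t = exp t + exp (- t)" by (simp add: cosh_field_def)
    also have "\<dots> \<le> exp t + 1" using that by simp
    also have "\<dots> \<le> (exp (t / 2) + 1)\<^sup>2"
      using exp_double[of "t / 2"] by (simp add: power2_eq_square algebra_simps)
    finally have "sqrt (2 * cosh t) \<le> exp (t / 2) + 1"
      by (intro real_le_lsqrt) (simp_all add: add_nonneg_nonneg)
    then show ?thesis by (simp add: real_sqrt_mult)
  qed
  have h: "2 * (p * q) = (sqrt 2 * p) * (sqrt 2 * q)" for p q :: real
  proof -
    have "(sqrt 2 * p) * (sqrt 2 * q) = (sqrt 2 * sqrt 2) * (p * q)" by (simp only: mult_ac)
    then show ?thesis by simp
  qed
  have "2 * (sqrt (cosh (dist x u)) * sqrt (cosh (dist w z)) + sqrt (cosh (dist x z)) * sqrt (cosh (dist w u)))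
    = (sqrt 2 * sqrt (cosh (dist x u))) * (sqrt 2 * sqrt (cosh (dist w z)))
      + (sqrt 2 * sqrt (cosh (dist x z))) * (sqrt 2 * sqrt (cosh (dist w u)))"
    by (simp only: distrib_left h)
  also have "\<dots> \<le> (exp (dist x u / 2) + 1) * (exp (dist w z / 2) + 1)
      + (exp (dist x z / 2) + 1) * (exp (dist w u / 2) + 1)"
    by (intro add_mono mult_mono k) (simp_all add: add_nonneg_nonneg)
  finally show ?thesis using ptolemy_cosh[of x w u z] by linarith
qed

end

section \<open>Gromov products and the boundary\<close>

text \<open>The Bourdon expression for points of the space. It stays in (0, 1] while Gromov products
  are unbounded, so convergence to infinity becomes convergence to zero.\<close>

definition rho :: "'a::metric_space \<Rightarrow> 'a \<Rightarrow> 'a \<Rightarrow> real" where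
  "rho p x y = exp (- gromov_product p x y)"

text \<open>The square root of \<open>rho p x x\<close>. It tends to zero along sequences converging
  to infinity and measures all error terms.\<close>

definition eps :: "'a::metric_space \<Rightarrow> 'a \<Rightarrow> real" where
  "eps p x = exp (- dist p x / 2)"

lemma rho_altdef: "rho p x y = exp (dist x y / 2) * (eps p x * eps p y)"
  by (simp add: rho_def eps_def gromov_product_def mult_exp_exp field_simps)

lemma rho_pos [simp]: "0 < rho p x y" "0 \<le> rho p x y"
  by (simp_all add: rho_def)

lemma eps_pos [simp]: "0 < eps p x" "0 \<le> eps p x"
  by (simp_all add: eps_def)

lemma eps_nonzero [simp]: "eps p x \<noteq> 0"
  by (simp add: eps_def)

lemma rho_nonzero [simp]: "rho p x y \<noteq> 0"
  by (simp add: rho_def)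

lemma eps_le_1 [simp]: "eps p x \<le> 1"
  by (simp add: eps_def)

lemma eps_self [simp]: "eps p p = 1"
  by (simp add: eps_def)

lemma rho_commute: "rho p x y = rho p y x"
  by (simp add: rho_def gromov_product_def dist_commute add.commute)

lemma rho_self: "rho p x x = (eps p x)\<^sup>2"
  by (simp add: rho_altdef power2_eq_square)

lemma rho_base [simp]: "rho p x p = 1" "rho p p x = 1"
  by (simp_all add: rho_def gromov_product_def dist_commute)

lemma rho_le_1 [simp]: "rho p x y \<le> 1"
  using dist_triangle2[of x y p] by (simp add: rho_def gromov_product_def dist_commute)

lemma rho_change_base: "rho q x y \<le> exp (dist p q) * rho p x y"
proof -
  have "- gromov_product q x y \<le> dist p q + - gromov_product p x y"
    using dist_triangle[of p x q] dist_triangle[of p y q]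
    unfolding gromov_product_def by (simp add: field_simps)
  then show ?thesis unfolding rho_def by (simp add: mult_exp_exp)
qed

lemma rho_perturb: "rho p x' y \<le> exp (dist x x') * rho p x y"
proof -
  have "- gromov_product p x' y \<le> dist x x' + - gromov_product p x y"
    using dist_triangle[of p x x'] dist_triangle[of x' y x]
    unfolding gromov_product_def by (simp add: field_simps dist_commute)
  then show ?thesis unfolding rho_def by (simp add: mult_exp_exp)
qed

lemma exp_uminus_tendsto_0_iff: "((\<lambda>x. exp (- f x)) \<longlongrightarrow> 0) F \<longleftrightarrow> filterlim f at_top F" for f :: "_ \<Rightarrow> real"
proof
  assume "((\<lambda>x. exp (- f x)) \<longlongrightarrow> 0) F"
  then have "filterlim (\<lambda>x. exp (- f x)) (at_right 0) F"
    by (auto simp: filterlim_at)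
  from filterlim_compose[OF ln_at_0 this] show "filterlim f at_top F"
    by (simp add: filterlim_uminus_at_top)
next
  assume "filterlim f at_top F"
  then have "filterlim (\<lambda>x. - f x) at_bot F" by (simp add: filterlim_uminus_at_top)
  from filterlim_compose[OF exp_at_bot this] show "((\<lambda>x. exp (- f x)) \<longlongrightarrow> 0) F" .
qed

lemma converges_to_infinity_iff:
  "converges_to_infinity Z \<longleftrightarrow> (\<forall>e>0. \<exists>N. \<forall>i\<ge>N. \<forall>j\<ge>N. rho p (Z i) (Z j) < e)"
proof -
  have *: "filterlim (\<lambda>(i, j). gromov_product q (Z i) (Z j)) at_top (sequentially \<times>\<^sub>F sequentially)
      \<longleftrightarrow> (\<forall>e>0. \<exists>N. \<forall>i\<ge>N. \<forall>j\<ge>N. rho q (Z i) (Z j) < e)" for q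
    by (subst exp_uminus_tendsto_0_iff[symmetric])
      (simp add: tendsto_iff eventually_prod_sequentially rho_def case_prod_beta, blast)
  have "\<forall>e>0. \<exists>N. \<forall>i\<ge>N. \<forall>j\<ge>N. rho q (Z i) (Z j) < e"
    if a: "\<forall>e>0. \<exists>N. \<forall>i\<ge>N. \<forall>j\<ge>N. rho p (Z i) (Z j) < e" for q
  proof (intro allI impI)
    fix e :: real assume "0 < e"
    then have "0 < e / exp (dist p q)" by simp
    then obtain N where "\<forall>i\<ge>N. \<forall>j\<ge>N. rho p (Z i) (Z j) < e / exp (dist p q)" using a by blast
    then have "\<forall>i\<ge>N. \<forall>j\<ge>N. exp (dist p q) * rho p (Z i) (Z j) < e"
      by (simp add: pos_less_divide_eq mult.commute)
    then show "\<exists>N. \<forall>i\<ge>N. \<forall>j\<ge>N. rho q (Z i) (Z j) < e" 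
      using rho_change_base by (meson le_less_trans)
  qed
  then show ?thesis unfolding converges_to_infinity_def * by blast
qed

lemma asymptotic_rel_iff:
  "(Z, W) \<in> asymptotic_rel \<longleftrightarrow> converges_to_infinity Z \<and> converges_to_infinity W \<and>
    (\<lambda>i. rho p (Z i) (W i)) \<longlonglongrightarrow> 0"
proof -
  have "(\<lambda>i. rho q (Z i) (W i)) \<longlonglongrightarrow> 0" if "(\<lambda>i. rho p (Z i) (W i)) \<longlonglongrightarrow> 0" for q
  proof (rule tendsto_sandwich[OF _ _ tendsto_const])
    show "(\<lambda>i. exp (dist p q) * rho p (Z i) (W i)) \<longlonglongrightarrow> 0"
      using tendsto_mult_right_zero[OF that] .
  qed (simp_all add: rho_change_base)
  then show ?thesis
    unfolding asymptotic_rel_def by (simp add: exp_uminus_tendsto_0_iff[symmetric] flip: rho_def) blast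
qed

lemma asymptotic_rel_commute: "(Z, W) \<in> asymptotic_rel \<longleftrightarrow> (W, Z) \<in> asymptotic_rel"
  using asymptotic_rel_iff[of Z W undefined] asymptotic_rel_iff[of W Z undefined]
  by (auto simp: rho_commute)

lemma converges_to_infinity_eps:
  assumes "converges_to_infinity Z"
  shows "(\<lambda>i. eps p (Z i)) \<longlonglongrightarrow> 0"
proof -
  have "(\<lambda>i. sqrt (rho p (Z i) (Z i))) \<longlonglongrightarrow> sqrt 0"
  proof (intro tendsto_real_sqrt)
    show "(\<lambda>i. rho p (Z i) (Z i)) \<longlonglongrightarrow> 0"
      using assms unfolding converges_to_infinity_iff[of Z p] lim_sequentially
      by (simp add: dist_real_def) blast
  qed
  then show ?thesis by (simp add: rho_self)
qed

text \<open>A displacement by at most \<open>c\<close> changes \<open>rho\<close> by at most the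
  factor exp c in each argument.\<close>

lemma asymptotic_if_bounded_dist:
  assumes Z: "converges_to_infinity Z" and c: "\<And>i. dist (Z i) (W i) \<le> c"
  shows "(Z, W) \<in> asymptotic_rel"
proof -
  have rW: "rho p (W i) y \<le> exp c * rho p (Z i) y" for p y i
    using rho_perturb[of p "W i" y "Z i"] c[of i] 
    by (smt (verit) exp_le_cancel_iff mult_right_mono rho_pos(2))
  have "converges_to_infinity W"
    unfolding converges_to_infinity_iff[of W undefined]
  proof (intro allI impI)
    fix e :: real assume "0 < e"
    then have "0 < e / (exp c * exp c)" by simp
    then obtain N where N: "\<forall>i\<ge>N. \<forall>j\<ge>N. rho undefined (Z i) (Z j) < e / (exp c * exp c)"
      using Z unfolding converges_to_infinity_iff[of Z undefined] by blast
    have "rho undefined (W i) (W j) < e" if "i \<ge> N" "j \<ge> N" for i j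
    proof -
      have "rho undefined (W i) (W j) \<le> exp c * rho undefined (Z i) (W j)" by (rule rW)
      also have "\<dots> \<le> exp c * (exp c * rho undefined (Z i) (Z j))"
        using rW[of undefined j "Z i"] by (simp add: rho_commute)
      also have "\<dots> < e" using N that by (simp add: pos_less_divide_eq mult_ac)
      finally show ?thesis .
    qed
    then show "\<exists>N. \<forall>i\<ge>N. \<forall>j\<ge>N. rho undefined (W i) (W j) < e" by blast
  qed
  moreover have "(\<lambda>i. rho p (Z i) (W i)) \<longlonglongrightarrow> 0" for p
  proof (rule tendsto_sandwich[OF _ _ tendsto_const])
    have "(\<lambda>i. rho p (Z i) (Z i)) \<longlonglongrightarrow> 0"
      using tendsto_power[OF converges_to_infinity_eps[OF Z, of p], of 2] by (simp add: rho_self)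
    then show "(\<lambda>i. exp c * rho p (Z i) (Z i)) \<longlonglongrightarrow> 0" by (rule tendsto_mult_right_zero)
    have "rho p (Z i) (W i) \<le> exp c * rho p (Z i) (Z i)" for i
      using rW[of p i "Z i"] by (simp only: rho_commute[of p "W i" "Z i"])
    then show "\<forall>\<^sub>F i in sequentially. rho p (Z i) (W i) \<le> exp c * rho p (Z i) (Z i)" by simp
  qed simp
  ultimately show ?thesis using Z by (simp add: asymptotic_rel_iff[of Z W undefined])
qed

text \<open>If all pairs of representatives give the same limit, the infimum runs over a constant
  family; \<open>r = 0\<close> corresponds to the product \<infinity>.\<close>

lemma exp_minus_product_at_infinity:
  assumes ne: "y \<noteq> {}" "y' \<noteq> {}"
    and lim: "\<And>Z W. Z \<in> y \<Longrightarrow> W \<in> y' \<Longrightarrow> (\<lambda>i. exp (- P (Z i) (W i))) \<longlonglongrightarrow> r"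
  shows "exp_minus (product_at_infinity P y y') = r"
proof -
  obtain Z0 W0 where "Z0 \<in> y" "W0 \<in> y'" using ne by blast
  then have r: "0 \<le> r" using lim[of Z0 W0] by (auto intro: LIMSEQ_le_const)
  define g :: ereal where "g = (if r = 0 then \<infinity> else ereal (- ln r))"
  have "liminf (\<lambda>i. ereal (P (Z i) (W i))) = g" if "Z \<in> y" "W \<in> y'" for Z W
  proof (rule lim_imp_Liminf[OF sequentially_bot])
    show "(\<lambda>i. ereal (P (Z i) (W i))) \<longlonglongrightarrow> g"
    proof (cases "r = 0")
      case True
      then show ?thesis using lim[OF that]
        by (simp add: g_def exp_uminus_tendsto_0_iff tendsto_PInfty_eq_at_top)
    next
      case False
      from tendsto_ln[OF lim[OF that] False] have "(\<lambda>i. - P (Z i) (W i)) \<longlonglongrightarrow> ln r" by simp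
      from tendsto_minus[OF this] show ?thesis using False by (simp add: g_def)
    qed
  qed
  then have "product_at_infinity P y y' = g"
    unfolding product_at_infinity_def using ne by (intro INF_eq_const) auto
  then show ?thesis using r by (simp add: exp_minus_def g_def)
qed

section \<open>Continuous extension of Gromov products to the boundary\<close>

context star_space
begin

lemma rho_ptolemy:
  fixes x w u z :: 'a
  shows "rho p x w * rho p u z \<le> (rho p x u + eps p x * eps p u) * (rho p w z + eps p w * eps p z)
    + (rho p x z + eps p x * eps p z) * (rho p w u + eps p w * eps p u)"
proof -
  let ?E = "eps p x * eps p w * eps p u * eps p z"
  have "rho p x w * rho p u z = exp ((dist x w + dist u z) / 2) * ?E"
    by (simp add: rho_altdef add_divide_distrib exp_add)
  also have "\<dots> \<le> ((exp (dist x u / 2) + 1) * (exp (dist w z / 2) + 1)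
      + (exp (dist x z / 2) + 1) * (exp (dist w u / 2) + 1)) * ?E"
    by (intro mult_right_mono ptolemy_exp) simp
  also have "\<dots> = (rho p x u + eps p x * eps p u) * (rho p w z + eps p w * eps p z)
    + (rho p x z + eps p x * eps p z) * (rho p w u + eps p w * eps p u)"
    by (simp add: rho_altdef algebra_simps)
  finally show ?thesis .
qed

text \<open>The four point inequality with the basepoint as fourth point, where \<open>rho\<close>
  and \<open>eps\<close> equal one. The factor one in front of the main terms is what makes Gromov
  products continuous at infinity instead of defined up to a bounded error.\<close>

lemma rho_triangle:
  fixes x w z :: 'a
  shows "rho p x w \<le> rho p x z + rho p z w + 3 * eps p x + 3 * eps p w"
proof -
  have "rho p x w \<le> (rho p x z + eps p x * eps p z) * (1 + eps p w)
      + (1 + eps p x) * (rho p w z + eps p w * eps p z)"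
    using rho_ptolemy[of p x w z p] by simp
  also have "\<dots> = rho p x z + rho p w z + eps p w * rho p x z + eps p x * rho p w z
      + eps p x * eps p z + eps p x * (eps p z * eps p w) + eps p w * eps p z + eps p w * (eps p x * eps p z)"
    by (simp add: algebra_simps)
  also have "\<dots> \<le> rho p x z + rho p w z + eps p w * 1 + eps p x * 1 + eps p x * 1 + eps p x * 1
      + eps p w * 1 + eps p w * 1"
    by (intro add_mono mult_left_mono order_refl mult_le_one) simp_all
  finally show ?thesis by (simp add: rho_commute)
qed

text \<open>Two uses of \<open>rho_triangle\<close> exchange both representatives. The four indices
  are independent, so the statement yields the Cauchy property as well as independence of the
  representatives.\<close>

lemma rho_close:
  fixes Z Z' W W' :: "nat \<Rightarrow> 'a"
  assumes Z: "(Z, Z') \<in> asymptotic_rel" and W: "(W, W') \<in> asymptotic_rel" and e: "0 < e"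
  shows "\<exists>N. \<forall>i\<ge>N. \<forall>j\<ge>N. \<forall>k\<ge>N. \<forall>l\<ge>N. rho p (Z i) (W j) < rho p (Z' k) (W' l) + e"
proof -
  have ev: "\<exists>N. \<forall>i\<ge>N. eps p (U i) < d" if "converges_to_infinity U" "0 < d" for U d
    using converges_to_infinity_eps[OF that(1), of p] that(2) 
    unfolding lim_sequentially by (fastforce simp: dist_real_def)
  have near: "\<exists>N. \<forall>i\<ge>N. \<forall>k\<ge>N. rho p (U i) (U' k) < d" if U: "(U, U') \<in> asymptotic_rel" and d: "0 < d" for U U' d
  proof -
    have c: "converges_to_infinity U" "converges_to_infinity U'" and l: "(\<lambda>i. rho p (U i) (U' i)) \<longlonglongrightarrow> 0"
      using U by (simp_all add: asymptotic_rel_iff[of U U' p])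
    \<comment> \<open>Two \<open>rho\<close> terms and six \<open>eps\<close> terms on the right of
      \<open>rho_triangle\<close> make eight.\<close>
    have d': "0 < d / 8" using d by simp
    obtain N1 where N1: "\<forall>i\<ge>N1. eps p (U i) < d / 8" using ev[OF c(1) d'] by blast
    obtain N2 where N2: "\<forall>i\<ge>N2. eps p (U' i) < d / 8" using ev[OF c(2) d'] by blast
    obtain N3 where N3: "\<forall>i\<ge>N3. \<forall>j\<ge>N3. rho p (U i) (U j) < d / 8"
      using c(1) d' unfolding converges_to_infinity_iff[of U p] by blast
    obtain N4 where N4: "\<forall>i\<ge>N4. rho p (U i) (U' i) < d / 8"
      using l d' unfolding lim_sequentially by (fastforce simp: dist_real_def)
    have "rho p (U i) (U' k) < d" if "i \<ge> N1 + N2 + N3 + N4" "k \<ge> N1 + N2 + N3 + N4" for i k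
    proof -
      have "eps p (U i) < d / 8" using N1 that by simp
      moreover have "eps p (U' k) < d / 8" using N2 that by simp
      moreover have "rho p (U i) (U k) < d / 8" using N3 that by simp
      moreover have "rho p (U k) (U' k) < d / 8" using N4 that by simp
      ultimately show ?thesis using rho_triangle[of p "U i" "U' k" "U k"] by linarith
    qed
    then show ?thesis by blast
  qed
  have c: "converges_to_infinity Z" "converges_to_infinity Z'" "converges_to_infinity W"
    using Z W by (simp_all add: asymptotic_rel_iff[of _ _ p])
  \<comment> \<open>Fourteen error terms: two \<open>rho\<close> terms and twelve \<open>eps\<close>
    terms from two uses of \<open>rho_triangle\<close>.\<close>
  have e': "0 < e / 14" using e by simp
  obtain N1 where N1: "\<forall>i\<ge>N1. eps p (Z i) < e / 14" using ev[OF c(1) e'] by blast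
  obtain N2 where N2: "\<forall>i\<ge>N2. eps p (Z' i) < e / 14" using ev[OF c(2) e'] by blast
  obtain N3 where N3: "\<forall>i\<ge>N3. eps p (W i) < e / 14" using ev[OF c(3) e'] by blast
  obtain N4 where N4: "\<forall>i\<ge>N4. \<forall>k\<ge>N4. rho p (Z i) (Z' k) < e / 14" using near[OF Z e'] by blast
  obtain N5 where N5: "\<forall>i\<ge>N5. \<forall>k\<ge>N5. rho p (W i) (W' k) < e / 14" using near[OF W e'] by blast
  let ?N = "N1 + N2 + N3 + N4 + N5"
  have "rho p (Z i) (W j) < rho p (Z' k) (W' l) + e" if "i \<ge> ?N" "j \<ge> ?N" "k \<ge> ?N" "l \<ge> ?N" for i j k l
  proof -
    have "eps p (Z i) < e / 14" using N1 that by simp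
    moreover have "eps p (Z' k) < e / 14" using N2 that by simp
    moreover have "eps p (W j) < e / 14" using N3 that by simp
    moreover have "rho p (Z i) (Z' k) < e / 14" using N4 that by simp
    moreover have "rho p (W' l) (W j) < e / 14" using N5 that by (simp add: rho_commute)
    ultimately show ?thesis 
      using rho_triangle[of p "Z i" "W j" "Z' k"] rho_triangle[of p "Z' k" "W j" "W' l"] by linarith
  qed
  then show ?thesis by blast
qed

lemma asymptotic_refl: "converges_to_infinity Z \<Longrightarrow> (Z, Z :: nat \<Rightarrow> 'a) \<in> asymptotic_rel"
  by (rule asymptotic_if_bounded_dist[of _ _ 0]) simp_all

lemma asymptotic_trans:
  assumes "(Z, W) \<in> asymptotic_rel" "(W, U :: nat \<Rightarrow> 'a) \<in> asymptotic_rel"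
  shows "(Z, U) \<in> asymptotic_rel"
proof -
  have c: "converges_to_infinity Z" "converges_to_infinity W" "converges_to_infinity U"
    and l: "(\<lambda>i. rho undefined (W i) (U i)) \<longlonglongrightarrow> 0"
    using assms by (simp_all add: asymptotic_rel_iff[of _ _ undefined])
  have "(\<lambda>i. rho undefined (Z i) (U i)) \<longlonglongrightarrow> 0"
    unfolding lim_sequentially
  proof (intro allI impI)
    fix e :: real assume "0 < e"
    then have e: "0 < e / 2" by simp
    obtain N where N: "\<forall>i\<ge>N. \<forall>j\<ge>N. \<forall>k\<ge>N. \<forall>l\<ge>N. rho undefined (Z i) (U j) < rho undefined (W k) (U l) + e / 2"
      using rho_close[OF assms(1) asymptotic_refl[OF c(3)] e] by blast
    obtain M where M: "\<forall>i\<ge>M. rho undefined (W i) (U i) < e / 2"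
      using l e unfolding lim_sequentially by (fastforce simp: dist_real_def)
    have "dist (rho undefined (Z n) (U n)) 0 < e" if "n \<ge> N + M" for n
    proof -
      have "rho undefined (Z n) (U n) < rho undefined (W n) (U n) + e / 2" using N that by simp
      moreover have "rho undefined (W n) (U n) < e / 2" using M that by simp
      ultimately show ?thesis by (simp add: dist_real_def)
    qed
    then show "\<exists>N. \<forall>n\<ge>N. dist (rho undefined (Z n) (U n)) 0 < e" by blast
  qed
  with c show ?thesis by (simp add: asymptotic_rel_iff[of _ _ undefined])
qed

lemma equiv_asymptotic: "equiv {Z :: nat \<Rightarrow> 'a. converges_to_infinity Z} asymptotic_rel"
proof (rule equivI)
  show "asymptotic_rel \<subseteq> {Z :: nat \<Rightarrow> 'a. converges_to_infinity Z} \<times> {Z. converges_to_infinity Z}"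
    by (auto simp: asymptotic_rel_def)
  show "refl_on {Z :: nat \<Rightarrow> 'a. converges_to_infinity Z} asymptotic_rel"
    by (rule refl_onI) (simp add: asymptotic_refl)
  show "sym (asymptotic_rel :: ((nat \<Rightarrow> 'a) \<times> _) set)"
    by (rule symI) (simp add: asymptotic_rel_commute)
  show "trans (asymptotic_rel :: ((nat \<Rightarrow> 'a) \<times> _) set)"
    by (rule transI) (rule asymptotic_trans)
qed

lemma boundary_nonempty: "y \<in> boundary_at_infinity \<Longrightarrow> (y :: 'a ideal_point) \<noteq> {}"
  unfolding boundary_at_infinity_def by (rule in_quotient_imp_non_empty[OF equiv_asymptotic])

lemma boundary_converges:
  "y \<in> boundary_at_infinity \<Longrightarrow> Z \<in> y \<Longrightarrow> converges_to_infinity (Z :: nat \<Rightarrow> 'a)"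
  unfolding boundary_at_infinity_def using in_quotient_imp_subset[OF equiv_asymptotic] by blast

lemma boundary_asymptotic:
  "y \<in> boundary_at_infinity \<Longrightarrow> Z \<in> y \<Longrightarrow> W \<in> y \<longleftrightarrow> (Z, W :: nat \<Rightarrow> 'a) \<in> asymptotic_rel"
  unfolding boundary_at_infinity_def
  using in_quotient_imp_in_rel[OF equiv_asymptotic, of y Z W]
    in_quotient_imp_closed[OF equiv_asymptotic, of y Z W] by auto

lemma boundary_eqI:
  assumes "y \<in> boundary_at_infinity" "y' \<in> boundary_at_infinity" "Z \<in> y" "W \<in> y'"
    "(Z, W :: nat \<Rightarrow> 'a) \<in> asymptotic_rel"
  shows "y = y'"
proof -
  have "W \<in> y" using boundary_asymptotic[OF assms(1,3)] assms(5) by simp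
  then show ?thesis
    using quotient_disj[OF equiv_asymptotic assms(1,2)[unfolded boundary_at_infinity_def]] assms(4) by blast
qed

lemma ideal_point_of_sequence:
  assumes "converges_to_infinity (Z :: nat \<Rightarrow> 'a)"
  obtains y where "y \<in> boundary_at_infinity" "Z \<in> y"
proof -
  have "asymptotic_rel `` {Z} \<in> boundary_at_infinity"
    unfolding boundary_at_infinity_def using assms by (intro quotientI) simp
  then show ?thesis using that asymptotic_refl[OF assms] by blast
qed

text \<open>\<open>rho_close\<close> for a pair of sequences against itself gives the Cauchy
  property, against another pair the same limit. Independent indices are needed where one sequence
  settles before the other moves.\<close>

lemma rho_limit_uniform:
  fixes y y' :: "'a ideal_point"
  assumes y: "y \<in> boundary_at_infinity" "y' \<in> boundary_at_infinity" and Z: "Z \<in> y" "W \<in> y'" and e: "0 < e"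
  shows "\<exists>N. \<forall>i\<ge>N. \<forall>j\<ge>N. \<bar>rho p (Z i) (W j) - bourdon_metric p y y'\<bar> < e"
proof -
  have ref: "(Z, Z) \<in> asymptotic_rel" "(W, W) \<in> asymptotic_rel"
    using y Z boundary_asymptotic by blast+
  have "Cauchy (\<lambda>i. rho p (Z i) (W i))"
  proof (rule CauchyI)
    fix e :: real assume "0 < e"
    from rho_close[OF ref this, of p] obtain N where
      "\<forall>i\<ge>N. \<forall>j\<ge>N. \<forall>k\<ge>N. \<forall>l\<ge>N. rho p (Z i) (W j) < rho p (Z k) (W l) + e" by blast
    then have "norm (rho p (Z m) (W m) - rho p (Z n) (W n)) < e" if "m \<ge> N" "n \<ge> N" for m n
      using that unfolding real_norm_def abs_less_iff by (smt (verit))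
    then show "\<exists>M. \<forall>m\<ge>M. \<forall>n\<ge>M. norm (rho p (Z m) (W m) - rho p (Z n) (W n)) < e" by blast
  qed
  then obtain r where r: "(\<lambda>i. rho p (Z i) (W i)) \<longlonglongrightarrow> r"
    by (auto simp: Cauchy_convergent_iff convergent_def)
  have unif: "\<exists>N. \<forall>i\<ge>N. \<forall>j\<ge>N. \<bar>rho p (Z' i) (W' j) - r\<bar> < e" 
    if Z': "Z' \<in> y" "W' \<in> y'" and e: "0 < e" for Z' W' e
  proof -
    have a: "(Z, Z') \<in> asymptotic_rel" "(W, W') \<in> asymptotic_rel"
      using y Z Z' boundary_asymptotic by blast+
    then have a': "(Z', Z) \<in> asymptotic_rel" "(W', W) \<in> asymptotic_rel"
      by (simp_all add: asymptotic_rel_commute)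
    have e2: "0 < e / 2" using e by simp
    obtain N1 where N1: "\<forall>i\<ge>N1. \<forall>j\<ge>N1. \<forall>k\<ge>N1. \<forall>l\<ge>N1. rho p (Z i) (W j) < rho p (Z' k) (W' l) + e / 2"
      using rho_close[OF a e2] by blast
    obtain N2 where N2: "\<forall>i\<ge>N2. \<forall>j\<ge>N2. \<forall>k\<ge>N2. \<forall>l\<ge>N2. rho p (Z' i) (W' j) < rho p (Z k) (W l) + e / 2"
      using rho_close[OF a' e2] by blast
    obtain N3 where N3: "\<forall>i\<ge>N3. \<bar>rho p (Z i) (W i) - r\<bar> < e / 2"
      using r e2 unfolding lim_sequentially dist_real_def by blast
    let ?n = "N1 + N2 + N3"
    have "\<bar>rho p (Z' i) (W' j) - r\<bar> < e" if "i \<ge> ?n" "j \<ge> ?n" for i j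
    proof -
      have "rho p (Z ?n) (W ?n) < rho p (Z' i) (W' j) + e / 2" using N1 that by simp
      moreover have "rho p (Z' i) (W' j) < rho p (Z ?n) (W ?n) + e / 2" using N2 that by simp
      moreover have "\<bar>rho p (Z ?n) (W ?n) - r\<bar> < e / 2" using N3 by simp
      ultimately show ?thesis by linarith
    qed
    then show ?thesis by blast
  qed
  have lim: "(\<lambda>i. rho p (Z' i) (W' i)) \<longlonglongrightarrow> r" if "Z' \<in> y" "W' \<in> y'" for Z' W'
    unfolding lim_sequentially dist_real_def using unif[OF that] by blast
  have "bourdon_metric p y y' = r"
    unfolding bourdon_metric_def
    using lim by (intro exp_minus_product_at_infinity boundary_nonempty y) (simp add: rho_def)
  then show ?thesis using unif[OF Z e] by simp
qed

lemma rho_limit: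
  fixes y y' :: "'a ideal_point"
  assumes "y \<in> boundary_at_infinity" "y' \<in> boundary_at_infinity" "Z \<in> y" "W \<in> y'"
  shows "(\<lambda>i. rho p (Z i) (W i)) \<longlonglongrightarrow> bourdon_metric p y y'"
  unfolding lim_sequentially dist_real_def using rho_limit_uniform[OF assms] by blast

lemma bourdon_nonneg:
  fixes y y' :: "'a ideal_point"
  assumes y: "y \<in> boundary_at_infinity" "y' \<in> boundary_at_infinity"
  shows "0 \<le> bourdon_metric p y y'"
proof -
  obtain Z W where Z: "Z \<in> y" "W \<in> y'" using boundary_nonempty y by blast
  show ?thesis using rho_limit[OF y Z, of p] by (auto intro: LIMSEQ_le_const)
qed

lemma bourdon_commute:
  fixes y y' :: "'a ideal_point"
  assumes y: "y \<in> boundary_at_infinity" "y' \<in> boundary_at_infinity"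
  shows "bourdon_metric p y y' = bourdon_metric p y' y"
proof -
  obtain Z W where Z: "Z \<in> y" "W \<in> y'" using boundary_nonempty y by blast
  show ?thesis
    using rho_limit[OF y Z, of p] rho_limit[OF y(2,1) Z(2,1), of p]
    by (simp add: rho_commute LIMSEQ_unique)
qed

lemma bourdon_pos:
  fixes y y' :: "'a ideal_point"
  assumes y: "y \<in> boundary_at_infinity" "y' \<in> boundary_at_infinity" and ne: "y \<noteq> y'"
  shows "0 < bourdon_metric p y y'"
proof -
  obtain Z W where Z: "Z \<in> y" "W \<in> y'" using boundary_nonempty y by blast
  have "bourdon_metric p y y' \<noteq> 0"
  proof
    assume "bourdon_metric p y y' = 0"
    then have "(Z, W) \<in> asymptotic_rel"
      using rho_limit[OF y Z, of p] boundary_converges[OF y(1) Z(1)] boundary_converges[OF y(2) Z(2)]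
      by (simp add: asymptotic_rel_iff[of Z W p])
    then show False using boundary_eqI[OF y Z] ne by simp
  qed
  then show ?thesis using bourdon_nonneg[OF y, of p] by simp
qed

lemma bourdon_ptolemy:
  fixes y1 y2 y3 y4 :: "'a ideal_point" and p :: 'a
  assumes y: "y1 \<in> boundary_at_infinity" "y2 \<in> boundary_at_infinity"
    "y3 \<in> boundary_at_infinity" "y4 \<in> boundary_at_infinity"
  defines "r \<equiv> bourdon_metric p"
  shows "r y1 y3 * r y2 y4 \<le> r y1 y2 * r y3 y4 + r y2 y3 * r y4 y1"
proof -
  obtain Z1 Z2 Z3 Z4 where Z: "Z1 \<in> y1" "Z2 \<in> y2" "Z3 \<in> y3" "Z4 \<in> y4"
    using y[THEN boundary_nonempty] by (metis ex_in_conv)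
  have e: "(\<lambda>i. eps p (Z i)) \<longlonglongrightarrow> 0" if "Z \<in> y" "y \<in> boundary_at_infinity" for Z and y :: "'a ideal_point"
    using that boundary_converges converges_to_infinity_eps by blast
  note l = rho_limit[OF _ _ _ _, of _ _ _ _ p, folded r_def]
  have "(\<lambda>i. (rho p (Z1 i) (Z2 i) + eps p (Z1 i) * eps p (Z2 i)) * (rho p (Z3 i) (Z4 i) + eps p (Z3 i) * eps p (Z4 i))
    + (rho p (Z1 i) (Z4 i) + eps p (Z1 i) * eps p (Z4 i)) * (rho p (Z3 i) (Z2 i) + eps p (Z3 i) * eps p (Z2 i)))
    \<longlonglongrightarrow> (r y1 y2 + 0 * 0) * (r y3 y4 + 0 * 0) + (r y1 y4 + 0 * 0) * (r y3 y2 + 0 * 0)"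
    by (intro tendsto_intros l e y Z; rule y Z)
  moreover have "(\<lambda>i. rho p (Z1 i) (Z3 i) * rho p (Z2 i) (Z4 i)) \<longlonglongrightarrow> r y1 y3 * r y2 y4"
    by (intro tendsto_intros l y Z)
  ultimately have "r y1 y3 * r y2 y4 \<le> (r y1 y2 + 0 * 0) * (r y3 y4 + 0 * 0) + (r y1 y4 + 0 * 0) * (r y3 y2 + 0 * 0)"
    by (intro LIMSEQ_le) (auto intro: rho_ptolemy)
  then show ?thesis
    using bourdon_commute[OF y(1,4), of p] bourdon_commute[OF y(2,3), of p] by (simp add: r_def mult.commute)
qed

section \<open>Busemann functions and the Hamenstaedt metric\<close>

text \<open>For a point of the space the infimum of lower limits is not treated as a limit. It is
  enclosed between bounds that hold for every representative of \<omega> and therefore survive the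
  infimum.\<close>

lemma gromov_product_point_limit:
  fixes \<omega> y :: "'a ideal_point"
  assumes y: "\<omega> \<in> boundary_at_infinity" "y \<in> boundary_at_infinity" and ne: "\<omega> \<noteq> y" and Z: "Z \<in> y"
  shows "(\<lambda>i. exp (- real_of_ereal (gromov_product_point p \<omega> (Z i)))) \<longlonglongrightarrow> bourdon_metric p \<omega> y"
proof -
  define r where "r = bourdon_metric p \<omega> y"
  have r0: "0 < r" using bourdon_pos[OF y ne] by (simp add: r_def)
  obtain W where W: "W \<in> \<omega>" using boundary_nonempty[OF y(1)] by blast
  show ?thesis unfolding r_def[symmetric]
  proof (rule LIMSEQ_I)
    fix e0 :: real assume "0 < e0"
    \<comment> \<open>\<open>e < r\<close> keeps ln (r - e) meaningful; this is possible because
      distinct ideal points have \<open>0 < r\<close>.\<close>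
    define e where "e = min (e0 / 2) (r / 2)"
    have e: "0 < e" "e < e0" "e < r" using \<open>0 < e0\<close> r0 by (simp_all add: e_def)
    obtain N where N: "\<forall>i\<ge>N. \<forall>j\<ge>N. \<bar>rho p (W i) (Z j) - r\<bar> < e / 14"
      using rho_limit_uniform[OF y W Z, of "e / 14" p] e by (auto simp: r_def)
    obtain M where M: "\<forall>i\<ge>M. eps p (Z i) < e / 14"
      using converges_to_infinity_eps[OF boundary_converges[OF y(2) Z], of p] e(1)
      unfolding lim_sequentially by (fastforce simp: dist_real_def dest!: spec[of _ "e / 14"])
    have "\<bar>exp (- real_of_ereal (gromov_product_point p \<omega> (Z i))) - r\<bar> \<le> e" if i: "i \<ge> N + M" for i
    proof -
      have bd: "ereal (- ln (r + e)) \<le> liminf (\<lambda>j. ereal (gromov_product p (W' j) (Z i)))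
          \<and> liminf (\<lambda>j. ereal (gromov_product p (W' j) (Z i))) \<le> ereal (- ln (r - e))" 
        if W': "W' \<in> \<omega>" for W'
      proof -
        have cW: "converges_to_infinity W'" "converges_to_infinity W" using boundary_converges y(1) W W' by blast+
        have "(\<lambda>j. rho p (W' j) (W j)) \<longlonglongrightarrow> 0"
          using boundary_asymptotic[OF y(1) W'] W by (simp add: asymptotic_rel_iff[of W' W p])
        then have "\<forall>\<^sub>F j in sequentially. rho p (W' j) (W j) < e / 14"
          using e by (intro order_tendstoD(2)) auto
        moreover have "\<forall>\<^sub>F j in sequentially. eps p (W' j) < e / 14" "\<forall>\<^sub>F j in sequentially. eps p (W j) < e / 14"
          using e order_tendstoD(2)[OF converges_to_infinity_eps[OF cW(1)], of "e / 14" p]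
            order_tendstoD(2)[OF converges_to_infinity_eps[OF cW(2)], of "e / 14" p] by simp_all
        moreover have "\<forall>\<^sub>F j in sequentially. j \<ge> N" by (rule eventually_ge_at_top)
        ultimately have ev: "\<forall>\<^sub>F j in sequentially. \<bar>rho p (W' j) (Z i) - r\<bar> \<le> e"
        proof eventually_elim
          case (elim j)
          have "\<bar>rho p (W j) (Z i) - r\<bar> < e / 14" "eps p (Z i) < e / 14"
            using N M i elim by simp_all
          then show ?case
            using rho_triangle[of p "W' j" "Z i" "W j"] rho_triangle[of p "W j" "Z i" "W' j"] elim
              rho_commute[of p "W j" "W' j"] by linarith
        qed
        have ev': "\<forall>\<^sub>F j in sequentially. - ln (r + e) \<le> gromov_product p (W' j) (Z i)
            \<and> gromov_product p (W' j) (Z i) \<le> - ln (r - e)"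
          using ev
        proof eventually_elim
          case (elim j)
          then have "exp (- gromov_product p (W' j) (Z i)) \<le> r + e" "r - e \<le> exp (- gromov_product p (W' j) (Z i))"
            by (auto simp: rho_def abs_le_iff)
          then have "- gromov_product p (W' j) (Z i) \<le> ln (r + e)" "ln (r - e) \<le> - gromov_product p (W' j) (Z i)"
            using e r0 by (simp_all add: ln_ge_iff) (metis exp_gt_zero ln_exp ln_le_cancel_iff diff_gt_0_iff_gt)
          then show ?case by simp
        qed
        have "ereal (- ln (r + e)) \<le> liminf (\<lambda>j. ereal (gromov_product p (W' j) (Z i)))"
          using ev' by (intro Liminf_bounded) (auto elim: eventually_mono)
        moreover have "liminf (\<lambda>j. ereal (gromov_product p (W' j) (Z i))) \<le> limsup (\<lambda>j. ereal (gromov_product p (W' j) (Z i)))"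
          by (intro Liminf_le_Limsup) simp
        moreover have "limsup (\<lambda>j. ereal (gromov_product p (W' j) (Z i))) \<le> ereal (- ln (r - e))"
          using ev' by (intro Limsup_bounded) (auto elim: eventually_mono)
        ultimately show ?thesis by (blast intro: order_trans)
      qed
      define g where "g = gromov_product_point p \<omega> (Z i)"
      have "ereal (- ln (r + e)) \<le> g"
        unfolding g_def gromov_product_point_def using bd by (intro INF_greatest) blast
      moreover have "g \<le> ereal (- ln (r - e))"
        unfolding g_def gromov_product_point_def using bd W by (intro INF_lower2[OF W]) blast
      ultimately obtain t where t: "g = ereal t" "- ln (r + e) \<le> t" "t \<le> - ln (r - e)"
        by (cases g) auto
      have "exp (- t) \<le> exp (ln (r + e))" "exp (ln (r - e)) \<le> exp (- t)" using t by simp_all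
      then have "exp (- t) \<le> r + e" "r - e \<le> exp (- t)" using e r0 by simp_all
      then show ?thesis unfolding g_def[symmetric] t(1) by (simp add: abs_le_iff)
    qed
    then show "\<exists>no. \<forall>n\<ge>no. norm (exp (- real_of_ereal (gromov_product_point p \<omega> (Z n))) - r) < e0"
      using e(2) by (intro exI[of _ "N + M"]) fastforce
  qed
qed

text \<open>Exponentiating the Busemann product splits off one factor for each point, whose limit is
  the Bourdon distance to \<omega>. The result is the inversion of the Bourdon metric at \<omega>,
  scaled by the additive constant of \<open>b\<close>.\<close>

lemma hamenstaedt_rescaling:
  fixes \<omega> :: "'a ideal_point"
  assumes \<omega>: "\<omega> \<in> boundary_at_infinity" and b: "busemann_function \<omega> b"
  obtains p c where "\<And>y y'. y \<in> boundary_at_infinity - {\<omega>} \<Longrightarrow> y' \<in> boundary_at_infinity - {\<omega>} \<Longrightarrow>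
    hamenstaedt_metric b y y'
      = exp (- c) / (bourdon_metric p \<omega> y * bourdon_metric p \<omega> y') * bourdon_metric p y y'"
proof -
  obtain p c where b: "\<And>x. b x = dist p x - 2 * real_of_ereal (gromov_product_point p \<omega> x) + c"
    using b by (auto simp: busemann_function_def)
  define h where "h x = exp (- real_of_ereal (gromov_product_point p \<omega> x))" for x
  have "exp (- busemann_product b x w) = exp (- c) / (h x * h w) * rho p x w" for x w
    unfolding busemann_product_def b rho_def gromov_product_def h_def
    by (simp add: mult_exp_exp flip: exp_diff) (simp add: field_simps)
  note P = this
  have "hamenstaedt_metric b y y'
      = exp (- c) / (bourdon_metric p \<omega> y * bourdon_metric p \<omega> y') * bourdon_metric p y y'"
    if y: "y \<in> boundary_at_infinity - {\<omega>}" "y' \<in> boundary_at_infinity - {\<omega>}" for y y'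
  proof -
    have pos: "0 < bourdon_metric p \<omega> y" "0 < bourdon_metric p \<omega> y'"
      using y \<omega> by (auto intro: bourdon_pos)
    show ?thesis
      unfolding hamenstaedt_metric_def
    proof (rule exp_minus_product_at_infinity)
      fix Z W assume Z: "Z \<in> y" "W \<in> y'"
      show "(\<lambda>i. exp (- busemann_product b (Z i) (W i)))
        \<longlonglongrightarrow> exp (- c) / (bourdon_metric p \<omega> y * bourdon_metric p \<omega> y') * bourdon_metric p y y'"
        unfolding P h_def using pos y \<omega> Z
        by (intro tendsto_intros gromov_product_point_limit rho_limit[OF _ _ _ _]) auto
    qed (use y boundary_nonempty in auto)
  qed
  then show ?thesis by (rule that)
qed

end

section \<open>Geodesic lines\<close>

definition line :: "(real \<Rightarrow> 'a::metric_space) \<Rightarrow> bool" where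
  "line \<gamma> \<longleftrightarrow> (\<forall>s t. dist (\<gamma> s) (\<gamma> t) = \<bar>s - t\<bar>)"

text \<open>A parametrised version of \<open>line_joining\<close>, which keeps only the range:
  distances between two lines are compared at equal parameters below.\<close>

definition joins :: "(real \<Rightarrow> 'a::metric_space) \<Rightarrow> 'a ideal_point \<Rightarrow> 'a ideal_point \<Rightarrow> bool" where
  "joins \<gamma> y y' \<longleftrightarrow> line \<gamma> \<and> (\<lambda>n. \<gamma> (- real n)) \<in> y \<and> (\<lambda>n. \<gamma> (real n)) \<in> y'"

lemma line_joining_iff: "line_joining y y' L \<longleftrightarrow> (\<exists>\<gamma>. joins \<gamma> y y' \<and> L = range \<gamma>)"
  by (auto simp: line_joining_def joins_def line_def)

lemma line_dist: "line \<gamma> \<Longrightarrow> dist (\<gamma> s) (\<gamma> t) = \<bar>s - t\<bar>"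
  by (simp add: line_def)

lemma line_shift: "line \<gamma> \<Longrightarrow> line (\<lambda>t. \<gamma> (c + t))"
  by (simp add: line_def)

lemma line_reverse: "line \<gamma> \<Longrightarrow> line (\<lambda>t. \<gamma> (- t))"
  by (simp add: line_def abs_minus_commute)

lemma line_converges:
  assumes l: "line \<gamma>"
  shows "converges_to_infinity (\<lambda>n. \<gamma> (real n))"
  unfolding converges_to_infinity_iff[of _ "\<gamma> 0"]
proof (intro allI impI)
  fix e :: real assume e: "0 < e"
  obtain N :: nat where N: "- ln e < real N" using reals_Archimedean2 by blast
  have "rho (\<gamma> 0) (\<gamma> (real i)) (\<gamma> (real j)) < e" if "i \<ge> N" "j \<ge> N" for i j
  proof -
    have "gromov_product (\<gamma> 0) (\<gamma> (real i)) (\<gamma> (real j)) = min (real i) (real j)"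
      by (simp add: gromov_product_def line_dist[OF l] min_def)
    then have "rho (\<gamma> 0) (\<gamma> (real i)) (\<gamma> (real j)) < exp (ln e)"
      unfolding rho_def using N that by simp
    then show ?thesis using e by simp
  qed
  then show "\<exists>N. \<forall>i\<ge>N. \<forall>j\<ge>N. rho (\<gamma> 0) (\<gamma> (real i)) (\<gamma> (real j)) < e" by blast
qed

lemma line_converges': "line \<gamma> \<Longrightarrow> converges_to_infinity (\<lambda>n. \<gamma> (- real n))"
  using line_converges[OF line_reverse] .

lemma joins_reverse: "joins \<gamma> y y' \<Longrightarrow> joins (\<lambda>t. \<gamma> (- t)) y' y"
  by (simp add: joins_def line_reverse)

text \<open>As cosh behaves like half the exponential, rescaled hyperbolic cosines of distances turn
  into exponentials of Busemann functions.\<close>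

lemma exp_times_cosh_tendsto:
  fixes a c :: "nat \<Rightarrow> real"
  assumes c: "filterlim c at_top sequentially" and a: "\<And>n. 0 \<le> a n" and l: "(\<lambda>n. a n - c n) \<longlonglongrightarrow> b"
  shows "(\<lambda>n. exp (- c n) * cosh (a n)) \<longlonglongrightarrow> exp b / 2"
proof -
  have c0: "(\<lambda>n. exp (- c n)) \<longlonglongrightarrow> 0" using c by (simp add: exp_uminus_tendsto_0_iff)
  have "(\<lambda>n. exp (- c n) * exp (- a n)) \<longlonglongrightarrow> 0"
    by (rule tendsto_sandwich[OF _ _ tendsto_const c0]) (use a in \<open>simp_all add: mult_left_le\<close>)
  then have "(\<lambda>n. (exp (a n - c n) + exp (- c n) * exp (- a n)) / 2) \<longlonglongrightarrow> (exp b + 0) / 2"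
    using l by (intro tendsto_intros) simp_all
  moreover have "(exp (a n - c n) + exp (- c n) * exp (- a n)) / 2 = exp (- c n) * cosh (a n)" for n
    by (simp add: cosh_field_def field_simps mult_exp_exp)
  ultimately show ?thesis by simp
qed

text \<open>The Busemann function of the forward end, normalised to vanish at
  \<open>\<gamma> 0\<close>. The backward end is treated by reversing the line.\<close>

definition bus :: "(real \<Rightarrow> 'a::metric_space) \<Rightarrow> 'a \<Rightarrow> real" where
  "bus \<gamma> x = lim (\<lambda>n. dist x (\<gamma> (real n)) - real n)"

lemma antimono_bounded_convergent:
  fixes f :: "nat \<Rightarrow> real"
  assumes "\<And>n. f (Suc n) \<le> f n" "\<And>n. c \<le> f n"
  shows "convergent f"
proof -
  have d: "decseq f" using assms(1) by (simp add: decseq_Suc_iff)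
  obtain L where "f \<longlonglongrightarrow> L" using decseq_convergent[OF d, of c] assms(2) by blast
  then show ?thesis by (auto simp: convergent_def)
qed

lemma bus_limit:
  assumes l: "line \<gamma>"
  shows "(\<lambda>n. dist x (\<gamma> (real n)) - real n) \<longlonglongrightarrow> bus \<gamma> x"
proof -
  have "convergent (\<lambda>n. dist x (\<gamma> (real n)) - real n)"
  proof (rule antimono_bounded_convergent)
    fix n :: nat
    show "dist x (\<gamma> (real (Suc n))) - real (Suc n) \<le> dist x (\<gamma> (real n)) - real n"
      using dist_triangle[of x "\<gamma> (real (Suc n))" "\<gamma> (real n)"] by (simp add: line_dist[OF l])
    show "- dist x (\<gamma> 0) \<le> dist x (\<gamma> (real n)) - real n"
      using dist_triangle[of "\<gamma> 0" "\<gamma> (real n)" x] by (simp add: line_dist[OF l] dist_commute)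
  qed
  then show ?thesis unfolding bus_def by (simp add: convergent_LIMSEQ_iff)
qed

lemma bus_on_line:
  assumes l: "line \<gamma>"
  shows "bus \<gamma> (\<gamma> t) = - t"
proof -
  have "\<forall>\<^sub>F n in sequentially. t \<le> real n"
    using eventually_ge_at_top[of "nat \<lceil>t\<rceil>"] by eventually_elim linarith
  then have "\<forall>\<^sub>F n in sequentially. dist (\<gamma> t) (\<gamma> (real n)) - real n = - t"
    by eventually_elim (simp add: line_dist[OF l])
  then have "(\<lambda>n. dist (\<gamma> t) (\<gamma> (real n)) - real n) \<longlonglongrightarrow> - t" by (rule tendsto_eventually)
  then show ?thesis using bus_limit[OF l] LIMSEQ_unique by blast
qed

lemma bus_sum_nonneg:
  assumes l: "line \<gamma>"
  shows "0 \<le> bus \<gamma> x + bus (\<lambda>t. \<gamma> (- t)) x"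
proof (rule LIMSEQ_le_const)
  show "(\<lambda>n. (dist x (\<gamma> (real n)) - real n) + (dist x (\<gamma> (- real n)) - real n))
      \<longlonglongrightarrow> bus \<gamma> x + bus (\<lambda>t. \<gamma> (- t)) x"
    by (intro tendsto_add bus_limit[OF l] bus_limit[OF line_reverse[OF l]])
  have "0 \<le> (dist x (\<gamma> (real n)) - real n) + (dist x (\<gamma> (- real n)) - real n)" for n
    using dist_triangle3[of "\<gamma> (real n)" "\<gamma> (- real n)" x] by (simp add: line_dist[OF l])
  then show "\<exists>N. \<forall>n\<ge>N. 0 \<le> (dist x (\<gamma> (real n)) - real n) + (dist x (\<gamma> (- real n)) - real n)"
    by blast
qed

lemma real_tail: "\<forall>\<^sub>F n in sequentially. (t::real) \<le> real n"
  using eventually_ge_at_top[of "nat \<lceil>t\<rceil>"] by eventually_elim linarith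

section \<open>Lines: uniqueness, existence and cross ratios\<close>

context star_space
begin

text \<open>Limit of \<open>cosh_between_le\<close> on the segments from \<gamma> (-n) to \<gamma>
  n. If the two Busemann values at \<open>x\<close> add up to zero, some \<open>t\<close> makes the
  bound one, and \<open>x\<close> lies on the line.\<close>

lemma cosh_line_le:
  fixes \<gamma> :: "real \<Rightarrow> 'a"
  assumes l: "line \<gamma>"
  shows "cosh (dist x (\<gamma> t)) \<le> (exp (bus \<gamma> x + t) + exp (bus (\<lambda>t. \<gamma> (- t)) x - t)) / 2"
proof (rule LIMSEQ_le_const)
  let ?f = "\<lambda>n. exp (- t) * (exp (- real n) * cosh (dist x (\<gamma> (- real n))))
      + exp t * (exp (- real n) * cosh (dist x (\<gamma> (real n))))"
  have "?f \<longlonglongrightarrow> exp (- t) * (exp (bus (\<lambda>t. \<gamma> (- t)) x) / 2) + exp t * (exp (bus \<gamma> x) / 2)"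
    using bus_limit[OF l] bus_limit[OF line_reverse[OF l]]
    by (intro tendsto_add tendsto_mult_left exp_times_cosh_tendsto filterlim_real_sequentially) simp_all
  then show "?f \<longlonglongrightarrow> (exp (bus \<gamma> x + t) + exp (bus (\<lambda>t. \<gamma> (- t)) x - t)) / 2"
    by (simp add: exp_add exp_diff exp_minus field_simps)
  have "\<forall>\<^sub>F n in sequentially. cosh (dist x (\<gamma> t)) \<le> ?f n"
    using real_tail[of "\<bar>t\<bar>"]
  proof eventually_elim
    case (elim n)
    have d: "dist (\<gamma> (- real n)) (\<gamma> t) = real n + t" "dist (\<gamma> t) (\<gamma> (real n)) = real n - t"
      "dist (\<gamma> (- real n)) (\<gamma> (real n)) = 2 * real n"
      using elim by (simp_all add: line_dist[OF l])
    have "cosh (dist x (\<gamma> t)) \<le> exp (- (real n + t)) * cosh (dist x (\<gamma> (- real n)))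
        + exp (- (real n - t)) * cosh (dist x (\<gamma> (real n)))"
      using cosh_between_le[of "\<gamma> (- real n)" "\<gamma> t" "\<gamma> (real n)" x] unfolding d by simp
    then show ?case by (simp add: exp_minus exp_add exp_diff field_simps)
  qed
  then show "\<exists>N. \<forall>n\<ge>N. cosh (dist x (\<gamma> t)) \<le> ?f n" by (simp add: eventually_sequentially)
qed

lemma bourdon_bus:
  fixes \<gamma> :: "real \<Rightarrow> 'a"
  assumes y: "y \<in> boundary_at_infinity" "y' \<in> boundary_at_infinity" and j: "joins \<gamma> y y'"
  shows "bourdon_metric x y y' = exp (- (bus \<gamma> x + bus (\<lambda>t. \<gamma> (- t)) x) / 2)"
proof (rule LIMSEQ_unique)
  have l: "line \<gamma>" using j by (simp add: joins_def)
  show "(\<lambda>n. rho x (\<gamma> (- real n)) (\<gamma> (real n))) \<longlonglongrightarrow> bourdon_metric x y y'"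
    using j by (intro rho_limit[OF y _ _]) (simp_all add: joins_def)
  have "(\<lambda>n. exp (- ((dist x (\<gamma> (real n)) - real n) + (dist x (\<gamma> (- real n)) - real n)) / 2))
    \<longlonglongrightarrow> exp (- (bus \<gamma> x + bus (\<lambda>t. \<gamma> (- t)) x) / 2)"
    by (intro tendsto_intros bus_limit[OF l] bus_limit[OF line_reverse[OF l]]) simp
  moreover have "exp (- ((dist x (\<gamma> (real n)) - real n) + (dist x (\<gamma> (- real n)) - real n)) / 2)
      = rho x (\<gamma> (- real n)) (\<gamma> (real n))" for n
    by (simp add: rho_def gromov_product_def line_dist[OF l] field_simps)
  ultimately show "(\<lambda>n. rho x (\<gamma> (- real n)) (\<gamma> (real n)))
      \<longlonglongrightarrow> exp (- (bus \<gamma> x + bus (\<lambda>t. \<gamma> (- t)) x) / 2)" by simp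
qed

text \<open>The right-hand side does not mention \<gamma>, so the line between two ideal points is
  unique as a set.\<close>

lemma line_range:
  fixes \<gamma> :: "real \<Rightarrow> 'a"
  assumes y: "y \<in> boundary_at_infinity" "y' \<in> boundary_at_infinity" and j: "joins \<gamma> y y'"
  shows "range \<gamma> = {x. bourdon_metric x y y' = 1}"
proof -
  have l: "line \<gamma>" using j by (simp add: joins_def)
  have "bourdon_metric (\<gamma> t) y y' = 1" for t
    using bus_on_line[OF l, of t] bus_on_line[OF line_reverse[OF l], of "- t"]
    by (simp add: bourdon_bus[OF y j])
  moreover have "x \<in> range \<gamma>" if "bourdon_metric x y y' = 1" for x
  proof -
    have "bus (\<lambda>t. \<gamma> (- t)) x = - bus \<gamma> x" using that by (simp add: bourdon_bus[OF y j])
    then have "cosh (dist x (\<gamma> (- bus \<gamma> x))) \<le> 1"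
      using cosh_line_le[OF l, of x "- bus \<gamma> x"] by simp
    then have "x = \<gamma> (- bus \<gamma> x)" by (rule cosh_dist_le_1D)
    then show ?thesis by blast
  qed
  ultimately show ?thesis by blast
qed

lemma geodesic_line_eq:
  fixes \<gamma> :: "real \<Rightarrow> 'a"
  assumes y: "y \<in> boundary_at_infinity" "y' \<in> boundary_at_infinity" and j: "joins \<gamma> y y'"
  shows "geodesic_line y y' = range \<gamma>"
  unfolding geodesic_line_def
proof (rule the_equality)
  show "line_joining y y' (range \<gamma>)" using j by (auto simp: line_joining_iff)
  fix L assume "line_joining y y' L"
  then obtain \<eta> where "joins \<eta> y y'" "L = range \<eta>" by (auto simp: line_joining_iff)
  then show "L = range \<gamma>" using line_range[OF y] j by metis
qed

lemma joins_shift: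
  fixes \<gamma> :: "real \<Rightarrow> 'a"
  assumes y: "y \<in> boundary_at_infinity" "y' \<in> boundary_at_infinity" and j: "joins \<gamma> y y'"
  shows "joins (\<lambda>t. \<gamma> (c + t)) y y'"
proof -
  have l: "line \<gamma>" and e: "(\<lambda>n. \<gamma> (- real n)) \<in> y" "(\<lambda>n. \<gamma> (real n)) \<in> y'"
    using j by (simp_all add: joins_def)
  have "(\<lambda>n. \<gamma> (- real n), \<lambda>n. \<gamma> (c + - real n)) \<in> asymptotic_rel"
    by (rule asymptotic_if_bounded_dist[OF line_converges'[OF l], of _ "\<bar>c\<bar>"]) (simp add: line_dist[OF l])
  moreover have "(\<lambda>n. \<gamma> (real n), \<lambda>n. \<gamma> (c + real n)) \<in> asymptotic_rel"
    by (rule asymptotic_if_bounded_dist[OF line_converges[OF l], of _ "\<bar>c\<bar>"]) (simp add: line_dist[OF l])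
  ultimately show ?thesis
    using l boundary_asymptotic[OF y(1) e(1)] boundary_asymptotic[OF y(2) e(2)]
    by (simp add: joins_def line_shift)
qed

text \<open>For fixed \<open>n\<close> the bound holds only for late \<open>i\<close>. The Cauchy
  property of \<open>Z\<close> with respect to \<open>rho\<close> brings the index back to
  \<open>n\<close> itself.\<close>

lemma asymptotic_if_eventually_close:
  fixes U Z :: "nat \<Rightarrow> 'a"
  assumes cU: "converges_to_infinity U" and cZ: "converges_to_infinity Z" and c: "c \<longlonglongrightarrow> 0"
    and close: "\<And>n. \<forall>\<^sub>F i in sequentially. rho p (U n) (Z i) \<le> c n"
  shows "(U, Z) \<in> asymptotic_rel"
proof -
  have "(\<lambda>n. rho p (U n) (Z n)) \<longlonglongrightarrow> 0"
  proof (rule LIMSEQ_I)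
    fix e :: real assume "0 < e"
    then have e: "0 < e / 8" by simp
    have ev: "\<forall>\<^sub>F n in sequentially. c n < e / 8"
      "\<forall>\<^sub>F n in sequentially. eps p (U n) < e / 8" "\<forall>\<^sub>F n in sequentially. eps p (Z n) < e / 8"
      using order_tendstoD(2)[OF c e] order_tendstoD(2)[OF converges_to_infinity_eps e] cU cZ by blast+
    obtain N where N: "\<forall>i\<ge>N. \<forall>j\<ge>N. rho p (Z i) (Z j) < e / 8"
      using cZ e unfolding converges_to_infinity_iff[of Z p] by blast
    have "\<forall>\<^sub>F n in sequentially. rho p (U n) (Z n) < e"
      using ev eventually_ge_at_top[of N]
    proof eventually_elim
      case (elim n)
      have "\<forall>\<^sub>F i in sequentially. rho p (U n) (Z i) \<le> c n \<and> i \<ge> N"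
        using close[of n] eventually_ge_at_top[of N] by (rule eventually_conj)
      then obtain i where i: "rho p (U n) (Z i) \<le> c n" "i \<ge> N" 
        by (auto simp: eventually_sequentially)
      have "rho p (Z i) (Z n) < e / 8" using N i elim by simp
      then show ?case using rho_triangle[of p "U n" "Z n" "Z i"] i elim by linarith
    qed
    then show "\<exists>no. \<forall>n\<ge>no. norm (rho p (U n) (Z n) - 0) < e" by (simp add: eventually_sequentially)
  qed
  then show ?thesis using cU cZ by (simp add: asymptotic_rel_iff[of U Z p])
qed

lemma bourdon_self:
  assumes y: "(y :: 'a ideal_point) \<in> boundary_at_infinity"
  shows "bourdon_metric p y y = 0"
proof -
  obtain Z where Z: "Z \<in> y" using boundary_nonempty[OF y] by blast
  have "(\<lambda>i. rho p (Z i) (Z i)) \<longlonglongrightarrow> 0"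
    using tendsto_power[OF converges_to_infinity_eps[OF boundary_converges[OF y Z], of p], of 2]
    by (simp add: rho_self)
  then show ?thesis using rho_limit[OF y y Z Z, of p] LIMSEQ_unique by blast
qed

lemma rho_limit_prod:
  fixes y y' :: "'a ideal_point"
  assumes y: "y \<in> boundary_at_infinity" "y' \<in> boundary_at_infinity" and Z: "Z \<in> y" "W \<in> y'"
  shows "((\<lambda>x. rho p (Z (fst x)) (W (snd x))) \<longlongrightarrow> bourdon_metric p y y') (sequentially \<times>\<^sub>F sequentially)"
proof (rule tendstoI)
  fix e :: real assume "0 < e"
  from rho_limit_uniform[OF y Z this, of p] 
  show "\<forall>\<^sub>F x in sequentially \<times>\<^sub>F sequentially. dist (rho p (Z (fst x)) (W (snd x))) (bourdon_metric p y y') < e"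
    by (auto simp: eventually_prod_sequentially dist_real_def)
qed

lemma complete_limit:
  fixes f :: "nat \<Rightarrow> 'a"
  assumes "Cauchy f"
  obtains l where "f \<longlonglongrightarrow> l"
  using complete assms by (auto simp: complete_def)

text \<open>Points at a fixed signed distance from the Gromov point on the segments \<open>[Z i, W i]\<close>
  form a Cauchy sequence, because the comparison estimate pushes the hyperbolic cosine of their
  distance to one.\<close>

theorem line_exists:
  fixes y y' :: "'a ideal_point"
  assumes y: "y \<in> boundary_at_infinity" "y' \<in> boundary_at_infinity" and ne: "y \<noteq> y'"
  obtains \<gamma> where "joins \<gamma> y y'"
proof -
  obtain Z W where Z: "Z \<in> y" "W \<in> y'" using boundary_nonempty y by blast
  define p where "p = Z 0"
  define r where "r = bourdon_metric p y y'"
  have r: "0 < r" unfolding r_def by (rule bourdon_pos[OF y ne])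
  have cZ: "converges_to_infinity Z" and cW: "converges_to_infinity W"
    using boundary_converges y Z by blast+
  define D where "D i = dist (Z i) (W i)" for i
  \<comment> \<open>The Gromov product of \<open>Z i\<close> and \<open>W i\<close> tends to
    \<open>- ln r\<close>, so up to a vanishing error \<open>A i\<close> is the distance from
    \<open>Z i\<close> to the Gromov point of the segment as seen from \<open>p\<close>, and
    \<open>B i\<close> the distance from there to \<open>W i\<close>.\<close>
  define A where "A i = dist p (Z i) + ln r" for i
  define B where "B i = D i - A i" for i
  have eA: "exp (- A i) = (eps p (Z i))\<^sup>2 / r" for i
    using r by (simp add: A_def eps_def power2_eq_square mult_exp_exp exp_diff)
  have eB: "exp (- B i) = r * (eps p (W i))\<^sup>2 / (rho p (Z i) (W i))\<^sup>2" for i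
  proof -
    have "(rho p (Z i) (W i))\<^sup>2 = exp (D i) * ((eps p (Z i))\<^sup>2 * (eps p (W i))\<^sup>2)"
      by (simp add: rho_altdef power_mult_distrib D_def) (simp add: power2_eq_square mult_exp_exp)
    moreover have "exp (- B i) = inverse (exp (- A i)) * inverse (exp (D i))"
      by (simp add: B_def exp_diff exp_minus field_simps)
    ultimately show ?thesis using r by (simp add: eA field_simps)
  qed
  have lr: "(\<lambda>i. rho p (Z i) (W i)) \<longlonglongrightarrow> r" unfolding r_def by (rule rho_limit[OF y Z])
  have eZ: "(\<lambda>i. eps p (Z i)) \<longlonglongrightarrow> 0" and eW: "(\<lambda>i. eps p (W i)) \<longlonglongrightarrow> 0"
    by (rule converges_to_infinity_eps[OF cZ], rule converges_to_infinity_eps[OF cW])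
  have "(\<lambda>i. exp (- A i)) \<longlonglongrightarrow> 0\<^sup>2 / r" unfolding eA using r by (intro tendsto_intros eZ) simp
  then have At: "filterlim A at_top sequentially" by (simp add: exp_uminus_tendsto_0_iff)
  have "(\<lambda>i. exp (- B i)) \<longlonglongrightarrow> r * 0\<^sup>2 / r\<^sup>2" unfolding eB using r by (intro tendsto_intros eW lr) simp
  then have Bt: "filterlim B at_top sequentially" by (simp add: exp_uminus_tendsto_0_iff)
  have "\<forall>i. \<exists>g. geodesic_path g (Z i) (W i)" using geodesic_exists by blast
  then obtain g where g: "\<And>i. geodesic_path (g i) (Z i) (W i)" by metis
  define P where "P i t = g i (A i + t)" for i t
  have ev: "\<forall>\<^sub>F i in sequentially. \<bar>t\<bar> \<le> A i \<and> \<bar>t\<bar> \<le> B i" for t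
    using At Bt by (auto simp: filterlim_at_top intro: eventually_conj)
  have dP: "dist (P i s) (P i t) = \<bar>s - t\<bar>"
    "dist (Z i) (P i t) = A i + t" "dist (P i t) (W i) = B i - t"
    if "\<bar>s\<bar> \<le> A i" "\<bar>s\<bar> \<le> B i" "\<bar>t\<bar> \<le> A i" "\<bar>t\<bar> \<le> B i" for i s t
  proof -
    have gi: "g i 0 = Z i" "g i (D i) = W i"
      and gd: "\<And>s t. s \<in> {0..D i} \<Longrightarrow> t \<in> {0..D i} \<Longrightarrow> dist (g i s) (g i t) = \<bar>s - t\<bar>"
      using g[of i] unfolding geodesic_path_def D_def by blast+
    have DAB: "D i = A i + B i" by (simp add: B_def)
    have in': "A i + s \<in> {0..D i}" "A i + t \<in> {0..D i}" "0 \<in> {0..D i}" "D i \<in> {0..D i}"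
      unfolding DAB using that by auto
    show "dist (P i s) (P i t) = \<bar>s - t\<bar>"
      unfolding P_def gd[OF in'(1,2)] by simp
    show "dist (Z i) (P i t) = A i + t" "dist (P i t) (W i) = B i - t"
      using gd[OF in'(3,2), unfolded gi] gd[OF in'(2,4), unfolded gi] in'(2) DAB 
      unfolding P_def by auto
  qed
  \<comment> \<open>\<open>cosh_between_le\<close> on both segments gives four terms. The two
    pairing \<open>Z\<close> with \<open>W\<close> tend to one each, the two pairing a sequence with
    itself tend to zero, so twice the hyperbolic cosine of the distance is squeezed to two.\<close>
  define K where "K t x = exp (- 2 * t) * (((rho p (Z (fst x)) (Z (snd x)))\<^sup>2 + (eps p (Z (fst x)))\<^sup>2 * (eps p (Z (snd x)))\<^sup>2) / r\<^sup>2)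
      + ((rho p (Z (fst x)) (W (snd x)))\<^sup>2 + (eps p (Z (fst x)))\<^sup>2 * (eps p (W (snd x)))\<^sup>2) / (rho p (Z (snd x)) (W (snd x)))\<^sup>2
      + ((rho p (W (fst x)) (Z (snd x)))\<^sup>2 + (eps p (W (fst x)))\<^sup>2 * (eps p (Z (snd x)))\<^sup>2) / (rho p (Z (fst x)) (W (fst x)))\<^sup>2
      + exp (2 * t) * (r\<^sup>2 * ((rho p (W (fst x)) (W (snd x)))\<^sup>2 + (eps p (W (fst x)))\<^sup>2 * (eps p (W (snd x)))\<^sup>2)
          / ((rho p (Z (fst x)) (W (fst x)))\<^sup>2 * (rho p (Z (snd x)) (W (snd x)))\<^sup>2))" for t x
  have K_lim: "(K t \<longlongrightarrow> 2) (sequentially \<times>\<^sub>F sequentially)" for t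
  proof -
    note F = filterlim_compose[OF _ filterlim_fst] filterlim_compose[OF _ filterlim_snd]
    have "(K t \<longlongrightarrow> exp (- 2 * t) * ((0\<^sup>2 + 0\<^sup>2 * 0\<^sup>2) / r\<^sup>2) + (r\<^sup>2 + 0\<^sup>2 * 0\<^sup>2) / r\<^sup>2 + (r\<^sup>2 + 0\<^sup>2 * 0\<^sup>2) / r\<^sup>2
      + exp (2 * t) * (r\<^sup>2 * (0\<^sup>2 + 0\<^sup>2 * 0\<^sup>2) / (r\<^sup>2 * r\<^sup>2))) (sequentially \<times>\<^sub>F sequentially)"
      unfolding K_def
      using r rho_limit_prod[OF y(1) y(1) Z(1) Z(1), of p] rho_limit_prod[OF y(2) y(2) Z(2) Z(2), of p]
        rho_limit_prod[OF y Z, of p] rho_limit_prod[OF y(2,1) Z(2,1), of p]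
        bourdon_self[OF y(1), of p] bourdon_self[OF y(2), of p] bourdon_commute[OF y(2,1), of p]
      by (intro tendsto_intros F[OF eZ] F[OF eW] F[OF lr]) (simp_all add: r_def)
    then show ?thesis using r by simp
  qed
  have K_bound: "2 * cosh (dist (P i t) (P j t)) \<le> K t (i, j)"
    if i: "\<bar>t\<bar> \<le> A i" "\<bar>t\<bar> \<le> B i" and j: "\<bar>t\<bar> \<le> A j" "\<bar>t\<bar> \<le> B j" for i j t
  proof -
    have E: "2 * cosh (dist x y) \<le> ((rho p x y)\<^sup>2 + (eps p x)\<^sup>2 * (eps p y)\<^sup>2) / ((eps p x)\<^sup>2 * (eps p y)\<^sup>2)" for x y :: 'a
    proof -
      have "2 * cosh (dist x y) \<le> exp (dist x y) + 1" by (simp add: cosh_field_def)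
      also have "exp (dist x y) = (rho p x y)\<^sup>2 / ((eps p x)\<^sup>2 * (eps p y)\<^sup>2)"
      proof -
        have "(rho p x y)\<^sup>2 = exp (dist x y) * ((eps p x)\<^sup>2 * (eps p y)\<^sup>2)"
          by (simp add: rho_altdef power_mult_distrib) (simp add: power2_eq_square mult_exp_exp)
        then show ?thesis by (simp add: field_simps)
      qed
      finally show ?thesis by (simp add: add_divide_distrib)
    qed
    have b: "cosh (dist q (P k t)) \<le> exp (- A k) * exp (- t) * cosh (dist q (Z k)) + exp (- B k) * exp t * cosh (dist q (W k))"
      if k: "\<bar>t\<bar> \<le> A k" "\<bar>t\<bar> \<le> B k" for q k
    proof -
      have "dist (Z k) (P k t) + dist (P k t) (W k) = dist (Z k) (W k)"
        using dP(2,3)[OF k k] by (simp add: B_def D_def)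
      from cosh_between_le[OF this, of q] show ?thesis
        unfolding dP(2,3)[OF k k] by (simp add: exp_diff exp_add exp_minus field_simps)
    qed
    have "2 * cosh (dist (P i t) (P j t)) \<le> 2 * (exp (- A j) * exp (- t) * cosh (dist (P i t) (Z j)) + exp (- B j) * exp t * cosh (dist (P i t) (W j)))"
      using b[OF j, of "P i t"] by simp
    also have "\<dots> \<le> 2 * (exp (- A j) * exp (- t) * (exp (- A i) * exp (- t) * cosh (dist (Z j) (Z i)) + exp (- B i) * exp t * cosh (dist (Z j) (W i)))
         + exp (- B j) * exp t * (exp (- A i) * exp (- t) * cosh (dist (W j) (Z i)) + exp (- B i) * exp t * cosh (dist (W j) (W i))))"
      using b[OF i, of "Z j"] b[OF i, of "W j"]
      by (intro mult_left_mono add_mono) (simp_all add: dist_commute)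
    also have "\<dots> = exp (- A i) * exp (- A j) * (exp (- t) * exp (- t)) * (2 * cosh (dist (Z i) (Z j)))
        + exp (- A i) * exp (- B j) * (exp (- t) * exp t) * (2 * cosh (dist (Z i) (W j)))
        + exp (- B i) * exp (- A j) * (exp (- t) * exp t) * (2 * cosh (dist (W i) (Z j)))
        + exp (- B i) * exp (- B j) * (exp t * exp t) * (2 * cosh (dist (W i) (W j)))"
      by (simp add: algebra_simps dist_commute)
    also have "\<dots> \<le> exp (- A i) * exp (- A j) * (exp (- t) * exp (- t)) * (((rho p (Z i) (Z j))\<^sup>2 + (eps p (Z i))\<^sup>2 * (eps p (Z j))\<^sup>2) / ((eps p (Z i))\<^sup>2 * (eps p (Z j))\<^sup>2))
        + exp (- A i) * exp (- B j) * (exp (- t) * exp t) * (((rho p (Z i) (W j))\<^sup>2 + (eps p (Z i))\<^sup>2 * (eps p (W j))\<^sup>2) / ((eps p (Z i))\<^sup>2 * (eps p (W j))\<^sup>2))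
        + exp (- B i) * exp (- A j) * (exp (- t) * exp t) * (((rho p (W i) (Z j))\<^sup>2 + (eps p (W i))\<^sup>2 * (eps p (Z j))\<^sup>2) / ((eps p (W i))\<^sup>2 * (eps p (Z j))\<^sup>2))
        + exp (- B i) * exp (- B j) * (exp t * exp t) * (((rho p (W i) (W j))\<^sup>2 + (eps p (W i))\<^sup>2 * (eps p (W j))\<^sup>2) / ((eps p (W i))\<^sup>2 * (eps p (W j))\<^sup>2))"
      by (intro add_mono mult_left_mono E) simp_all
    also have "\<dots> = K t (i, j)"
    proof -
      have e: "exp (- t) * exp (- t) = exp (- 2 * t)" "exp (- t) * exp t = 1" "exp t * exp t = exp (2 * t)"
        by (simp_all add: mult_exp_exp)
      show ?thesis
        unfolding e eA eB K_def fst_conv snd_conv using r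
        by (simp add: power2_eq_square mult.assoc)
    qed
    finally show ?thesis .
  qed
  have "Cauchy (\<lambda>i. P i t)" for t
    unfolding Cauchy_def
  proof (intro allI impI)
    fix e :: real assume "0 < e"
    then have "cosh 0 < cosh e" by (subst cosh_real_nonneg_less_iff) simp_all
    then have "2 < 2 * cosh e" by simp
    from order_tendstoD(2)[OF K_lim[of t] this] obtain N where
      N: "\<forall>m\<ge>N. \<forall>n\<ge>N. K t (n, m) < 2 * cosh e" unfolding eventually_prod_sequentially by blast
    obtain M where M: "\<forall>n\<ge>M. \<bar>t\<bar> \<le> A n \<and> \<bar>t\<bar> \<le> B n"
      using ev[of t] unfolding eventually_sequentially by blast
    have "dist (P m t) (P n t) < e" if "m \<ge> N + M" "n \<ge> N + M" for m n
    proof -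
      have "K t (m, n) < 2 * cosh e" using N that by simp
      moreover have "2 * cosh (dist (P m t) (P n t)) \<le> K t (m, n)" 
        using M that by (intro K_bound) simp_all
      ultimately have "2 * cosh (dist (P m t) (P n t)) < 2 * cosh e" by linarith
      then show ?thesis using \<open>0 < e\<close> by (simp add: cosh_real_nonneg_less_iff)
    qed
    then show "\<exists>M. \<forall>m\<ge>M. \<forall>n\<ge>M. dist (P m t) (P n t) < e" by blast
  qed
  then have "\<forall>t. \<exists>l. (\<lambda>i. P i t) \<longlonglongrightarrow> l" using complete_limit by metis
  then obtain \<gamma> where \<gamma>: "\<And>t. (\<lambda>i. P i t) \<longlonglongrightarrow> \<gamma> t" by metis
  have l: "line \<gamma>"
    unfolding line_def
  proof (intro allI)
    fix s t
    have "\<forall>\<^sub>F i in sequentially. dist (P i s) (P i t) = \<bar>s - t\<bar>"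
      using ev[of s] ev[of t] by eventually_elim (auto intro: dP)
    then have "(\<lambda>i. dist (P i s) (P i t)) \<longlonglongrightarrow> \<bar>s - t\<bar>" by (rule tendsto_eventually)
    moreover have "(\<lambda>i. dist (P i s) (P i t)) \<longlonglongrightarrow> dist (\<gamma> s) (\<gamma> t)" by (intro tendsto_dist \<gamma>)
    ultimately show "dist (\<gamma> s) (\<gamma> t) = \<bar>s - t\<bar>" by (rule LIMSEQ_unique[symmetric])
  qed
  have close: "\<forall>\<^sub>F i in sequentially. dist (P i t) (\<gamma> t) < 1" for t
    using \<gamma>[of t] tendstoD zero_less_one by blast
  have ex0: "(\<lambda>n. exp 1 * (exp (- real n / 2) * c)) \<longlonglongrightarrow> 0" for c :: real
  proof -
    have "filterlim (\<lambda>n. real n / 2) at_top sequentially"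
      unfolding filterlim_at_top using real_tail by (auto elim: eventually_mono[rotated] simp: field_simps)
    then have "(\<lambda>n. exp (- (real n / 2))) \<longlonglongrightarrow> 0" by (simp only: exp_uminus_tendsto_0_iff)
    then have "(\<lambda>n. exp 1 * (exp (- (real n / 2)) * c)) \<longlonglongrightarrow> exp 1 * (0 * c)" by (intro tendsto_intros)
    then show ?thesis by simp
  qed
  have half: "exp (ln r / 2) = sqrt r"
    using r by (intro real_sqrt_unique[symmetric]) (simp_all add: power2_eq_square mult_exp_exp)
  \<comment> \<open>Moving \<open>n\<close> units towards \<open>Z i\<close> gains the factor exp
    (-n/2) in \<open>rho\<close>; replacing the point of the segment by its limit costs at most the
    factor exp 1.\<close>
  have end1: "(\<lambda>n. \<gamma> (- real n), Z) \<in> asymptotic_rel"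
  proof (rule asymptotic_if_eventually_close[OF line_converges'[OF l] cZ ex0[of "sqrt r"]])
    fix n :: nat
    show "\<forall>\<^sub>F i in sequentially. rho p (\<gamma> (- real n)) (Z i) \<le> exp 1 * (exp (- real n / 2) * sqrt r)"
      using ev[of "- real n"] close[of "- real n"]
    proof eventually_elim
      case (elim i)
      then have d: "dist (P i (- real n)) (Z i) = A i - real n"
        using dP(2)[of "- real n" i "- real n"] by (simp add: dist_commute)
      have "exp ((A i - real n) / 2) = exp (- real n / 2) * exp (A i / 2)"
        by (simp add: mult_exp_exp field_simps)
      moreover have "exp (A i / 2) * eps p (Z i) = sqrt r"
        using r by (simp add: A_def eps_def mult_exp_exp add_divide_distrib half)
      ultimately have "rho p (P i (- real n)) (Z i) = exp (- real n / 2) * sqrt r * eps p (P i (- real n))"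
        unfolding rho_altdef d by (simp add: mult_ac)
      also have "\<dots> \<le> exp (- real n / 2) * sqrt r" using r by (simp add: mult_left_le)
      finally have "rho p (P i (- real n)) (Z i) \<le> exp (- real n / 2) * sqrt r" .
      moreover have "exp (dist (P i (- real n)) (\<gamma> (- real n))) \<le> exp 1" using elim by simp
      ultimately have "exp (dist (P i (- real n)) (\<gamma> (- real n))) * rho p (P i (- real n)) (Z i)
          \<le> exp 1 * (exp (- real n / 2) * sqrt r)"
        by (intro mult_mono) simp_all
      then show ?case using rho_perturb[of p "\<gamma> (- real n)" "Z i" "P i (- real n)"] by linarith
    qed
  qed
  have end2: "(\<lambda>n. \<gamma> (real n), W) \<in> asymptotic_rel"
  proof (rule asymptotic_if_eventually_close[OF line_converges[OF l] cW ex0[of "inverse (sqrt r)"]])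
    fix n :: nat
    show "\<forall>\<^sub>F i in sequentially. rho p (\<gamma> (real n)) (W i) \<le> exp 1 * (exp (- real n / 2) * inverse (sqrt r))"
      using ev[of "real n"] close[of "real n"]
    proof eventually_elim
      case (elim i)
      then have d: "dist (P i (real n)) (W i) = B i - real n"
        using dP(3)[of "real n" i "real n"] by simp
      have "exp ((B i - real n) / 2) = exp (- real n / 2) * exp (B i / 2)"
        by (simp add: mult_exp_exp field_simps)
      moreover have "exp (B i / 2) * eps p (W i) = rho p (Z i) (W i) * inverse (sqrt r)"
      proof -
        have a: "exp (A i / 2) * eps p (Z i) = sqrt r"
          using r by (simp add: A_def eps_def mult_exp_exp add_divide_distrib half)
        have "exp (D i / 2) = exp (B i / 2) * exp (A i / 2)"
          by (simp add: B_def mult_exp_exp diff_divide_distrib)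
        then have "rho p (Z i) (W i) = exp (B i / 2) * eps p (W i) * sqrt r"
          unfolding rho_altdef D_def[symmetric] a[symmetric] by (simp only: mult_ac)
        then show ?thesis using r by simp
      qed
      ultimately have "rho p (P i (real n)) (W i)
          = exp (- real n / 2) * inverse (sqrt r) * (rho p (Z i) (W i) * eps p (P i (real n)))"
        unfolding rho_altdef[of p "P i (real n)"] d by (simp add: mult_ac)
      also have "\<dots> \<le> exp (- real n / 2) * inverse (sqrt r)"
        using r by (intro mult_left_le mult_le_one) simp_all
      finally have "rho p (P i (real n)) (W i) \<le> exp (- real n / 2) * inverse (sqrt r)" .
      moreover have "exp (dist (P i (real n)) (\<gamma> (real n))) \<le> exp 1" using elim by simp
      ultimately have "exp (dist (P i (real n)) (\<gamma> (real n))) * rho p (P i (real n)) (W i)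
          \<le> exp 1 * (exp (- real n / 2) * inverse (sqrt r))"
        by (intro mult_mono) simp_all
      then show ?case using rho_perturb[of p "\<gamma> (real n)" "W i" "P i (real n)"] by linarith
    qed
  qed
  have "joins \<gamma> y y'"
    unfolding joins_def using l end1 end2 boundary_asymptotic[OF y(1) Z(1)] boundary_asymptotic[OF y(2) Z(2)]
    by (simp add: asymptotic_rel_commute)
  then show ?thesis by (rule that)
qed

text \<open>All \<open>eps\<close> factors cancel in a cross ratio, so it depends on nothing but
  distances between points of the two lines. Both implications of the equality case start from these
  limits.\<close>

lemma cross_ratio_limits:
  fixes \<gamma> \<eta> :: "real \<Rightarrow> 'a" and p :: 'a
  assumes y: "y1 \<in> boundary_at_infinity" "y2 \<in> boundary_at_infinity" "y3 \<in> boundary_at_infinity"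
      "y4 \<in> boundary_at_infinity"
    and ne: "y1 \<noteq> y3" "y2 \<noteq> y4" and j: "joins \<gamma> y1 y3" "joins \<eta> y2 y4"
  defines "r \<equiv> bourdon_metric p"
  shows "(\<lambda>n. exp ((dist (\<gamma> (- real n)) (\<eta> (- real n)) + dist (\<gamma> (real n)) (\<eta> (real n))) / 2 - 2 * real n))
      \<longlonglongrightarrow> r y1 y2 * r y3 y4 / (r y1 y3 * r y2 y4)"
    and "(\<lambda>n. exp ((dist (\<gamma> (real n)) (\<eta> (- real n)) + dist (\<gamma> (- real n)) (\<eta> (real n))) / 2 - 2 * real n))
      \<longlonglongrightarrow> r y2 y3 * r y4 y1 / (r y1 y3 * r y2 y4)"
proof -
  have l: "line \<gamma>" "line \<eta>" using j by (simp_all add: joins_def)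
  have e: "(\<lambda>n. \<gamma> (- real n)) \<in> y1" "(\<lambda>n. \<eta> (- real n)) \<in> y2" "(\<lambda>n. \<gamma> (real n)) \<in> y3" "(\<lambda>n. \<eta> (real n)) \<in> y4"
    using j by (simp_all add: joins_def)
  have pos: "r y1 y3 \<noteq> 0" "r y2 y4 \<noteq> 0"
    using bourdon_pos[of y1 y3 p] bourdon_pos[of y2 y4 p] y ne by (simp_all add: r_def)
  note L = rho_limit[OF _ _ _ _, of _ _ _ _ p, folded r_def]
  have eq: "exp ((dist (\<gamma> s) (\<eta> t) + dist (\<gamma> s') (\<eta> t')) / 2 - 2 * real n)
    = rho p (\<gamma> s) (\<eta> t) * rho p (\<gamma> s') (\<eta> t') / (rho p (\<gamma> s) (\<gamma> s') * rho p (\<eta> t) (\<eta> t'))"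
    if "\<bar>s - s'\<bar> = 2 * real n" "\<bar>t - t'\<bar> = 2 * real n" for n s s' t t'
  proof -
    have "rho p (\<gamma> s) (\<eta> t) * rho p (\<gamma> s') (\<eta> t') / (rho p (\<gamma> s) (\<gamma> s') * rho p (\<eta> t) (\<eta> t'))
      = exp (dist (\<gamma> s) (\<eta> t) / 2) * exp (dist (\<gamma> s') (\<eta> t') / 2) / (exp (real n) * exp (real n))"
      unfolding rho_altdef line_dist[OF l(1), of s] line_dist[OF l(2), of t] that by (simp add: field_simps)
    also have "\<dots> = exp ((dist (\<gamma> s) (\<eta> t) + dist (\<gamma> s') (\<eta> t')) / 2 - 2 * real n)"
      by (simp add: mult_exp_exp add_divide_distrib flip: exp_diff)
    finally show ?thesis by simp
  qed
  show "(\<lambda>n. exp ((dist (\<gamma> (- real n)) (\<eta> (- real n)) + dist (\<gamma> (real n)) (\<eta> (real n))) / 2 - 2 * real n))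
      \<longlonglongrightarrow> r y1 y2 * r y3 y4 / (r y1 y3 * r y2 y4)"
    using pos by (subst eq) (auto intro!: tendsto_intros L y e)
  have "(\<lambda>n. exp ((dist (\<gamma> (real n)) (\<eta> (- real n)) + dist (\<gamma> (- real n)) (\<eta> (real n))) / 2 - 2 * real n))
      \<longlonglongrightarrow> r y3 y2 * r y1 y4 / (r y3 y1 * r y2 y4)"
  proof -
    have "r y3 y1 \<noteq> 0" using pos(1) bourdon_commute[OF y(1,3), of p] by (simp add: r_def)
    then show ?thesis using pos(2) by (subst eq) (auto intro!: tendsto_intros L y e)
  qed
  then show "(\<lambda>n. exp ((dist (\<gamma> (real n)) (\<eta> (- real n)) + dist (\<gamma> (- real n)) (\<eta> (real n))) / 2 - 2 * real n))
      \<longlonglongrightarrow> r y2 y3 * r y4 y1 / (r y1 y3 * r y2 y4)"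
    unfolding r_def bourdon_commute[OF y(3,2)] bourdon_commute[OF y(1,4)] bourdon_commute[OF y(3,1)] .
qed

end

section \<open>Rigidity of crossing lines\<close>

text \<open>The upper bound satisfies the midpoint relation with equality. With \<open>r\<close> the
  distance from \<open>s\<close> to \<open>s0\<close>, the point \<open>s\<close> is one of s0 - r
  and s0 + r, and contact at \<open>s0\<close> leaves no slack at either.\<close>

lemma midpoint_convex_rigidity:
  fixes h :: "real \<Rightarrow> real"
  assumes convex: "\<And>s r. 0 \<le> r \<Longrightarrow> 2 * cosh r * h s \<le> h (s - r) + h (s + r)"
    and le: "\<And>s. h s \<le> \<alpha> * exp s + \<beta> * exp (- s)"
    and eq: "h s0 = \<alpha> * exp s0 + \<beta> * exp (- s0)"
  shows "h s = \<alpha> * exp s + \<beta> * exp (- s)"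
proof -
  define g where "g s = \<alpha> * exp s + \<beta> * exp (- s)" for s
  define r where "r = \<bar>s - s0\<bar>"
  have "g (s0 - r) + g (s0 + r) = 2 * cosh r * g s0"
    by (simp add: g_def cosh_field_def exp_add exp_diff exp_minus field_simps)
  moreover have "2 * cosh r * g s0 \<le> h (s0 - r) + h (s0 + r)"
    using convex[of r s0] eq by (simp add: r_def g_def)
  moreover have "h (s0 - r) \<le> g (s0 - r)" "h (s0 + r) \<le> g (s0 + r)"
    using le[of "s0 - r"] le[of "s0 + r"] by (simp_all add: g_def)
  ultimately have "h (s0 - r) = g (s0 - r)" "h (s0 + r) = g (s0 + r)" by linarith+
  moreover have "s = s0 - r \<or> s = s0 + r" by (auto simp: r_def)
  ultimately have "h s = g s" by metis
  then show ?thesis by (simp add: g_def)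
qed

context star_space
begin

lemma cosh_midpoint:
  fixes \<gamma> :: "real \<Rightarrow> 'a"
  assumes l: "line \<gamma>" and r: "0 \<le> r"
  shows "2 * cosh r * cosh (dist p (\<gamma> s)) \<le> cosh (dist p (\<gamma> (s - r))) + cosh (dist p (\<gamma> (s + r)))"
proof (cases "r = 0")
  case False
  then have s: "0 < sinh r" using r by simp
  have d: "dist (\<gamma> (s - r)) (\<gamma> s) = r" "dist (\<gamma> s) (\<gamma> (s + r)) = r" "dist (\<gamma> (s - r)) (\<gamma> (s + r)) = 2 * r"
    using r by (simp_all add: line_dist[OF l])
  have "cosh (dist p (\<gamma> s)) * sinh (2 * r)
      \<le> sinh r * cosh (dist p (\<gamma> (s - r))) + sinh r * cosh (dist p (\<gamma> (s + r)))"
    using star[of "\<gamma> (s - r)" "\<gamma> s" "\<gamma> (s + r)" p] unfolding d by simp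
  then have "sinh r * (2 * cosh r * cosh (dist p (\<gamma> s)))
      \<le> sinh r * (cosh (dist p (\<gamma> (s - r))) + cosh (dist p (\<gamma> (s + r))))"
    unfolding sinh_double by (simp add: algebra_simps)
  then show ?thesis using s by simp
qed simp

lemma bus_midpoint:
  fixes \<gamma> \<theta> :: "real \<Rightarrow> 'a"
  assumes l: "line \<gamma>" "line \<theta>" and r: "0 \<le> r"
  shows "2 * cosh r * exp (bus \<theta> (\<gamma> s)) \<le> exp (bus \<theta> (\<gamma> (s - r))) + exp (bus \<theta> (\<gamma> (s + r)))"
proof -
  have L: "(\<lambda>n. exp (- real n) * cosh (dist (\<theta> (real n)) x)) \<longlonglongrightarrow> exp (bus \<theta> x) / 2" for x
    using bus_limit[OF l(2), of x]
    by (intro exp_times_cosh_tendsto filterlim_real_sequentially) (simp_all add: dist_commute)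
  have "2 * cosh r * (exp (bus \<theta> (\<gamma> s)) / 2) \<le> exp (bus \<theta> (\<gamma> (s - r))) / 2 + exp (bus \<theta> (\<gamma> (s + r))) / 2"
  proof (rule LIMSEQ_le)
    show "(\<lambda>n. 2 * cosh r * (exp (- real n) * cosh (dist (\<theta> (real n)) (\<gamma> s))))
        \<longlonglongrightarrow> 2 * cosh r * (exp (bus \<theta> (\<gamma> s)) / 2)"
      by (intro tendsto_mult_left L)
    show "(\<lambda>n. exp (- real n) * cosh (dist (\<theta> (real n)) (\<gamma> (s - r))) + exp (- real n) * cosh (dist (\<theta> (real n)) (\<gamma> (s + r))))
        \<longlonglongrightarrow> exp (bus \<theta> (\<gamma> (s - r))) / 2 + exp (bus \<theta> (\<gamma> (s + r))) / 2"
      by (intro tendsto_add L)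
    have "2 * cosh r * (exp (- real n) * cosh (dist (\<theta> (real n)) (\<gamma> s)))
       \<le> exp (- real n) * cosh (dist (\<theta> (real n)) (\<gamma> (s - r))) + exp (- real n) * cosh (dist (\<theta> (real n)) (\<gamma> (s + r)))" for n
      using mult_left_mono[OF cosh_midpoint[OF l(1) r, of "\<theta> (real n)" s], of "exp (- real n)"]
      by (simp add: algebra_simps)
    then show "\<exists>N. \<forall>n\<ge>N. 2 * cosh r * (exp (- real n) * cosh (dist (\<theta> (real n)) (\<gamma> s)))
       \<le> exp (- real n) * cosh (dist (\<theta> (real n)) (\<gamma> (s - r))) + exp (- real n) * cosh (dist (\<theta> (real n)) (\<gamma> (s + r)))"
      by blast
  qed
  then show ?thesis by (simp add: field_simps)
qed

text \<open>The distance from a far point of \<theta> to \<open>\<gamma> s\<close> is estimated on a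
  long segment of \<gamma> and rescaled. The exponents \<open>c\<close> and \<open>c'\<close> are
  renormalised distances from the end of \<theta> to the two ends of \<gamma>.\<close>

lemma bus_line_le:
  fixes \<gamma> \<theta> :: "real \<Rightarrow> 'a"
  assumes l: "line \<gamma>" "line \<theta>"
    and c: "(\<lambda>n. dist (\<gamma> (real n)) (\<theta> (real n)) - 2 * real n) \<longlonglongrightarrow> c"
      "(\<lambda>n. dist (\<gamma> (- real n)) (\<theta> (real n)) - 2 * real n) \<longlonglongrightarrow> c'"
  shows "exp (bus \<theta> (\<gamma> s)) \<le> exp c * exp s + exp c' * exp (- s)"
proof -
  have two: "filterlim (\<lambda>n. 2 * real n) at_top sequentially"
    unfolding filterlim_at_top
  proof
    fix Z :: real
    show "\<forall>\<^sub>F n in sequentially. Z \<le> 2 * real n"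
      using real_tail[of "Z / 2"] by eventually_elim simp
  qed
  have "exp (bus \<theta> (\<gamma> s)) / 2 \<le> exp (- s) * (exp c' / 2) + exp s * (exp c / 2)"
  proof (rule LIMSEQ_le)
    show "(\<lambda>n. exp (- real n) * cosh (dist (\<gamma> s) (\<theta> (real n)))) \<longlonglongrightarrow> exp (bus \<theta> (\<gamma> s)) / 2"
      by (intro exp_times_cosh_tendsto filterlim_real_sequentially bus_limit[OF l(2)]) simp_all
    let ?f = "\<lambda>n. exp (- s) * (exp (- (2 * real n)) * cosh (dist (\<gamma> (- real n)) (\<theta> (real n))))
      + exp s * (exp (- (2 * real n)) * cosh (dist (\<gamma> (real n)) (\<theta> (real n))))"
    show "?f \<longlonglongrightarrow> exp (- s) * (exp c' / 2) + exp s * (exp c / 2)"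
      by (intro tendsto_add tendsto_mult_left exp_times_cosh_tendsto c two) simp_all
    have "\<forall>\<^sub>F n in sequentially. exp (- real n) * cosh (dist (\<gamma> s) (\<theta> (real n))) \<le> ?f n"
      using real_tail[of "\<bar>s\<bar>"]
    proof eventually_elim
      case (elim n)
      have d: "dist (\<gamma> (- real n)) (\<gamma> s) = real n + s" "dist (\<gamma> s) (\<gamma> (real n)) = real n - s"
        "dist (\<gamma> (- real n)) (\<gamma> (real n)) = 2 * real n"
        using elim by (simp_all add: line_dist[OF l(1)])
      have "cosh (dist (\<theta> (real n)) (\<gamma> s)) \<le> exp (- (real n + s)) * cosh (dist (\<theta> (real n)) (\<gamma> (- real n)))
          + exp (- (real n - s)) * cosh (dist (\<theta> (real n)) (\<gamma> (real n)))"
        using cosh_between_le[of "\<gamma> (- real n)" "\<gamma> s" "\<gamma> (real n)" "\<theta> (real n)"] unfolding d by simp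
      then have "exp (- real n) * cosh (dist (\<theta> (real n)) (\<gamma> s))
        \<le> exp (- real n) * (exp (- (real n + s)) * cosh (dist (\<theta> (real n)) (\<gamma> (- real n)))
          + exp (- (real n - s)) * cosh (dist (\<theta> (real n)) (\<gamma> (real n))))"
        by (rule mult_left_mono) simp
      also have "\<dots> = ?f n"
      proof -
        have "exp (- (real n + s)) = exp (- real n) * exp (- s)" "exp (- (real n - s)) = exp (- real n) * exp s"
          "exp (- (2 * real n)) = exp (- real n) * exp (- real n)"
          by (simp_all add: mult_exp_exp)
        then show ?thesis by (simp only: dist_commute[of "\<theta> (real n)"]) (simp only: algebra_simps)
      qed
      finally show ?case by (simp add: dist_commute)
    qed
    then show "\<exists>N. \<forall>n\<ge>N. exp (- real n) * cosh (dist (\<gamma> s) (\<theta> (real n))) \<le> ?f n"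
      by (simp add: eventually_sequentially)
  qed
  then show ?thesis by (simp add: field_simps)
qed

text \<open>The cross ratio controls only a sum of two renormalised distances. Each of them
  decreases by the triangle inequality, and the positive limit \<open>a\<close> bounds the sum from
  below, so both converge.\<close>

lemma paired_limits_exist:
  fixes \<gamma> \<eta> :: "real \<Rightarrow> 'a"
  assumes l: "line \<gamma>" "line \<eta>" and a: "0 < a"
    and lim: "(\<lambda>n. exp ((dist (\<gamma> (- real n)) (\<eta> (- real n)) + dist (\<gamma> (real n)) (\<eta> (real n))) / 2 - 2 * real n)) \<longlonglongrightarrow> a"
  obtains c c' where "(\<lambda>n. dist (\<gamma> (- real n)) (\<eta> (- real n)) - 2 * real n) \<longlonglongrightarrow> c"
    "(\<lambda>n. dist (\<gamma> (real n)) (\<eta> (real n)) - 2 * real n) \<longlonglongrightarrow> c'" "a = exp ((c + c') / 2)"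
proof -
  define u where "u n = dist (\<gamma> (- real n)) (\<eta> (- real n)) - 2 * real n" for n
  define v where "v n = dist (\<gamma> (real n)) (\<eta> (real n)) - 2 * real n" for n
  have du: "u (Suc n) \<le> u n" for n
    using dist_triangle[of "\<gamma> (- real (Suc n))" "\<eta> (- real (Suc n))" "\<gamma> (- real n)"]
      dist_triangle[of "\<gamma> (- real n)" "\<eta> (- real (Suc n))" "\<eta> (- real n)"]
    by (simp add: u_def line_dist[OF l(1)] line_dist[OF l(2)])
  have dv: "v (Suc n) \<le> v n" for n
    using dist_triangle[of "\<gamma> (real (Suc n))" "\<eta> (real (Suc n))" "\<gamma> (real n)"]
      dist_triangle[of "\<gamma> (real n)" "\<eta> (real (Suc n))" "\<eta> (real n)"]
    by (simp add: v_def line_dist[OF l(1)] line_dist[OF l(2)])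
  have u0: "u n \<le> u 0" and v0: "v n \<le> v 0" for n
    using decseqD[of u 0 n] decseqD[of v 0 n] du dv by (simp_all add: decseq_Suc_iff)
  have e: "exp ((u n + v n) / 2) = exp ((dist (\<gamma> (- real n)) (\<eta> (- real n)) + dist (\<gamma> (real n)) (\<eta> (real n))) / 2 - 2 * real n)" for n
    by (simp add: u_def v_def field_simps)
  have la: "(\<lambda>n. exp ((u n + v n) / 2)) \<longlonglongrightarrow> a" using lim by (simp only: e)
  have "decseq (\<lambda>n. exp ((u n + v n) / 2))"
    unfolding decseq_Suc_iff using du dv by (simp add: add_mono)
  then have "a \<le> exp ((u n + v n) / 2)" for n by (rule decseq_ge[OF _ la])
  then have "ln a \<le> ln (exp ((u n + v n) / 2))" for n using a by (subst ln_le_cancel_iff) simp_all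
  then have b: "2 * ln a \<le> u n + v n" for n by (simp add: field_simps)
  have "convergent u"
    by (rule antimono_bounded_convergent[of u "2 * ln a - v 0"], rule du) (use b v0 in \<open>smt (verit)\<close>)
  moreover have "convergent v"
    by (rule antimono_bounded_convergent[of v "2 * ln a - u 0"], rule dv) (use b u0 in \<open>smt (verit)\<close>)
  ultimately obtain c c' where c: "u \<longlonglongrightarrow> c" "v \<longlonglongrightarrow> c'" by (auto simp: convergent_def)
  have "(\<lambda>n. exp ((u n + v n) / 2)) \<longlonglongrightarrow> exp ((c + c') / 2)" by (intro tendsto_intros c) simp
  then have "a = exp ((c + c') / 2)" using la LIMSEQ_unique by blast
  with c show ?thesis using that unfolding u_def v_def by blast
qed

theorem lines_cross:
  fixes \<gamma> \<eta> :: "real \<Rightarrow> 'a"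
  assumes l: "line \<gamma>" "line \<eta>" and ab: "0 < a" "0 < b" "a + b = 1"
    and lim_a: "(\<lambda>n. exp ((dist (\<gamma> (- real n)) (\<eta> (- real n)) + dist (\<gamma> (real n)) (\<eta> (real n))) / 2 - 2 * real n)) \<longlonglongrightarrow> a"
    and lim_b: "(\<lambda>n. exp ((dist (\<gamma> (real n)) (\<eta> (- real n)) + dist (\<gamma> (- real n)) (\<eta> (real n))) / 2 - 2 * real n)) \<longlonglongrightarrow> b"
  obtains s0 t0 k where "-1 < k" "k < 1"
    "\<And>s t. cosh (dist (\<gamma> (s0 + s)) (\<eta> (t0 + t))) = cosh s * cosh t - k * (sinh s * sinh t)"
proof -
  note l' = line_reverse[OF l(2)]
  \<comment> \<open>The digits 1 and 3 stand for the backward and forward end of \<gamma>, the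
    digits 2 and 4 for those of \<eta>.\<close>
  obtain c12 c34 where c12: "(\<lambda>n. dist (\<gamma> (- real n)) (\<eta> (- real n)) - 2 * real n) \<longlonglongrightarrow> c12"
    and c34: "(\<lambda>n. dist (\<gamma> (real n)) (\<eta> (real n)) - 2 * real n) \<longlonglongrightarrow> c34" and a: "a = exp ((c12 + c34) / 2)"
    by (rule paired_limits_exist[OF l ab(1) lim_a])
  obtain c14 c23 where c14: "(\<lambda>n. dist (\<gamma> (- real n)) (\<eta> (real n)) - 2 * real n) \<longlonglongrightarrow> c14"
    and c23: "(\<lambda>n. dist (\<gamma> (real n)) (\<eta> (- real n)) - 2 * real n) \<longlonglongrightarrow> c23" and b: "b = exp ((c14 + c23) / 2)"
    using paired_limits_exist[OF l(1) l' ab(2)] lim_b by (auto simp: add.commute)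
  define f2 where "f2 s = exp (bus (\<lambda>t. \<eta> (- t)) (\<gamma> s))" for s
  define f4 where "f4 s = exp (bus \<eta> (\<gamma> s))" for s
  have f2_le: "f2 s \<le> exp c23 * exp s + exp c12 * exp (- s)" for s
    unfolding f2_def by (rule bus_line_le[OF l(1) l' c23 c12])
  have f4_le: "f4 s \<le> exp c34 * exp s + exp c14 * exp (- s)" for s
    unfolding f4_def by (rule bus_line_le[OF l c34 c14])
  \<comment> \<open>The product of the two bounds is a^2 + b^2 plus two terms with constant product;
    it is smallest where these agree, at this \<open>s0\<close>, with value (a + b)^2 = 1. As the
    product of \<open>f2\<close> and \<open>f4\<close> is never below one, both bounds are attained
    there.\<close>
  define s0 where "s0 = (c12 + c14 - c23 - c34) / 4"
  define G2 where "G2 = exp c23 * exp s0 + exp c12 * exp (- s0)"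
  define G4 where "G4 = exp c34 * exp s0 + exp c14 * exp (- s0)"
  define M where "M = (c12 + c23 + c34 + c14) / 2"
  have ee: "exp c23 * exp s0 * (exp c34 * exp s0) = exp M" "exp c12 * exp (- s0) * (exp c14 * exp (- s0)) = exp M"
    by (simp_all add: mult_exp_exp s0_def M_def field_simps)
  have "G2 * G4 = exp M + exp M + exp c23 * exp s0 * (exp c14 * exp (- s0)) + exp c12 * exp (- s0) * (exp c34 * exp s0)"
    unfolding G2_def G4_def ee(1)[symmetric] unfolding ee(1) 
    using ee by (simp add: algebra_simps)
  also have "\<dots> = (a + b)\<^sup>2"
  proof -
    have "exp c23 * exp s0 * (exp c14 * exp (- s0)) = b * b" "exp c12 * exp (- s0) * (exp c34 * exp s0) = a * a"
      "exp M = a * b"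
      by (simp_all add: a b mult_exp_exp M_def field_simps)
    then show ?thesis by (simp add: power2_eq_square algebra_simps)
  qed
  finally have G: "G2 * G4 = 1" using ab(3) by simp
  have fpos: "0 < f2 s" "0 < f4 s" for s by (simp_all add: f2_def f4_def)
  have Gpos: "0 < G2" "0 < G4" by (simp_all add: G2_def G4_def add_pos_pos)
  have sum0: "1 \<le> f2 s0 * f4 s0"
    using bus_sum_nonneg[OF l(2), of "\<gamma> s0"] by (simp add: f2_def f4_def mult_exp_exp add.commute)
  have f2G: "f2 s0 \<le> G2" "f4 s0 \<le> G4" using f2_le f4_le by (simp_all add: G2_def G4_def)
  have "G2 * G4 \<le> f2 s0 * f4 s0" using sum0 G by simp
  also have "\<dots> \<le> f2 s0 * G4" using f2G fpos by (simp add: mult_left_mono less_imp_le)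
  finally have f2_eq: "f2 s0 = G2" using Gpos f2G by simp
  have "G2 * G4 \<le> G2 * f4 s0" using sum0 G f2_eq by simp
  then have f4_eq: "f4 s0 = G4" using Gpos f2G by simp
  have F2: "f2 s = exp c23 * exp s + exp c12 * exp (- s)" for s
    using f2_le f2_eq unfolding G2_def
    by (rule midpoint_convex_rigidity[rotated]) (simp add: f2_def bus_midpoint[OF l(1) l'])
  have F4: "f4 s = exp c34 * exp s + exp c14 * exp (- s)" for s
    using f4_le f4_eq unfolding G4_def
    by (rule midpoint_convex_rigidity[rotated]) (simp add: f4_def bus_midpoint[OF l])
  \<comment> \<open>The Busemann function of the backward end takes the value \<open>t\<close> at
    \<open>\<eta> t\<close>, so this is the only candidate for the parameter of the crossing point
    on \<eta>.\<close>
  define t0 where "t0 = bus (\<lambda>t. \<eta> (- t)) (\<gamma> s0)"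
  have f2t: "f2 s0 = exp t0" by (simp add: f2_def t0_def)
  have "exp (bus \<eta> (\<gamma> s0) + t0) = 1"
    using f2_eq f4_eq G by (simp add: f2_def f4_def t0_def exp_add mult.commute)
  then have bt: "bus \<eta> (\<gamma> s0) = - t0" by simp
  have f4t: "f4 s0 = exp (- t0)" by (simp add: f4_def bt)
  have "cosh (dist (\<gamma> s0) (\<eta> t0)) \<le> 1"
    using cosh_line_le[OF l(2), of "\<gamma> s0" t0] by (simp add: bt flip: t0_def)
  then have meet: "\<eta> t0 = \<gamma> s0" by (rule cosh_dist_le_1D[symmetric])
  \<comment> \<open>The coefficients of \<open>f2\<close> and \<open>f4\<close> recentred at the
    crossing point. Two normalisations and the choice of \<open>s0\<close> leave the single
    parameter \<open>A\<close>, and \<open>2 * A - 1\<close> becomes the cosine of the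
    angle.\<close>
  define A where "A = exp c23 * exp s0 * exp (- t0)"
  define B where "B = exp c12 * exp (- s0) * exp (- t0)"
  define C where "C = exp c34 * exp s0 * exp t0"
  define E where "E = exp c14 * exp (- s0) * exp t0"
  have "A + B = f2 s0 * exp (- t0)" unfolding F2 A_def B_def by (simp add: algebra_simps)
  then have AB: "A + B = 1" by (simp add: f2t mult_exp_exp)
  have "C + E = f4 s0 * exp t0" unfolding F4 C_def E_def by (simp add: algebra_simps)
  then have CE: "C + E = 1" by (simp add: f4t mult_exp_exp)
  have "A * C = B * E"
  proof -
    have t: "exp (- t0) * exp t0 = 1" by (simp add: mult_exp_exp)
    have "A * C = (exp c23 * exp s0 * (exp c34 * exp s0)) * (exp (- t0) * exp t0)"
      by (simp only: A_def C_def mult_ac)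
    moreover have "B * E = (exp c12 * exp (- s0) * (exp c14 * exp (- s0))) * (exp (- t0) * exp t0)"
      by (simp only: B_def E_def mult_ac)
    ultimately show ?thesis by (simp only: ee t)
  qed
  moreover have "B = 1 - A" "E = 1 - C" using AB CE by linarith+
  ultimately have "A * C = (1 - A) * (1 - C)" by (simp only:)
  then have AC: "A + C = 1" by (simp add: algebra_simps)
  then have BE: "C = B" "E = A" using AB CE by simp_all
  have pos: "0 < A" "0 < B" by (simp_all add: A_def B_def)
  have m: "exp (- (x + y)) = exp (- x) * exp (- y)" for x y :: real by (simp add: mult_exp_exp)
  have f2s: "f2 (s0 + s) * exp (- (t0 + t)) = (A * exp s + B * exp (- s)) * exp (- t)" for s t
    unfolding F2 A_def B_def m exp_add by (simp only: algebra_simps)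
  have f4s: "f4 (s0 + s) * exp (t0 + t) = (B * exp s + A * exp (- s)) * exp t" for s t
    unfolding F4 BE[symmetric] C_def E_def m exp_add by (simp only: algebra_simps)
  have key: "cosh (dist (\<gamma> (s0 + s)) (\<eta> (t0 + t))) = cosh s * cosh t - (2 * A - 1) * (sinh s * sinh t)" for s t
  proof -
    have bd: "cosh (dist (\<gamma> (s0 + s)) (\<eta> t')) \<le> f4 (s0 + s) / 2 * exp t' + f2 (s0 + s) / 2 * exp (- t')" for t'
      using cosh_line_le[OF l(2), of "\<gamma> (s0 + s)" t'] unfolding f2_def f4_def
      by (simp add: exp_add exp_diff exp_minus field_simps)
    \<comment> \<open>At \<open>t0\<close> the point of \<eta> lies on \<gamma>, so its distance is
      known and the bound \<open>bd\<close> is attained. Rigidity in the second variable then gives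
      all other parameters.\<close>
    have "f4 (s0 + s) / 2 * exp t0 + f2 (s0 + s) / 2 * exp (- t0)
        = (f4 (s0 + s) * exp (t0 + 0) + f2 (s0 + s) * exp (- (t0 + 0))) / 2"
      by (simp add: add_divide_distrib)
    also have "\<dots> = ((B * exp s + A * exp (- s)) + (A * exp s + B * exp (- s))) / 2"
      unfolding f2s f4s by simp
    also have "\<dots> = (A + B) * cosh s" by (simp add: cosh_field_def field_simps)
    also have "\<dots> = cosh (dist (\<gamma> (s0 + s)) (\<eta> t0))" unfolding meet AB by (simp add: line_dist[OF l(1)])
    finally have "cosh (dist (\<gamma> (s0 + s)) (\<eta> t0)) = f4 (s0 + s) / 2 * exp t0 + f2 (s0 + s) / 2 * exp (- t0)" ..
    with bd have "cosh (dist (\<gamma> (s0 + s)) (\<eta> (t0 + t)))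
        = f4 (s0 + s) / 2 * exp (t0 + t) + f2 (s0 + s) / 2 * exp (- (t0 + t))"
      by (rule midpoint_convex_rigidity[rotated]) (rule cosh_midpoint[OF l(2)])
    also have "\<dots> = ((B * exp s + A * exp (- s)) * exp t + (A * exp s + B * exp (- s)) * exp (- t)) / 2"
      using f2s[of s t] f4s[of s t] by simp
    also have "\<dots> = (A + B) * (cosh s * cosh t) - (A - B) * (sinh s * sinh t)"
      by (simp add: cosh_field_def sinh_field_def field_simps)
    also have "A - B = 2 * A - 1" using AB by simp
    finally show ?thesis unfolding AB by simp
  qed
  show ?thesis by (rule that[OF _ _ key]) (use pos AB in simp_all)
qed

end

subsection \<open>The model of two crossing lines\<close>

text \<open>\<open>bform k\<close> is the Lorentzian form in the basis consisting of the crossing point and the unit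
  directions of the two lines, which enclose an angle with cosine \<open>k\<close>.\<close>

definition bform :: "real \<Rightarrow> real \<times> real \<times> real \<Rightarrow> real \<times> real \<times> real \<Rightarrow> real" where
  "bform k Z W = fst Z * fst W - fst (snd Z) * fst (snd W) - snd (snd Z) * snd (snd W)
     - k * (fst (snd Z) * snd (snd W) + snd (snd Z) * fst (snd W))"

lemma bform_linear:
  "bform k (Z + Z') W = bform k Z W + bform k Z' W"
  "bform k W (Z + Z') = bform k W Z + bform k W Z'"
  "bform k (c *\<^sub>R Z) W = c * bform k Z W"
  "bform k W (c *\<^sub>R Z) = c * bform k W Z"
  "bform k (Z - Z') W = bform k Z W - bform k Z' W"
  "bform k W (Z - Z') = bform k W Z - bform k W Z'"
  by (simp_all add: bform_def algebra_simps)

lemma bform_commute: "bform k Z W = bform k W Z"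
  by (simp add: bform_def algebra_simps)

lemma bform_tendsto:
  "(f \<longlongrightarrow> Z) F \<Longrightarrow> (g \<longlongrightarrow> W) F \<Longrightarrow> ((\<lambda>x. bform k (f x) (g x)) \<longlongrightarrow> bform k Z W) F"
  unfolding bform_def by (intro tendsto_intros)

text \<open>The vectors of the points of the two lines in this basis.\<close>

definition mU :: "real \<Rightarrow> real \<times> real \<times> real" where "mU s = (cosh s, sinh s, 0)"
definition mW :: "real \<Rightarrow> real \<times> real \<times> real" where "mW t = (cosh t, 0, sinh t)"

text \<open>The cone over the open quadrilateral. Its extreme rays are the null vectors of the four
  ends of the lines; equality in place of the strict inequality describes the sides.\<close>

definition cone :: "(real \<times> real \<times> real) set" where
  "cone = {(a, x, y). \<bar>x\<bar> + \<bar>y\<bar> < a}"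

definition cone_cl :: "(real \<times> real \<times> real) set" where
  "cone_cl = {(a, x, y). \<bar>x\<bar> + \<bar>y\<bar> \<le> a}"

lemma bform_mU_mW [simp]:
  "bform k (mU s) (mU s') = cosh (s - s')" "bform k (mW s) (mW s') = cosh (s - s')"
  "bform k (mU s) (mW t) = cosh s * cosh t - k * (sinh s * sinh t)"
  "bform k (mW t) (mU s) = cosh s * cosh t - k * (sinh s * sinh t)"
  by (simp_all add: bform_def mU_def mW_def cosh_diff)

lemma bform_cone_pos:
  assumes k: "-1 < k" "k < 1" and Z: "Z \<in> cone"
  shows "0 < bform k Z Z"
proof -
  obtain a x y where [simp]: "Z = (a, x, y)" by (cases Z)
  have a: "\<bar>x\<bar> + \<bar>y\<bar> < a" using Z by (simp add: cone_def)
  have "(\<bar>x\<bar> + \<bar>y\<bar>)\<^sup>2 < a\<^sup>2" using a by (intro power_strict_mono) simp_all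
  then have "x\<^sup>2 + y\<^sup>2 + 2 * (\<bar>x\<bar> * \<bar>y\<bar>) < a\<^sup>2" by (simp add: power2_sum)
  moreover have "\<bar>k * (x * y)\<bar> \<le> 1 * \<bar>x * y\<bar>" unfolding abs_mult[of k] using k by (intro mult_right_mono) simp_all
  then have "k * (x * y) \<le> \<bar>x\<bar> * \<bar>y\<bar>"
    using abs_ge_self[of "k * (x * y)"] unfolding abs_mult[of x] by linarith
  ultimately have "0 < a\<^sup>2 - x\<^sup>2 - y\<^sup>2 - 2 * (k * (x * y))" by linarith
  then show ?thesis by (simp add: bform_def power2_eq_square algebra_simps)
qed

lemma cone_scaleR:
  assumes "Z \<in> cone" "0 < c"
  shows "c *\<^sub>R Z \<in> cone"
proof -
  obtain a x y where Z: "Z = (a, x, y)" by (cases Z)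
  have "c * (\<bar>x\<bar> + \<bar>y\<bar>) < c * a" using assms by (simp add: Z cone_def)
  then show ?thesis using assms(2) by (simp add: Z cone_def abs_mult distrib_left)
qed

lemma cone_decompose:
  assumes "Z \<in> cone"
  obtains l m s t where "0 \<le> l" "0 \<le> m" "Z = l *\<^sub>R mU s + m *\<^sub>R mW t"
proof -
  obtain a x y where [simp]: "Z = (a, x, y)" by (cases Z)
  have a: "\<bar>x\<bar> + \<bar>y\<bar> < a" using assms by (simp add: cone_def)
  have part: "\<exists>l s. 0 \<le> l \<and> l * cosh s = b \<and> l * sinh s = z" if b: "\<bar>z\<bar> < b" for b z :: real
  proof -
    have "z\<^sup>2 < b\<^sup>2" using b by (metis abs_ge_zero power2_abs power_strict_mono zero_less_numeral)
    define l where "l = sqrt (b\<^sup>2 - z\<^sup>2)"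
    have l: "0 < l" "l\<^sup>2 = b\<^sup>2 - z\<^sup>2" using \<open>z\<^sup>2 < b\<^sup>2\<close> by (simp_all add: l_def)
    define s where "s = arsinh (z / l)"
    have s: "l * sinh s = z" using l by (simp add: s_def)
    have "(l * cosh s)\<^sup>2 = l\<^sup>2 + (l * sinh s)\<^sup>2"
      by (simp add: power_mult_distrib cosh_square_eq algebra_simps)
    also have "\<dots> = b\<^sup>2" using l s by simp
    finally have sq: "(l * cosh s)\<^sup>2 = b\<^sup>2" .
    have "0 \<le> l * cosh s" "0 \<le> b" using l(1) b by simp_all
    then have "l * cosh s = b" by (rule power2_eq_imp_eq[OF sq])
    then show ?thesis using l s by (intro exI[of _ l] exI[of _ s]) simp
  qed
  \<comment> \<open>Half of the slack goes to each line, so that both parts are timelike and can be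
    normalised.\<close>
  define d where "d = (a - \<bar>x\<bar> - \<bar>y\<bar>) / 2"
  have d: "0 < d" "\<bar>x\<bar> + d + (\<bar>y\<bar> + d) = a" using a by (simp_all add: d_def)
  obtain l s where l: "0 \<le> l" "l * cosh s = \<bar>x\<bar> + d" "l * sinh s = x" using part[of x "\<bar>x\<bar> + d"] d by auto
  obtain m t where m: "0 \<le> m" "m * cosh t = \<bar>y\<bar> + d" "m * sinh t = y" using part[of y "\<bar>y\<bar> + d"] d by auto
  have "Z = l *\<^sub>R mU s + m *\<^sub>R mW t" using l m d(2) by (simp add: mU_def mW_def)
  then show ?thesis using that l(1) m(1) by blast
qed

locale crossing_lines = star_space X for X :: "'a::metric_space itself" +
  fixes \<gamma> \<eta> :: "real \<Rightarrow> 'a" and k :: real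
  assumes line_gamma: "line \<gamma>" and line_eta: "line \<eta>" and k_bounds: "-1 < k" "k < 1"
    and cross: "cosh (dist (\<gamma> s) (\<eta> t)) = cosh s * cosh t - k * (sinh s * sinh t)"
begin

text \<open>A relation rather than a map: \<open>Z\<close> has many decompositions, and that they
  lead to the same point follows only from \<open>models_dist\<close>. The last clause stores the
  comparison inequality of \<open>barycenter\<close>.\<close>

definition models :: "'a \<Rightarrow> real \<times> real \<times> real \<Rightarrow> bool" where
  "models x Z \<longleftrightarrow> bform k Z Z = 1 \<and> (\<exists>l m s t. 0 \<le> l \<and> 0 \<le> m \<and> Z = l *\<^sub>R mU s + m *\<^sub>R mW t \<and>
     dist (\<gamma> s) x + dist x (\<eta> t) = dist (\<gamma> s) (\<eta> t) \<and>
     cosh (dist (\<gamma> s) x) = l + m * cosh (dist (\<gamma> s) (\<eta> t)) \<and>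
     cosh (dist x (\<eta> t)) = l * cosh (dist (\<gamma> s) (\<eta> t)) + m \<and>
     (\<forall>p. cosh (dist p x) \<le> l * cosh (dist p (\<gamma> s)) + m * cosh (dist p (\<eta> t))))"

lemma models_exists:
  assumes "Z \<in> cone" and B: "bform k Z Z = 1"
  obtains x where "models x Z"
proof -
  obtain l m s t where lm: "0 \<le> l" "0 \<le> m" and Z: "Z = l *\<^sub>R mU s + m *\<^sub>R mW t"
    using cone_decompose[OF assms(1)] by blast
  have "l\<^sup>2 + m\<^sup>2 + 2 * l * m * cosh (dist (\<gamma> s) (\<eta> t)) = bform k Z Z"
    unfolding Z cross by (simp add: bform_linear power2_eq_square algebra_simps)
  then have "l\<^sup>2 + m\<^sup>2 + 2 * l * m * cosh (dist (\<gamma> s) (\<eta> t)) = 1" using B by simp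
  from barycenter[OF lm this] obtain x where "dist (\<gamma> s) x + dist x (\<eta> t) = dist (\<gamma> s) (\<eta> t)"
     "cosh (dist (\<gamma> s) x) = l + m * cosh (dist (\<gamma> s) (\<eta> t))"
     "cosh (dist x (\<eta> t)) = l * cosh (dist (\<gamma> s) (\<eta> t)) + m"
     "\<And>p. cosh (dist p x) \<le> l * cosh (dist p (\<gamma> s)) + m * cosh (dist p (\<eta> t))" by blast
  then have "models x Z" unfolding models_def using lm Z B by blast
  then show ?thesis by (rule that)
qed

lemma models_gamma: "models (\<gamma> s) (mU s)"
  unfolding models_def
proof (intro conjI exI)
  show "mU s = 1 *\<^sub>R mU s + 0 *\<^sub>R mW 0" by simp
qed simp_all

lemma models_eta: "models (\<eta> t) (mW t)"
  unfolding models_def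
proof (intro conjI exI)
  show "mW t = 0 *\<^sub>R mU 0 + 1 *\<^sub>R mW t" by simp
qed simp_all

text \<open>Along each line the comparison bound is the model value, and it is attained at the end
  of the segment through \<open>x\<close>, where the distance is known. Rigidity gives equality on
  the whole line.\<close>

lemma models_dist_lines:
  assumes "models x Z"
  shows models_dist_gamma: "cosh (dist x (\<gamma> s')) = bform k Z (mU s')"
    and models_dist_eta: "cosh (dist x (\<eta> t')) = bform k Z (mW t')"
proof -
  obtain l m s t where Z: "Z = l *\<^sub>R mU s + m *\<^sub>R mW t" and lm: "0 \<le> l" "0 \<le> m"
    and e: "cosh (dist (\<gamma> s) x) = l + m * cosh (dist (\<gamma> s) (\<eta> t))"
     "cosh (dist x (\<eta> t)) = l * cosh (dist (\<gamma> s) (\<eta> t)) + m"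
    and le: "\<And>p. cosh (dist p x) \<le> l * cosh (dist p (\<gamma> s)) + m * cosh (dist p (\<eta> t))"
    using assms unfolding models_def by blast
  obtain a u v where auv: "Z = (a, u, v)" by (cases Z)
  have U: "bform k Z (mU r) = (a - (u + k * v)) / 2 * exp r + (a + (u + k * v)) / 2 * exp (- r)" for r
    unfolding auv by (simp add: bform_def mU_def cosh_field_def sinh_field_def field_simps)
  have W: "bform k Z (mW r) = (a - (v + k * u)) / 2 * exp r + (a + (v + k * u)) / 2 * exp (- r)" for r
    unfolding auv by (simp add: bform_def mW_def cosh_field_def sinh_field_def field_simps)
  show "cosh (dist x (\<gamma> s')) = bform k Z (mU s')"
    unfolding U
  proof (rule midpoint_convex_rigidity)
    show "cosh (dist x (\<gamma> r)) \<le> (a - (u + k * v)) / 2 * exp r + (a + (u + k * v)) / 2 * exp (- r)" for r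
    proof -
      have "bform k Z (mU r) = l * cosh (dist (\<gamma> r) (\<gamma> s)) + m * cosh (dist (\<gamma> r) (\<eta> t))"
        unfolding Z bform_linear bform_mU_mW cross dist_commute[of "\<gamma> r" "\<gamma> s"] line_dist[OF line_gamma]
        by (simp add: abs_minus_commute)
      then show ?thesis unfolding U[symmetric] dist_commute[of x] using le[of "\<gamma> r"] by simp
    qed
    show "cosh (dist x (\<gamma> s)) = (a - (u + k * v)) / 2 * exp s + (a + (u + k * v)) / 2 * exp (- s)"
      unfolding U[symmetric] using e(1) by (simp add: Z bform_linear cross dist_commute[of x])
  qed (rule cosh_midpoint[OF line_gamma])
  show "cosh (dist x (\<eta> t')) = bform k Z (mW t')"
    unfolding W
  proof (rule midpoint_convex_rigidity)
    show "cosh (dist x (\<eta> r)) \<le> (a - (v + k * u)) / 2 * exp r + (a + (v + k * u)) / 2 * exp (- r)" for r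
    proof -
      have "bform k Z (mW r) = l * cosh (dist (\<eta> r) (\<gamma> s)) + m * cosh (dist (\<eta> r) (\<eta> t))"
        unfolding Z bform_linear bform_mU_mW dist_commute[of "\<eta> r" "\<gamma> s"] cross dist_commute[of "\<eta> r" "\<eta> t"] 
          line_dist[OF line_eta] by (simp add: abs_minus_commute)
      then show ?thesis unfolding W[symmetric] dist_commute[of x] using le[of "\<eta> r"] by simp
    qed
    show "cosh (dist x (\<eta> t)) = (a - (v + k * u)) / 2 * exp t + (a + (v + k * u)) / 2 * exp (- t)"
      unfolding W[symmetric] using e(2) by (simp add: Z bform_linear cross)
  qed (rule cosh_midpoint[OF line_eta])
qed

text \<open>The decomposition of \<open>Z\<close> reduces the bound to distances from
  \<open>x'\<close> to points of the two lines, which are already exact.\<close>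

lemma models_dist_le:
  assumes "models x Z" "models x' Z'"
  shows "cosh (dist x' x) \<le> bform k Z' Z"
proof -
  obtain l m s t where Z: "Z = l *\<^sub>R mU s + m *\<^sub>R mW t" 
    and le: "\<And>p. cosh (dist p x) \<le> l * cosh (dist p (\<gamma> s)) + m * cosh (dist p (\<eta> t))"
    using assms(1) unfolding models_def by blast
  show ?thesis using le[of x'] by (simp add: models_dist_lines[OF assms(2)] Z bform_linear)
qed

lemma crossing_unique:
  assumes "dist (\<gamma> s) (\<eta> t) = 0"
  shows "s = 0 \<and> t = 0"
proof -
  have c: "cosh s * cosh t - k * (sinh s * sinh t) = 1" using cross[of s t] assms by simp
  have "cosh (dist (\<gamma> 0) (\<eta> 0)) \<le> 1" using cross[of 0 0] by simp
  then have m: "\<gamma> 0 = \<eta> 0" by (rule cosh_dist_le_1D)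
  have "\<bar>s\<bar> = dist (\<gamma> s) (\<gamma> 0)" by (simp add: line_dist[OF line_gamma])
  also have "\<dots> = dist (\<eta> t) (\<eta> 0)" using assms m by simp
  also have "\<dots> = \<bar>t\<bar>" by (simp add: line_dist[OF line_eta])
  finally have st: "t = s \<or> t = - s" by linarith
  have "cosh s * cosh s = 1 + sinh s * sinh s" using cosh_square_eq[of s] by (simp add: power2_eq_square)
  then have "sinh s * sinh s * (1 - k) = 0 \<or> sinh s * sinh s * (1 + k) = 0"
    using c st by (auto simp: algebra_simps)
  then have "s = 0" using k_bounds by auto
  then show ?thesis using st by auto
qed

text \<open>The lower bound comes from prolonging the segment through \<open>x\<close> beyond its
  end on \<eta> to a model point \<open>x2\<close>. That end lies between \<open>x\<close> and
  \<open>x2\<close> and has a known distance to \<open>x'\<close>; together with the upper bound for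
  \<open>x2\<close> this bounds the distance from \<open>x'\<close> to \<open>x\<close> from
  below.\<close>

lemma models_dist:
  assumes x: "models x Z" and x': "models x' Z'"
  shows "cosh (dist x' x) = bform k Z' Z"
proof -
  obtain l m s t where Z: "Z = l *\<^sub>R mU s + m *\<^sub>R mW t" and lm: "0 \<le> l" "0 \<le> m"
    and bt: "dist (\<gamma> s) x + dist x (\<eta> t) = dist (\<gamma> s) (\<eta> t)"
    and B: "bform k Z Z = 1"
    using x unfolding models_def by blast
  show ?thesis
  proof (cases "dist (\<gamma> s) (\<eta> t) = 0")
    case True
    then have st: "s = 0" "t = 0" using crossing_unique by blast+
    have "dist (\<gamma> s) x = 0" using bt True zero_le_dist[of "\<gamma> s" x] zero_le_dist[of x "\<eta> t"] by linarith
    then have xg: "x = \<gamma> 0" by (simp add: st)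
    have "Z = (l + m) *\<^sub>R mU 0" unfolding Z st by (simp add: mU_def mW_def)
    moreover from this B have "(l + m) * (l + m) = 1" by (simp add: bform_linear)
    then have "l + m = 1" using lm by (simp add: square_eq_1_iff)
    ultimately have "Z = mU 0" by simp
    then show ?thesis unfolding xg using models_dist_gamma[OF x'] by simp
  next
    case False
    \<comment> \<open>Small enough for \<open>Z0\<close>, which lies beyond \<open>mW t\<close> as
      seen from \<open>mU s\<close>, to stay in the cone: \<open>e\<close> times exp |s| is exp
      (-|t|), the slack of \<open>mW t\<close>.\<close>
    define e where "e = exp (- \<bar>s\<bar> - \<bar>t\<bar>)"
    have e: "0 < e" by (simp add: e_def)
    define Z0 where "Z0 = mW t + e *\<^sub>R (mW t - mU s)"
    have Z0: "Z0 \<in> cone"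
    proof -
      have q: "cosh z + \<bar>sinh z\<bar> = exp \<bar>z\<bar>" "cosh z - \<bar>sinh z\<bar> = exp (- \<bar>z\<bar>)" for z :: real
        using cosh_plus_sinh[of "\<bar>z\<bar>"] cosh_minus_sinh[of "\<bar>z\<bar>"] by simp_all
      have "e * (cosh s + \<bar>sinh s\<bar>) = cosh t - \<bar>sinh t\<bar>"
        unfolding q e_def by (simp add: mult_exp_exp)
      moreover have "0 < cosh t - \<bar>sinh t\<bar>" unfolding q by simp
      then have "0 < e * (cosh t - \<bar>sinh t\<bar>)" using e by simp
      ultimately have "e * \<bar>sinh s\<bar> + (1 + e) * \<bar>sinh t\<bar> < (1 + e) * cosh t - e * cosh s"
        by (simp add: algebra_simps)
      moreover have "\<bar>sinh t + e * sinh t\<bar> = (1 + e) * \<bar>sinh t\<bar>"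
      proof -
        have "sinh t + e * sinh t = (1 + e) * sinh t" by (simp add: algebra_simps)
        then show ?thesis using e by (simp add: abs_mult)
      qed
      ultimately show ?thesis using e
        by (simp add: cone_def Z0_def mU_def mW_def abs_mult algebra_simps)
    qed
    define n where "n = sqrt (bform k Z0 Z0)"
    have n: "0 < n" "n\<^sup>2 = bform k Z0 Z0" using bform_cone_pos[OF k_bounds Z0] by (simp_all add: n_def)
    define Z2 where "Z2 = (1 / n) *\<^sub>R Z0"
    have Z2: "Z2 \<in> cone" using Z0 n by (simp add: Z2_def cone_scaleR)
    have B2: "bform k Z2 Z2 = 1" using n by (simp add: Z2_def bform_linear power2_eq_square flip: n(2))
    obtain x2 where x2: "models x2 Z2" using models_exists[OF Z2 B2] by blast
    \<comment> \<open>Barycentric coordinates of \<open>mW t\<close> between \<open>mU s\<close> and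
      \<open>Z2\<close>.\<close>
    define \<alpha> \<beta> where "\<alpha> = e / (1 + e)" and "\<beta> = n / (1 + e)"
    have ab: "0 < \<alpha>" "0 < \<beta>" using e n by (simp_all add: \<alpha>_def \<beta>_def)
    have W: "mW t = \<alpha> *\<^sub>R mU s + \<beta> *\<^sub>R Z2"
    proof -
      have "(1 + e) *\<^sub>R mW t = e *\<^sub>R mU s + n *\<^sub>R Z2"
        using n by (simp add: Z2_def Z0_def algebra_simps)
      then have "(1 / (1 + e)) *\<^sub>R ((1 + e) *\<^sub>R mW t) = (1 / (1 + e)) *\<^sub>R (e *\<^sub>R mU s + n *\<^sub>R Z2)" by simp
      then show ?thesis using e by (simp add: \<alpha>_def \<beta>_def scaleR_add_right)
    qed
    define D where "D = dist (\<gamma> s) x2"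
    have cD: "cosh D = bform k (mU s) Z2"
      using models_dist_gamma[OF x2, of s] by (simp add: D_def dist_commute bform_commute)
    have "bform k (mW t) (mW t) = \<alpha>\<^sup>2 + \<beta>\<^sup>2 + 2 * \<alpha> * \<beta> * cosh D"
      unfolding W cD by (simp add: bform_linear B2 bform_commute[of k Z2 "mU s"] power2_eq_square algebra_simps)
    then have norm1: "\<alpha>\<^sup>2 + \<beta>\<^sup>2 + 2 * \<alpha> * \<beta> * cosh D = 1" by simp
    obtain r where r: "0 \<le> r" "r \<le> D" "cosh r = \<alpha> + \<beta> * cosh D" "cosh (D - r) = \<alpha> * cosh D + \<beta>"
      "sinh r = \<beta> * sinh D" "sinh (D - r) = \<alpha> * sinh D"
      by (rule barycentric_param[OF _ _ _ norm1]) (use ab in \<open>simp_all add: D_def\<close>)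
    have "cosh (dist (\<gamma> s) (\<eta> t)) = bform k (mU s) (mW t)" by (simp add: cross)
    also have "\<dots> = cosh r" unfolding W r(3) cD by (simp add: bform_linear)
    finally have duv: "dist (\<gamma> s) (\<eta> t) = r" using r(1) by simp
    have "cosh (dist x2 (\<eta> t)) = bform k Z2 (mW t)" by (rule models_dist_eta[OF x2])
    also have "\<dots> = cosh (D - r)" unfolding W r(4) cD by (simp add: bform_linear B2 bform_commute[of k Z2 "mU s"])
    finally have dvx2: "dist (\<eta> t) x2 = D - r" using r(2) by (simp add: dist_commute)
    have norm2: "(l + m * \<alpha>)\<^sup>2 + (m * \<beta>)\<^sup>2 + 2 * (l + m * \<alpha>) * (m * \<beta>) * cosh D = 1"
    proof -
      have "Z = (l + m * \<alpha>) *\<^sub>R mU s + (m * \<beta>) *\<^sub>R Z2" unfolding Z W by (simp add: algebra_simps)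
      then have "bform k Z Z = (l + m * \<alpha>)\<^sup>2 + (m * \<beta>)\<^sup>2 + 2 * (l + m * \<alpha>) * (m * \<beta>) * cosh D"
        unfolding cD by (simp add: bform_linear B2 bform_commute[of k Z2 "mU s"] power2_eq_square algebra_simps)
      then show ?thesis using B by simp
    qed
    obtain q where q: "0 \<le> q" "q \<le> D" "cosh q = (l + m * \<alpha>) + (m * \<beta>) * cosh D"
      "sinh q = (m * \<beta>) * sinh D" "sinh (D - q) = (l + m * \<alpha>) * sinh D"
      by (rule barycentric_param[OF _ _ _ norm2]) (use ab lm in \<open>simp_all add: D_def\<close>)
    have "cosh (dist x (\<gamma> s)) = bform k Z (mU s)" by (rule models_dist_gamma[OF x])
    also have "\<dots> = cosh q" unfolding q(3) cD Z W by (simp add: bform_linear bform_commute[of k Z2 "mU s"] algebra_simps)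
    finally have dux: "dist (\<gamma> s) x = q" using q(1) by (simp add: dist_commute)
    have dxv: "dist x (\<eta> t) = r - q" using bt unfolding duv dux by simp
    \<comment> \<open>From above through \<open>\<eta> t\<close>, from below through the total
      length \<open>D\<close>; hence \<open>\<eta> t\<close> lies between \<open>x\<close> and
      \<open>x2\<close>.\<close>
    have dxx2: "dist x x2 = D - q"
      using dist_triangle[of x x2 "\<eta> t"] dist_triangle[of "\<gamma> s" x2 x] dxv dvx2 dux by (simp add: D_def)
    have D0: "0 < sinh D" using False r duv by simp
    have "dist x (\<eta> t) + dist (\<eta> t) x2 = dist x x2" unfolding dxv dvx2 dxx2 by simp
    from star[OF this, of x'] have "cosh (dist x' (\<eta> t)) * sinh (D - q)
        \<le> sinh (D - r) * cosh (dist x' x) + sinh (r - q) * cosh (dist x' x2)"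
      unfolding dxv dvx2 dxx2 .
    also have "\<dots> \<le> sinh (D - r) * cosh (dist x' x) + sinh (r - q) * bform k Z' Z2"
      using models_dist_le[OF x2 x'] dxv zero_le_dist[of x "\<eta> t"] 
      by (intro add_left_mono mult_left_mono) simp_all
    finally have le: "bform k Z' (mW t) * sinh (D - q) \<le> sinh (D - r) * cosh (dist x' x) + sinh (r - q) * bform k Z' Z2"
      unfolding models_dist_eta[OF x'] .
    define P Q where "P = bform k Z' (mU s)" and "Q = bform k Z' Z2"
    have PQ: "bform k Z' (mW t) = \<alpha> * P + \<beta> * Q" "bform k Z' Z = (l + m * \<alpha>) * P + m * \<beta> * Q"
      unfolding Z W P_def Q_def by (simp_all add: bform_linear algebra_simps)
    \<comment> \<open>Expresses that the model values satisfy the comparison at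
      \<open>\<eta> t\<close> with equality.\<close>
    have id: "sinh r * sinh (D - q) = sinh (D - r) * sinh q + sinh D * sinh (r - q)"
    proof -
      have "sinh D * sinh (r - q) * ((cosh r)\<^sup>2 - (sinh r)\<^sup>2) = sinh D * sinh (r - q)" 
        by (simp add: cosh_square_eq)
      then show ?thesis by (simp add: sinh_diff algebra_simps)
    qed
    have "sinh D * (bform k Z' (mW t) * sinh (D - q)) = (sinh (D - r) * P + sinh r * Q) * sinh (D - q)"
      unfolding PQ r(5,6) by (simp add: algebra_simps)
    also have "\<dots> = sinh (D - r) * P * sinh (D - q) + Q * (sinh (D - r) * sinh q + sinh D * sinh (r - q))"
      unfolding id[symmetric] by (simp add: algebra_simps)
    also have "\<dots> = sinh D * (sinh (D - r) * bform k Z' Z + sinh (r - q) * Q)"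
      unfolding PQ q(4,5) by (simp add: algebra_simps)
    finally have "bform k Z' (mW t) * sinh (D - q) = sinh (D - r) * bform k Z' Z + sinh (r - q) * Q"
      using D0 by simp
    with le have "sinh (D - r) * bform k Z' Z \<le> sinh (D - r) * cosh (dist x' x)" unfolding Q_def by simp
    moreover have "0 < sinh (D - r)" unfolding r(6) using ab D0 by simp
    ultimately have "bform k Z' Z \<le> cosh (dist x' x)" by simp
    then show ?thesis using models_dist_le[OF x x'] by simp
  qed
qed

text \<open>Pushing towards the crossing point \<open>(1, 0, 0)\<close> and renormalising moves a
  vector on a side into the open cone.\<close>

lemma cone_cl_approx:
  assumes "Z \<in> cone_cl" "bform k Z Z = 1"
  obtains f where "f \<longlonglongrightarrow> Z" "\<And>n. f n \<in> cone" "\<And>n. bform k (f n) (f n) = 1"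
proof -
  define g where "g n = Z + (1 / (real n + 1)) *\<^sub>R (1, 0, 0)" for n
  have g: "g n \<in> cone" for n
  proof -
    obtain a x y where Z: "Z = (a, x, y)" by (cases Z)
    have "0 < 1 / (real n + 1)" by simp
    moreover have "\<bar>x\<bar> + \<bar>y\<bar> \<le> a" using assms(1) by (simp add: Z cone_cl_def)
    ultimately have "\<bar>x\<bar> + \<bar>y\<bar> < a + 1 / (real n + 1)" by linarith
    then show ?thesis by (simp add: Z g_def cone_def)
  qed
  have "(\<lambda>n. 1 / (real n + 1)) \<longlonglongrightarrow> 0" using LIMSEQ_inverse_real_of_nat by (simp add: inverse_eq_divide add.commute)
  then have "g \<longlonglongrightarrow> Z + 0 *\<^sub>R (1, 0, 0)" unfolding g_def by (intro tendsto_intros)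
  then have gl: "g \<longlonglongrightarrow> Z" by (simp only: scaleR_zero_left add_0_right)
  define f where "f n = (1 / sqrt (bform k (g n) (g n))) *\<^sub>R g n" for n
  have pos: "0 < bform k (g n) (g n)" for n by (rule bform_cone_pos[OF k_bounds g])
  have "f \<longlonglongrightarrow> (1 / sqrt (bform k Z Z)) *\<^sub>R Z"
    unfolding f_def using assms(2) by (intro tendsto_intros bform_tendsto gl) simp
  then have "f \<longlonglongrightarrow> Z" using assms(2) by simp
  moreover have "f n \<in> cone" for n
    using g[of n] pos[of n] by (simp add: f_def cone_scaleR)
  moreover have "bform k (f n) (f n) = 1" for n
    using pos[of n] by (simp add: f_def bform_linear flip: power2_eq_square)
  ultimately show ?thesis by (rule that)
qed

text \<open>Model points are available for the open cone. The exact distance formula makes the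
  images of an approximating sequence Cauchy, so completeness adds the sides.\<close>

theorem rigid_extension:
  obtains F where "\<And>Z Z'. Z \<in> cone_cl \<Longrightarrow> bform k Z Z = 1 \<Longrightarrow> Z' \<in> cone_cl \<Longrightarrow> bform k Z' Z' = 1 \<Longrightarrow>
      cosh (dist (F Z) (F Z')) = bform k Z Z'"
    "\<And>s. F (mU s) = \<gamma> s" "\<And>t. F (mW t) = \<eta> t"
proof -
  have ex: "\<exists>x f g. x \<longlonglongrightarrow> f \<and> g \<longlonglongrightarrow> Z \<and> (\<forall>n. models (x n) (g n))"
    if Z: "Z \<in> cone_cl" "bform k Z Z = 1" for Z
  proof -
    obtain g where g: "g \<longlonglongrightarrow> Z" "\<And>n. g n \<in> cone" "\<And>n. bform k (g n) (g n) = 1"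
      using cone_cl_approx[OF Z] by blast
    have "\<forall>n. \<exists>x. models x (g n)" using models_exists g by metis
    then obtain x where x: "\<And>n. models (x n) (g n)" by metis
    have "((\<lambda>z. bform k (g (fst z)) (g (snd z))) \<longlongrightarrow> bform k Z Z) (sequentially \<times>\<^sub>F sequentially)"
      by (intro bform_tendsto filterlim_compose[OF g(1) filterlim_fst] filterlim_compose[OF g(1) filterlim_snd])
    then have lim: "((\<lambda>z. bform k (g (fst z)) (g (snd z))) \<longlongrightarrow> 1) (sequentially \<times>\<^sub>F sequentially)"
      unfolding Z(2) .
    have "Cauchy x"
      unfolding Cauchy_def
    proof (intro allI impI)
      fix e :: real assume "0 < e"
      then have "cosh 0 < cosh e" by (subst cosh_real_nonneg_less_iff) simp_all
      then have "1 < cosh e" by simp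
      from order_tendstoD(2)[OF lim this] obtain N where
        N: "\<forall>m\<ge>N. \<forall>n\<ge>N. bform k (g n) (g m) < cosh e" unfolding eventually_prod_sequentially by auto
      have "dist (x m) (x n) < e" if "m \<ge> N" "n \<ge> N" for m n
      proof -
        have "cosh (dist (x m) (x n)) < cosh e" using models_dist[OF x x] N that by simp
        then show ?thesis using \<open>0 < e\<close> by (simp add: cosh_real_nonneg_less_iff)
      qed
      then show "\<exists>M. \<forall>m\<ge>M. \<forall>n\<ge>M. dist (x m) (x n) < e" by blast
    qed
    then obtain f where "x \<longlonglongrightarrow> f" by (rule complete_limit)
    then show ?thesis using g(1) x by blast
  qed
  define S where "S = {Z. Z \<in> cone_cl \<and> bform k Z Z = 1}"
  have "\<forall>Z\<in>S. \<exists>f. \<exists>x g. x \<longlonglongrightarrow> f \<and> g \<longlonglongrightarrow> Z \<and> (\<forall>n. models (x n) (g n))"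
    using ex unfolding S_def by blast
  then obtain F where F: "\<And>Z. Z \<in> S \<Longrightarrow> \<exists>x g. x \<longlonglongrightarrow> F Z \<and> g \<longlonglongrightarrow> Z \<and> (\<forall>n. models (x n) (g n))"
    by metis
  have dF: "cosh (dist y (F Z)) = bform k W Z" if Z: "Z \<in> S" and y: "y = lim u" "convergent u" and W: "w \<longlonglongrightarrow> W" and uw: "\<And>n. models (u n) (w n)" for Z y u w W
  proof -
    obtain x g where x: "x \<longlonglongrightarrow> F Z" "g \<longlonglongrightarrow> Z" "\<And>n. models (x n) (g n)" using F[OF Z] by blast
    have "(\<lambda>n. cosh (dist (u n) (x n))) \<longlonglongrightarrow> cosh (dist y (F Z))"
      using y by (intro tendsto_cosh tendsto_dist x) (simp add: convergent_LIMSEQ_iff)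
    moreover have "(\<lambda>n. cosh (dist (u n) (x n))) \<longlonglongrightarrow> bform k W Z"
      unfolding models_dist[OF x(3) uw] by (rule bform_tendsto[OF W x(2)])
    ultimately show ?thesis by (rule LIMSEQ_unique)
  qed
  have dist_F: "cosh (dist (F Z) (F Z')) = bform k Z Z'" if Z: "Z \<in> S" "Z' \<in> S" for Z Z'
  proof -
    obtain x g where x: "x \<longlonglongrightarrow> F Z" "g \<longlonglongrightarrow> Z" "\<And>n. models (x n) (g n)" using F[OF Z(1)] by blast
    show ?thesis by (rule dF[OF Z(2) _ _ x(2,3)]) (use x(1) in \<open>auto simp: limI convergent_def\<close>)
  qed
  have agree: "F Z = y" if y: "models y Z" and Z: "Z \<in> S" for y Z
  proof -
    have "cosh (dist y (F Z)) = bform k Z Z"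
      by (rule dF[OF Z _ _ tendsto_const y]) (auto simp: limI convergent_const)
    then show ?thesis using Z cosh_dist_le_1D[of y "F Z"] by (simp add: S_def)
  qed
  have abs_sinh: "\<bar>sinh s\<bar> \<le> cosh s" for s :: real
    using sinh_le_cosh_real[of "\<bar>s\<bar>"] by simp
  have "mU s \<in> cone_cl" "mW s \<in> cone_cl" for s
    by (simp_all add: cone_cl_def mU_def mW_def abs_sinh)
  then have in_S: "mU s \<in> S" "mW s \<in> S" for s by (simp_all add: S_def)
  have "F (mU s) = \<gamma> s" for s by (rule agree[OF models_gamma in_S(1)])
  moreover have "F (mW t) = \<eta> t" for t by (rule agree[OF models_eta in_S(2)])
  ultimately show ?thesis using dist_F that[of F] by (simp add: S_def)
qed

end

section \<open>Isometric images of convex sets\<close>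

lemma geodesically_convexD:
  assumes "geodesically_convex C" "x \<in> C" "y \<in> C" "geodesic_path \<gamma> x y" "t \<in> {0..dist x y}"
  shows "\<gamma> t \<in> C"
  using assms unfolding geodesically_convex_def by blast

lemma geodesically_convex_hull: "geodesically_convex (geodesically_convex hull (S :: 'a::metric_space set))"
proof (rule hull_in)
  fix T :: "'a set set" assume T: "\<forall>C\<in>T. geodesically_convex C"
  show "geodesically_convex (\<Inter>T)"
    unfolding geodesically_convex_def
  proof (intro ballI allI impI Inter_greatest)
    fix x y \<gamma> C assume "x \<in> \<Inter>T" "y \<in> \<Inter>T" "geodesic_path \<gamma> x y" "C \<in> T"
    then show "\<gamma> ` {0..dist x y} \<subseteq> C" using T by (auto intro: geodesically_convexD)
  qed
qed

lemma geodesic_path_isometric_image: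
  assumes iso: "\<And>x y. x \<in> A \<Longrightarrow> y \<in> A \<Longrightarrow> dist (f x) (f y) = dist x y"
    and g: "geodesic_path \<gamma> x y" "\<gamma> ` {0..dist x y} \<subseteq> A"
  shows "geodesic_path (\<lambda>t. f (\<gamma> t)) (f x) (f y)"
proof -
  have e: "\<gamma> 0 = x" "\<gamma> (dist x y) = y" using g(1) by (simp_all add: geodesic_path_def)
  have "0 \<in> {0..dist x y}" "dist x y \<in> {0..dist x y}" by simp_all
  then have "\<gamma> 0 \<in> A" "\<gamma> (dist x y) \<in> A" using g(2) by blast+
  then have "x \<in> A" "y \<in> A" unfolding e .
  then have d: "dist (f x) (f y) = dist x y" by (rule iso)
  show ?thesis
    unfolding geodesic_path_def d using g iso by (simp add: geodesic_path_def image_subset_iff)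
qed

lemma isometric_converges:
  assumes iso: "\<And>x y. x \<in> A \<Longrightarrow> y \<in> A \<Longrightarrow> dist (f x) (f y) = dist x y" and Z: "\<And>n. Z n \<in> A"
  shows "converges_to_infinity (\<lambda>n. f (Z n)) \<longleftrightarrow> converges_to_infinity Z"
proof -
  have "rho (f (Z 0)) (f (Z i)) (f (Z j)) = rho (Z 0) (Z i) (Z j)" for i j
    by (simp add: rho_def gromov_product_def iso Z)
  then show ?thesis
    by (simp add: converges_to_infinity_iff[of Z "Z 0"] converges_to_infinity_iff[of _ "f (Z 0)"])
qed

lemma isometric_asymptotic:
  assumes iso: "\<And>x y. x \<in> A \<Longrightarrow> y \<in> A \<Longrightarrow> dist (f x) (f y) = dist x y"
    and Z: "\<And>n. Z n \<in> A" "\<And>n. W n \<in> A"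
  shows "((\<lambda>n. f (Z n)), (\<lambda>n. f (W n))) \<in> asymptotic_rel \<longleftrightarrow> (Z, W) \<in> asymptotic_rel"
proof -
  have "rho (f (Z 0)) (f (Z i)) (f (W i)) = rho (Z 0) (Z i) (W i)" for i
    by (simp add: rho_def gromov_product_def iso Z)
  moreover have "converges_to_infinity (\<lambda>n. f (Z n)) = converges_to_infinity Z"
    "converges_to_infinity (\<lambda>n. f (W n)) = converges_to_infinity W"
    by (rule isometric_converges[OF iso Z(1)], assumption+, rule isometric_converges[OF iso Z(2)], assumption+)
  ultimately show ?thesis
    by (simp add: asymptotic_rel_iff[of _ _ "Z 0"] asymptotic_rel_iff[of _ _ "f (Z 0)"])
qed

context star_space
begin

text \<open>The comparison at \<open>v\<close> for the point \<open>w\<close> has the right-hand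
  side \<open>sinh (dist x y)\<close>, so the hyperbolic cosine of their distance is at most
  one.\<close>

lemma between_unique:
  fixes x y v w :: 'a
  assumes v: "dist x v + dist v y = dist x y" and w: "dist x w + dist w y = dist x y"
    and e: "dist x v = dist x w"
  shows "v = w"
proof (cases "dist x y = 0")
  case True
  then have "dist x v = 0" "dist x w = 0"
    using v w zero_le_dist[of x v] zero_le_dist[of v y] zero_le_dist[of x w] zero_le_dist[of w y] by linarith+
  then show ?thesis by simp
next
  case False
  define d r where "d = dist x y" and "r = dist x v"
  have d: "dist x w = r" "dist v y = d - r" "dist w y = d - r" using v w e unfolding d_def r_def by linarith+
  have "cosh (dist w v) * sinh d \<le> sinh (d - r) * cosh r + sinh r * cosh (d - r)"
    using star[OF v, of w] unfolding dist_commute[of w x] d d_def[symmetric] r_def[symmetric] .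
  also have "\<dots> = sinh d" using sinh_add[of "d - r" r] by (simp add: mult.commute)
  finally have "cosh (dist w v) * sinh d \<le> 1 * sinh d" by simp
  moreover have "0 < sinh d" using False by (simp add: d_def)
  ultimately have "cosh (dist w v) \<le> 1" by (simp only: mult_le_cancel_right_pos)
  then show ?thesis using cosh_dist_le_1D by metis
qed

lemma geodesic_path_unique:
  fixes x y :: 'a
  assumes g: "geodesic_path \<gamma> x y" "geodesic_path \<gamma>' x y" and t: "t \<in> {0..dist x y}"
  shows "\<gamma> t = \<gamma>' t"
proof -
  have *: "dist x (\<delta> t) = t \<and> dist (\<delta> t) y = dist x y - t" if d: "geodesic_path \<delta> x y" for \<delta>
  proof -
    have e: "\<delta> 0 = x" "\<delta> (dist x y) = y"
      and dd: "\<And>s t. s \<in> {0..dist x y} \<Longrightarrow> t \<in> {0..dist x y} \<Longrightarrow> dist (\<delta> s) (\<delta> t) = \<bar>s - t\<bar>"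
      using d unfolding geodesic_path_def by blast+
    show ?thesis using dd[of 0 t] dd[of t "dist x y"] t by (simp add: e)
  qed
  show ?thesis by (rule between_unique[of x _ y]) (use *[OF g(1)] *[OF g(2)] in simp_all)
qed

end

text \<open>Geodesics in the target are unique, so those between image points are images of
  geodesics. Hence the image of the hull is convex, and so is the preimage in \<open>A\<close> of
  the hull of the image.\<close>

lemma hull_isometric_image:
  fixes f :: "'b::metric_space \<Rightarrow> 'a::metric_space"
  assumes spaces: "star_space TYPE('a)" "star_space TYPE('b)"
    and iso: "\<And>x y. x \<in> A \<Longrightarrow> y \<in> A \<Longrightarrow> dist (f x) (f y) = dist x y"
    and A: "geodesically_convex A" and S: "S \<subseteq> A"
  shows "geodesically_convex hull (f ` S) = f ` (geodesically_convex hull S)"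
proof (rule equalityI)
  interpret a: star_space "TYPE('a)" by (rule spaces)
  interpret b: star_space "TYPE('b)" by (rule spaces)
  have HA: "geodesically_convex hull S \<subseteq> A" by (rule hull_minimal[where S=geodesically_convex, OF S A])
  have path: "geodesic_path (\<lambda>t. f (\<gamma> t)) (f x) (f y)" if "x \<in> A" "y \<in> A" "geodesic_path \<gamma> x y" for \<gamma> x y
  proof (rule geodesic_path_isometric_image[OF iso that(3)])
    show "\<gamma> ` {0..dist x y} \<subseteq> A" using geodesically_convexD[OF A that] by blast
  qed
  have "\<gamma> ` {0..dist u v} \<subseteq> f ` (geodesically_convex hull S)"
    if uv: "u \<in> f ` (geodesically_convex hull S)" "v \<in> f ` (geodesically_convex hull S)"
      and g: "geodesic_path \<gamma> u v" for u v \<gamma>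
  proof -
    from uv obtain x y where xy: "u = f x" "v = f y" "x \<in> geodesically_convex hull S" "y \<in> geodesically_convex hull S"
      by blast
    have xyA: "x \<in> A" "y \<in> A" using xy HA by blast+
    obtain \<delta> where d: "geodesic_path \<delta> x y" using b.geodesic_exists by blast
    have "\<gamma> t \<in> f ` (geodesically_convex hull S)" if t: "t \<in> {0..dist u v}" for t
    proof -
      have t': "t \<in> {0..dist x y}" using t iso[OF xyA] by (simp add: xy)
      have "\<gamma> t = f (\<delta> t)"
        using a.geodesic_path_unique[OF g[unfolded xy] path[OF xyA d]] t by (simp add: xy)
      moreover have "\<delta> t \<in> geodesically_convex hull S"
        by (rule geodesically_convexD[OF geodesically_convex_hull xy(3,4) d t'])
      ultimately show ?thesis by blast
    qed
    then show ?thesis by blast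
  qed
  then have "geodesically_convex (f ` (geodesically_convex hull S))"
    by (intro geodesically_convex_def[THEN iffD2] ballI allI impI)
  from hull_minimal[where S=geodesically_convex, OF image_mono[OF hull_subset] this]
  show "geodesically_convex hull (f ` S) \<subseteq> f ` (geodesically_convex hull S)" .
  let ?C = "{x \<in> A. f x \<in> geodesically_convex hull (f ` S)}"
  have "\<gamma> ` {0..dist x y} \<subseteq> ?C" if x: "x \<in> ?C" "y \<in> ?C" and g: "geodesic_path \<gamma> x y" for x y \<gamma>
  proof -
    from x have xyA: "x \<in> A" "y \<in> A" by blast+
    have "\<gamma> t \<in> ?C" if t: "t \<in> {0..dist x y}" for t
    proof -
      have "f (\<gamma> t) \<in> geodesically_convex hull (f ` S)"
        using x t iso[OF xyA] by (intro geodesically_convexD[OF geodesically_convex_hull _ _ path[OF xyA g]]) auto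
      then show ?thesis using geodesically_convexD[OF A xyA g t] by blast
    qed
    then show ?thesis by blast
  qed
  then have "geodesically_convex ?C"
    by (intro geodesically_convex_def[THEN iffD2] ballI allI impI)
  moreover have "S \<subseteq> ?C" using S hull_subset[of "f ` S" geodesically_convex] by blast
  ultimately have "geodesically_convex hull S \<subseteq> ?C"
    by (intro hull_minimal[where S=geodesically_convex and t="?C"])
  then show "f ` (geodesically_convex hull S) \<subseteq> geodesically_convex hull (f ` S)" by blast
qed

section \<open>The model quadrilateral\<close>

text \<open>Coordinates of the hyperbolic plane adapted to the two lines through $i$ with directions
  \<open>(0, 1)\<close> and \<open>(sqrt (1 - k\<^sup>2), k)\<close>, which enclose an angle with cosine \<open>k\<close>.\<close>

definition co :: "real \<Rightarrow> hyp_plane \<Rightarrow> real \<times> real \<times> real" where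
  "co k z = ((hP z + hQ z) / 2, (hQ z - hP z) / 2 - k * (hR z / sqrt (1 - k\<^sup>2)), hR z / sqrt (1 - k\<^sup>2))"

definition pt :: "real \<Rightarrow> real \<times> real \<times> real \<Rightarrow> hyp_plane" where
  "pt k Z = hmk (fst Z - fst (snd Z) - k * snd (snd Z)) (sqrt (1 - k\<^sup>2) * snd (snd Z))"

lemma hQ_pos: "0 < hQ z"
proof -
  have "0 < hP z * hQ z" using hPQR[of z] zero_le_power2[of "hR z"] by linarith
  then show ?thesis using hP_pos[of z] by (simp add: zero_less_mult_iff)
qed

locale angle =
  fixes k :: real
  assumes k: "-1 < k" "k < 1"
begin

abbreviation "ell \<equiv> sqrt (1 - k\<^sup>2)"

lemma ell: "0 < ell" "ell\<^sup>2 = 1 - k\<^sup>2"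
proof -
  have "k\<^sup>2 < 1" using k by (simp add: abs_square_less_1)
  then show "0 < ell" "ell\<^sup>2 = 1 - k\<^sup>2" by simp_all
qed

lemma cosh_dist_co: "cosh (dist z w) = bform k (co k z) (co k w)"
proof -
  define u v where "u = hR z / ell" and "v = hR w / ell"
  have R: "hR z = ell * u" "hR w = ell * v" using ell(1) by (simp_all add: u_def v_def)
  have e: "ell * ell = 1 - k\<^sup>2" using ell(2) by (simp add: power2_eq_square)
  have "hR z * hR w = (ell * ell) * (u * v)" unfolding R by (simp only: mult_ac)
  then have "hR z * hR w = (1 - k\<^sup>2) * (u * v)" by (simp only: e)
  then have "cosh (dist z w) = (hP z * hQ w + hQ z * hP w) / 2 - (1 - k\<^sup>2) * (u * v)"
    by (simp only: cosh_dist_hyp)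
  also have "\<dots> = bform k (co k z) (co k w)"
    unfolding bform_def co_def u_def[symmetric] v_def[symmetric] fst_conv snd_conv
    by (simp add: field_simps power2_eq_square)
  finally show ?thesis .
qed

lemma bform_co [simp]: "bform k (co k z) (co k z) = 1"
  using cosh_dist_co[of z z] by simp

lemma co_pt:
  assumes B: "bform k Z Z = 1" and a: "0 < fst Z"
  shows "co k (pt k Z) = Z"
proof -
  obtain a x y where Z: "Z = (a, x, y)" by (cases Z)
  have e: "ell * ell = 1 - k\<^sup>2" using ell(2) by (simp add: power2_eq_square)
  have "(ell * y)\<^sup>2 = (1 - k\<^sup>2) * y\<^sup>2" using ell(2) by (simp add: power_mult_distrib)
  then have PQ: "(a - x - k * y) * (a + x + k * y) - (ell * y)\<^sup>2 = 1"
    using B by (simp add: Z bform_def power2_eq_square algebra_simps)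
  then have "0 < (a - x - k * y) * (a + x + k * y)" using zero_le_power2[of "ell * y"] by linarith
  then have P: "0 < a - x - k * y" using a by (auto simp: Z zero_less_mult_iff)
  show ?thesis
    using P ell(1) hQ_hmk[OF P PQ] by (simp add: co_def pt_def Z add_divide_distrib)
qed

text \<open>The closed quadrilateral, cut out by four linear inequalities. The hull of the vertices
  is shown to lie inside it, and this inclusion is what the frontier argument needs.\<close>

definition region :: "hyp_plane set" where
  "region = {z. co k z \<in> cone_cl}"

lemma cone_cl_combination:
  assumes "Z \<in> cone_cl" "W \<in> cone_cl" "0 \<le> l" "0 \<le> m"
  shows "l *\<^sub>R Z + m *\<^sub>R W \<in> cone_cl"
proof -
  obtain a x y b u v where Z: "Z = (a, x, y)" and W: "W = (b, u, v)" by (cases Z, cases W)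
  have "\<bar>l * x + m * u\<bar> + \<bar>l * y + m * v\<bar> \<le> (l * \<bar>x\<bar> + m * \<bar>u\<bar>) + (l * \<bar>y\<bar> + m * \<bar>v\<bar>)"
    using assms(3,4) abs_triangle_ineq[of "l * x" "m * u"] abs_triangle_ineq[of "l * y" "m * v"]
    by (simp add: abs_mult)
  also have "\<dots> = l * (\<bar>x\<bar> + \<bar>y\<bar>) + m * (\<bar>u\<bar> + \<bar>v\<bar>)" by (simp add: algebra_simps)
  also have "\<dots> \<le> l * a + m * b"
    using assms by (intro add_mono mult_left_mono) (simp_all add: Z W cone_cl_def)
  finally show ?thesis by (simp add: Z W cone_cl_def)
qed

lemma convex_region: "geodesically_convex region"
  unfolding geodesically_convex_def
proof (intro ballI allI impI)
  fix x y \<gamma> assume x: "x \<in> region" and y: "y \<in> region" and g: "geodesic_path \<gamma> x y"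
  have "\<gamma> t \<in> region" if t: "t \<in> {0..dist x y}" for t
  proof -
    have e: "\<gamma> 0 = x" "\<gamma> (dist x y) = y"
      and dd: "\<And>s t. s \<in> {0..dist x y} \<Longrightarrow> t \<in> {0..dist x y} \<Longrightarrow> dist (\<gamma> s) (\<gamma> t) = \<bar>s - t\<bar>"
      using g unfolding geodesic_path_def by blast+
    have "dist x (\<gamma> t) + dist (\<gamma> t) y = dist x y"
      using dd[of 0 t] dd[of t "dist x y"] t by (simp add: e)
    then obtain l m where lm: "0 \<le> l" "0 \<le> m" 
      and v: "hP (\<gamma> t) = l * hP x + m * hP y" "hQ (\<gamma> t) = l * hQ x + m * hQ y" "hR (\<gamma> t) = l * hR x + m * hR y"
      by (rule hyp_between_coords)
    have "co k (\<gamma> t) = l *\<^sub>R co k x + m *\<^sub>R co k y"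
      unfolding co_def v using ell(1) by (simp add: field_simps)
    then show ?thesis using cone_cl_combination[OF _ _ lm] x y by (simp add: region_def)
  qed
  then show "\<gamma> ` {0..dist x y} \<subseteq> region" by blast
qed

text \<open>As |k| < 1, a null vector of the closed cone has a vanishing second or third component:
  up to scaling there are four of them, the ends of the two lines.\<close>

definition ideal_vector :: "real \<times> real \<times> real \<Rightarrow> bool" where
  "ideal_vector N \<longleftrightarrow> N \<in> cone_cl \<and> bform k N N = 0 \<and> 0 < fst N"

text \<open>The line whose ends are the null directions \<open>N\<close> and \<open>N'\<close>.\<close>

definition nvec :: "real \<times> real \<times> real \<Rightarrow> real \<times> real \<times> real \<Rightarrow> real \<Rightarrow> real \<times> real \<times> real" where
  "nvec N N' t = (1 / sqrt (2 * bform k N N')) *\<^sub>R (exp t *\<^sub>R N' + exp (- t) *\<^sub>R N)"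

definition nline :: "real \<times> real \<times> real \<Rightarrow> real \<times> real \<times> real \<Rightarrow> real \<Rightarrow> hyp_plane" where
  "nline N N' t = pt k (nvec N N' t)"

lemma nline_uminus: "nline N N' (- t) = nline N' N t"
  by (simp add: nline_def nvec_def bform_commute[of k N N'] add.commute)

lemma nvec_props:
  assumes N: "ideal_vector N" "ideal_vector N'" and pos: "0 < bform k N N'"
  shows "bform k (nvec N N' s) (nvec N N' t) = cosh (s - t)" "0 < fst (nvec N N' t)" "nvec N N' t \<in> cone_cl"
proof -
  have n: "bform k N N = 0" "bform k N' N' = 0" using N by (simp_all add: ideal_vector_def)
  define q where "q = 1 / sqrt (2 * bform k N N')"
  have q: "q * q = 1 / (2 * bform k N N')" using pos by (simp add: q_def)
  have "bform k (nvec N N' s) (nvec N N' t)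
    = (q * q) * ((exp s * exp (- t) + exp (- s) * exp t) * bform k N N')"
    unfolding nvec_def q_def[symmetric] bform_linear n bform_commute[of k N' N] by (simp add: algebra_simps)
  also have "\<dots> = (exp s * exp (- t) + exp (- s) * exp t) / 2" unfolding q using pos by simp
  also have "\<dots> = cosh (s - t)" by (simp add: cosh_field_def mult_exp_exp)
  finally show "bform k (nvec N N' s) (nvec N N' t) = cosh (s - t)" .
  show "0 < fst (nvec N N' t)"
    using N pos by (simp add: nvec_def ideal_vector_def add_pos_pos)
  have "nvec N N' t = (exp t / sqrt (2 * bform k N N')) *\<^sub>R N' + (exp (- t) / sqrt (2 * bform k N N')) *\<^sub>R N"
    by (simp add: nvec_def scaleR_add_right)
  also have "\<dots> \<in> cone_cl"
    using N pos by (intro cone_cl_combination) (simp_all add: ideal_vector_def)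
  finally show "nvec N N' t \<in> cone_cl" .
qed

lemma co_nline:
  assumes N: "ideal_vector N" "ideal_vector N'" and pos: "0 < bform k N N'"
  shows "co k (nline N N' t) = nvec N N' t"
  unfolding nline_def using nvec_props[OF assms] by (intro co_pt) simp_all

lemma line_nline:
  assumes N: "ideal_vector N" "ideal_vector N'" and pos: "0 < bform k N N'"
  shows "line (nline N N')"
  unfolding line_def
proof (intro allI)
  fix s t
  have "cosh (dist (nline N N' s) (nline N N' t)) = cosh (s - t)"
    unfolding cosh_dist_co co_nline[OF assms] by (rule nvec_props(1)[OF assms])
  then show "dist (nline N N' s) (nline N N' t) = \<bar>s - t\<bar>" by simp
qed

lemma nline_region:
  assumes N: "ideal_vector N" "ideal_vector N'" and pos: "0 < bform k N N'"
  shows "nline N N' t \<in> region"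
  using nvec_props(3)[OF assms] by (simp add: region_def co_nline[OF assms])

text \<open>In the hyperbolic cosine of the distance the coefficient of exp (2n) is the norm of the
  common end \<open>N'\<close>, which is zero; so the distance stays bounded.\<close>

lemma nline_asymptotic:
  assumes N: "ideal_vector N" "ideal_vector M" "ideal_vector N'"
    and pos: "0 < bform k N N'" "0 < bform k M N'"
  shows "((\<lambda>n. nline N N' (real n)), (\<lambda>n. nline M N' (real n))) \<in> asymptotic_rel"
proof -
  define c where "c = 1 / (sqrt (2 * bform k N N') * sqrt (2 * bform k M N'))"
  have c: "0 < c" using pos by (simp add: c_def)
  define K where "K = c * (bform k N N' + bform k M N' + \<bar>bform k N M\<bar>)"
  have b: "cosh (dist (nline N N' (real n)) (nline M N' (real n))) \<le> K" for n
  proof -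
    have z: "bform k N' N' = 0" using N by (simp add: ideal_vector_def)
    have e: "exp (real n) * exp (- real n) = 1" "exp (- real n) * exp (real n) = 1" by (simp_all add: mult_exp_exp)
    have "cosh (dist (nline N N' (real n)) (nline M N' (real n)))
      = c * (exp (real n) * exp (- real n) * bform k N' M + exp (- real n) * exp (real n) * bform k N N'
          + exp (- real n) * exp (- real n) * bform k N M)"
      unfolding cosh_dist_co co_nline[OF N(1,3) pos(1)] co_nline[OF N(2,3) pos(2)] nvec_def bform_linear z c_def
      by (simp add: algebra_simps)
    also have "\<dots> \<le> c * (bform k M N' + bform k N N' + 1 * \<bar>bform k N M\<bar>)"
      unfolding e bform_commute[of k N' M] using c
      by (intro mult_left_mono add_mono order_trans[OF mult_left_mono[OF abs_ge_self] mult_right_mono])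
        (simp_all add: mult_exp_exp)
    finally show ?thesis by (simp add: K_def add.commute add.left_commute)
  qed
  have "1 \<le> K" using b[of 0] cosh_real_ge_1 order_trans by blast
  then have "dist (nline N N' (real n)) (nline M N' (real n)) \<le> arcosh K" for n
    using b[of n] by (intro dist_eq_if_cosh_le) simp_all
  then show ?thesis
    by (intro asymptotic_if_bounded_dist[of _ _ "arcosh K"] line_converges line_nline N pos)
qed

text \<open>Leaving a point of a side along the geodesic issuing from the crossing point of the
  diagonals, one leaves the region at once.\<close>

lemma side_not_interior:
  assumes st: "\<bar>\<sigma>\<bar> = 1" "\<bar>\<tau>\<bar> = 1" and z: "fst (co k z) - \<sigma> * fst (snd (co k z)) - \<tau> * snd (snd (co k z)) = 0"
    and Q: "Q \<subseteq> region"
  shows "z \<notin> interior Q"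
proof
  assume "z \<in> interior Q"
  then obtain e where e: "0 < e" "ball z e \<subseteq> Q" by (auto simp: mem_interior)
  define Z where "Z = co k z"
  define M :: "real \<times> real \<times> real" where "M = (1, 0, 0)"
  \<comment> \<open>A linear functional that is nonnegative on the closed cone, vanishes along the
    side and is one at the crossing point \<open>M\<close>.\<close>
  define h where "h V = fst V - \<sigma> * fst (snd V) - \<tau> * snd (snd V)" for V :: "real \<times> real \<times> real"
  define m where "m = pt k M"
  have M: "bform k M M = 1" "0 < fst M" by (simp_all add: M_def bform_def)
  have com: "co k m = M" unfolding m_def by (rule co_pt[OF M])
  define d where "d = dist m z"
  have cd: "cosh d = bform k M Z" by (simp add: d_def cosh_dist_co com Z_def)
  have "z \<noteq> m" using z com by (auto simp: M_def)
  then have d: "0 < d" by (simp add: d_def)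
  then have sd: "0 < sinh d" by simp
  define \<delta> where "\<delta> = e / 2"
  have \<delta>: "0 < \<delta>" "\<delta> < e" using e by (simp_all add: \<delta>_def)
  \<comment> \<open>The unit vector of the point at distance \<delta> beyond \<open>z\<close> on the
    ray from \<open>m\<close>. Linearity makes \<open>h\<close> negative there.\<close>
  define W where "W = (1 / sinh d) *\<^sub>R (sinh (d + \<delta>) *\<^sub>R Z - sinh \<delta> *\<^sub>R M)"
  have id1: "sinh (d + \<delta>) = sinh d * cosh \<delta> + cosh d * sinh \<delta>" by (rule sinh_add)
  have c2: "(cosh d)\<^sup>2 = (sinh d)\<^sup>2 + 1" "(cosh \<delta>)\<^sup>2 = (sinh \<delta>)\<^sup>2 + 1" by (simp_all add: cosh_square_eq)
  have BZ: "bform k Z Z = 1" by (simp add: Z_def)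
  have WZ: "bform k W Z = cosh \<delta>"
    unfolding W_def bform_linear BZ cd[symmetric] id1 using sd by simp
  have WM: "bform k W M = cosh (d + \<delta>)"
  proof -
    have "bform k W M = (1 / sinh d) * (sinh (d + \<delta>) * cosh d - sinh \<delta>)"
      unfolding W_def bform_linear M bform_commute[of k Z M] cd[symmetric] by simp
    also have "sinh (d + \<delta>) * cosh d - sinh \<delta> = sinh d * cosh (d + \<delta>)"
    proof -
      have "sinh (d + \<delta>) * cosh d - sinh \<delta> = sinh d * cosh \<delta> * cosh d + ((cosh d)\<^sup>2 - 1) * sinh \<delta>"
        unfolding id1 by (simp add: power2_eq_square algebra_simps)
      then show ?thesis unfolding c2 cosh_add by (simp add: power2_eq_square algebra_simps)
    qed
    finally show ?thesis using sd by simp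
  qed
  have "bform k W W = (1 / sinh d) * (sinh (d + \<delta>) * bform k W Z - sinh \<delta> * bform k W M)"
    by (subst (2) W_def) (simp add: bform_linear)
  also have "sinh (d + \<delta>) * bform k W Z - sinh \<delta> * bform k W M = sinh d * ((cosh \<delta>)\<^sup>2 - (sinh \<delta>)\<^sup>2)"
    unfolding WZ WM sinh_add cosh_add by (simp add: power2_eq_square algebra_simps)
  finally have WW: "bform k W W = 1" unfolding c2 using sd by simp
  have "fst W = bform k W M" by (simp add: M_def bform_def)
  then have "0 < fst W" unfolding WM by simp
  then have cw: "co k (pt k W) = W" by (rule co_pt[OF WW])
  have "cosh (dist (pt k W) z) = cosh \<delta>" by (simp add: cosh_dist_co cw WZ flip: Z_def)
  then have "dist (pt k W) z = \<delta>" using \<delta> by simp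
  then have "pt k W \<in> ball z e" using \<delta> by (simp add: dist_commute)
  then have "pt k W \<in> region" using e(2) Q by blast
  then have "W \<in> cone_cl" by (simp add: region_def cw)
  then have "0 \<le> h W"
  proof -
    obtain a x y where Weq: "W = (a, x, y)" by (cases W)
    have "\<sigma> * x \<le> \<bar>x\<bar>" "\<tau> * y \<le> \<bar>y\<bar>"
      using abs_ge_self[of "\<sigma> * x"] abs_ge_self[of "\<tau> * y"] st by (simp_all add: abs_mult)
    then show ?thesis using \<open>W \<in> cone_cl\<close> by (simp add: Weq h_def cone_cl_def)
  qed
  moreover have "h W = - sinh \<delta> / sinh d"
  proof -
    have "h W = (1 / sinh d) * (sinh (d + \<delta>) * h Z - sinh \<delta> * h M)"
      by (simp add: W_def h_def algebra_simps)
    moreover have "h Z = 0" "h M = 1" using z by (simp_all add: h_def Z_def M_def)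
    ultimately show ?thesis by simp
  qed
  moreover have "- sinh \<delta> / sinh d < 0" using \<delta> sd by (simp add: divide_less_0_iff)
  ultimately show False by linarith
qed

end

section \<open>Equality forces an ideal quadrilateral\<close>

lemma pairs_of_four:
  assumes "distinct [a, b, c, d]"
  shows "{g v w | v w. v \<in> {a, b, c, d} \<and> w \<in> {a, b, c, d} \<and> v \<noteq> w}
    = {g a b, g a c, g a d, g b a, g b c, g b d, g c a, g c b, g c d, g d a, g d b, g d c}"
  using assms by auto

context star_space
begin

text \<open>Divided by its left-hand side, the equality says that the two cross ratios add up to
  one, which is the hypothesis of \<open>lines_cross\<close>. A shift of parameters moves the
  crossing point to zero.\<close>

lemma ptolemy_equality_crossing:
  fixes y1 y2 y3 y4 :: "'a ideal_point" and p :: 'a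
  assumes y: "y1 \<in> boundary_at_infinity" "y2 \<in> boundary_at_infinity" "y3 \<in> boundary_at_infinity"
      "y4 \<in> boundary_at_infinity"
    and dis: "distinct [y1, y2, y3, y4]"
    and eq: "bourdon_metric p y1 y3 * bourdon_metric p y2 y4
      = bourdon_metric p y1 y2 * bourdon_metric p y3 y4 + bourdon_metric p y2 y3 * bourdon_metric p y4 y1"
  obtains k \<gamma> \<eta> where "-1 < k" "k < 1" "joins \<gamma> y1 y3" "joins \<eta> y2 y4"
    "\<And>s t. cosh (dist (\<gamma> s) (\<eta> t)) = cosh s * cosh t - k * (sinh s * sinh t)"
proof -
  have ne: "y1 \<noteq> y3" "y2 \<noteq> y4" using dis by auto
  obtain \<gamma>0 where \<gamma>0: "joins \<gamma>0 y1 y3" by (rule line_exists[OF y(1,3) ne(1)])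
  obtain \<eta>0 where \<eta>0: "joins \<eta>0 y2 y4" by (rule line_exists[OF y(2,4) ne(2)])
  let ?r = "bourdon_metric p"
  have rpos: "0 < ?r y1 y3 * ?r y2 y4" "0 < ?r y1 y2 * ?r y3 y4" "0 < ?r y2 y3 * ?r y4 y1"
    using dis y by (auto intro!: mult_pos_pos bourdon_pos)
  define a where "a = ?r y1 y2 * ?r y3 y4 / (?r y1 y3 * ?r y2 y4)"
  define b where "b = ?r y2 y3 * ?r y4 y1 / (?r y1 y3 * ?r y2 y4)"
  have ab: "0 < a" "0 < b" using rpos by (simp_all add: a_def b_def)
  have "a + b = (?r y1 y3 * ?r y2 y4) / (?r y1 y3 * ?r y2 y4)"
    unfolding a_def b_def add_divide_distrib[symmetric] eq ..
  moreover have "?r y1 y3 * ?r y2 y4 \<noteq> 0" using rpos(1) by linarith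
  ultimately have ab1: "a + b = 1" by (metis divide_self)
  note lims = cross_ratio_limits[OF y ne \<gamma>0 \<eta>0, of p, folded a_def b_def]
  have l0: "line \<gamma>0" "line \<eta>0" using \<gamma>0 \<eta>0 by (simp_all add: joins_def)
  obtain k s0 t0 where k: "-1 < k" "k < 1"
    and cross: "\<And>s t. cosh (dist (\<gamma>0 (s0 + s)) (\<eta>0 (t0 + t))) = cosh s * cosh t - k * (sinh s * sinh t)"
    by (rule lines_cross[OF l0 ab ab1 lims]) (rule that)
  define \<gamma> where "\<gamma> = (\<lambda>t. \<gamma>0 (s0 + t))"
  define \<eta> where "\<eta> = (\<lambda>t. \<eta>0 (t0 + t))"
  have j: "joins \<gamma> y1 y3" "joins \<eta> y2 y4"
    unfolding \<gamma>_def \<eta>_def by (rule joins_shift[OF y(1,3) \<gamma>0], rule joins_shift[OF y(2,4) \<eta>0])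
  show ?thesis
    by (rule that[OF k j]) (simp add: \<gamma>_def \<eta>_def cross)
qed

end

section \<open>Vertices and sides of the model\<close>

context angle
begin

text \<open>\<open>N\<close> names the ideal point \<open>v\<close> of the plane and
  \<open>y\<close> of the space at once. The quantifier over \<open>M\<close> allows every side and
  diagonal ending at \<open>N\<close> to approach them.\<close>

definition vertex :: "(hyp_plane \<Rightarrow> 'a::metric_space) \<Rightarrow> real \<times> real \<times> real \<Rightarrow> hyp_plane ideal_point \<Rightarrow> 'a ideal_point \<Rightarrow> bool" where
  "vertex G N v y \<longleftrightarrow> ideal_vector N \<and> v \<in> boundary_at_infinity \<and> y \<in> boundary_at_infinity \<and>
     (\<forall>M. ideal_vector M \<longrightarrow> 0 < bform k M N \<longrightarrow>
       (\<lambda>n. nline M N (real n)) \<in> v \<and> (\<lambda>n. G (nline M N (real n))) \<in> y)"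

text \<open>A single line into \<open>N\<close> is enough: the others are asymptotic to it, and the
  isometry \<open>G\<close> preserves this.\<close>

lemma vertex_exists:
  fixes G :: "hyp_plane \<Rightarrow> 'a::metric_space"
  assumes X: "star_space TYPE('a)"
    and isometry: "\<forall>z\<in>region. \<forall>w\<in>region. dist (G z) (G w) = dist z w"
    and N: "ideal_vector N" "ideal_vector M" "0 < bform k M N"
    and y: "y \<in> boundary_at_infinity" "(\<lambda>n. G (nline M N (real n))) \<in> y"
  obtains v where "vertex G N v y"
proof -
  interpret star_space "TYPE('a)" by (rule X)
  note iso = isometry[rule_format]
  have "converges_to_infinity (\<lambda>n. nline M N (real n))"
    by (intro line_converges line_nline N)
  then obtain v where v: "v \<in> boundary_at_infinity" "(\<lambda>n. nline M N (real n)) \<in> v"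
    by (rule hyp.ideal_point_of_sequence)
  have "(\<lambda>n. nline M' N (real n)) \<in> v \<and> (\<lambda>n. G (nline M' N (real n))) \<in> y"
    if M': "ideal_vector M'" "0 < bform k M' N" for M'
  proof -
    have as: "((\<lambda>n. nline M N (real n)), (\<lambda>n. nline M' N (real n))) \<in> asymptotic_rel"
      by (intro nline_asymptotic N M')
    then have "((\<lambda>n. G (nline M N (real n))), (\<lambda>n. G (nline M' N (real n)))) \<in> asymptotic_rel"
      by (subst isometric_asymptotic[of region G, OF iso]) (auto intro: nline_region N M')
    then show ?thesis
      using as hyp.boundary_asymptotic[OF v] boundary_asymptotic[OF y] by blast
  qed
  then have "vertex G N v y" unfolding vertex_def using N(1) v(1) y(1) by blast
  then show ?thesis by (rule that)
qed

text \<open>The facts needed for each of the six pairs of vertices. Equal vertices would make the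
  image sequences asymptotic and hence \<open>y\<close> and \<open>y'\<close> equal.\<close>

lemma vertex_pair:
  fixes G :: "hyp_plane \<Rightarrow> 'a::metric_space"
  assumes X: "star_space TYPE('a)"
    and isometry: "\<forall>z\<in>region. \<forall>w\<in>region. dist (G z) (G w) = dist z w"
    and c: "vertex G N v y" "vertex G N' v' y'" and pos: "0 < bform k N N'" and ne: "y \<noteq> y'"
  shows "v \<noteq> v'" "geodesic_line v v' = range (nline N N')" "geodesic_line v v' \<subseteq> region"
    "geodesic_line y y' = G ` geodesic_line v v'"
    "geodesic_line v' v = geodesic_line v v'" "geodesic_line y' y = geodesic_line y y'"
proof -
  interpret star_space "TYPE('a)" by (rule X)
  note iso = isometry[rule_format]
  have pos': "0 < bform k N' N" using pos by (simp add: bform_commute)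
  have N: "ideal_vector N" "ideal_vector N'" and bd: "v \<in> boundary_at_infinity" "v' \<in> boundary_at_infinity"
      "y \<in> boundary_at_infinity" "y' \<in> boundary_at_infinity"
    using c by (simp_all add: vertex_def)
  have e: "(\<lambda>n. nline N' N (real n)) \<in> v" "(\<lambda>n. G (nline N' N (real n))) \<in> y"
    "(\<lambda>n. nline N N' (real n)) \<in> v'" "(\<lambda>n. G (nline N N' (real n))) \<in> y'"
    using c N pos pos' unfolding vertex_def by blast+
  have reg: "nline N N' t \<in> region" "nline N' N t \<in> region" for t
    using nline_region[OF N pos] nline_region[OF N(2,1) pos'] by blast+
  show "v \<noteq> v'"
  proof
    assume "v = v'"
    then have "((\<lambda>n. nline N' N (real n)), (\<lambda>n. nline N N' (real n))) \<in> asymptotic_rel"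
      using hyp.boundary_asymptotic[OF bd(1) e(1)] e(3) by simp
    then have "((\<lambda>n. G (nline N' N (real n))), (\<lambda>n. G (nline N N' (real n)))) \<in> asymptotic_rel"
      by (subst isometric_asymptotic[of region G, OF iso]) (auto intro: reg)
    then show False using boundary_eqI[OF bd(3,4) e(2,4)] ne by blast
  qed
  have j: "joins (nline N N') v v'"
    using e line_nline[OF N pos] by (simp add: joins_def nline_uminus)
  show gl: "geodesic_line v v' = range (nline N N')" by (rule hyp.geodesic_line_eq[OF bd(1,2) j])
  show "geodesic_line v v' \<subseteq> region" unfolding gl using reg by blast
  have "line (\<lambda>t. G (nline N N' t))"
    using line_nline[OF N pos] by (simp add: line_def iso reg)
  then have j': "joins (\<lambda>t. G (nline N N' t)) y y'"
    using e by (simp add: joins_def nline_uminus)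
  have gl': "geodesic_line y y' = range (\<lambda>t. G (nline N N' t))" by (rule geodesic_line_eq[OF bd(3,4) j'])
  then show "geodesic_line y y' = G ` geodesic_line v v'" unfolding gl by blast
  have r: "range (\<lambda>t. h (- t)) = range h" for h :: "real \<Rightarrow> 'c"
    by (metis (no_types, lifting) minus_minus rangeI subsetI subset_antisym image_subsetI)
  show "geodesic_line v' v = geodesic_line v v'"
    using hyp.geodesic_line_eq[OF bd(2,1) joins_reverse[OF j]] r[of "nline N N'"] by (simp only: gl)
  show "geodesic_line y' y = geodesic_line y y'"
    using geodesic_line_eq[OF bd(4,3) joins_reverse[OF j']] r[of "\<lambda>t. G (nline N N' t)"] by (simp only: gl')
qed

lemma side_in_frontier:
  assumes N: "ideal_vector (1, \<sigma>, 0)" "ideal_vector (1, 0, \<tau>)" and st: "\<bar>\<sigma>\<bar> = 1" "\<bar>\<tau>\<bar> = 1"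
    and L: "L = range (nline (1, \<sigma>, 0) (1, 0, \<tau>))" "L \<subseteq> Q" and Q: "Q \<subseteq> region"
    and pos: "0 < bform k (1, \<sigma>, 0) (1, 0, \<tau>)"
  shows "L \<subseteq> frontier Q"
proof
  fix z assume z: "z \<in> L"
  then obtain t where t: "z = nline (1, \<sigma>, 0) (1, 0, \<tau>) t" using L by blast
  have "\<sigma> = 1 \<or> \<sigma> = - 1" "\<tau> = 1 \<or> \<tau> = - 1" using st by linarith+
  then have "fst (co k z) - \<sigma> * fst (snd (co k z)) - \<tau> * snd (snd (co k z)) = 0"
    unfolding t co_nline[OF N pos] by (elim disjE) (simp_all add: nvec_def add_divide_distrib)
  then have "z \<notin> interior Q" by (rule side_not_interior[OF st _ Q])
  moreover have "z \<in> closure Q" using z L(2) closure_subset by blast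
  ultimately show "z \<in> frontier Q" by (simp add: frontier_def)
qed

end

theorem ptolemy_equality_imp_quadrilateral:
  fixes y1 y2 y3 y4 :: "'a::metric_space ideal_point" and p :: 'a
  assumes X: "star_space TYPE('a)"
    and y: "y1 \<in> boundary_at_infinity" "y2 \<in> boundary_at_infinity" "y3 \<in> boundary_at_infinity"
      "y4 \<in> boundary_at_infinity"
    and dis: "distinct [y1, y2, y3, y4]"
    and eq: "bourdon_metric p y1 y3 * bourdon_metric p y2 y4
      = bourdon_metric p y1 y2 * bourdon_metric p y3 y4 + bourdon_metric p y2 y3 * bourdon_metric p y4 y1"
  shows "\<exists>v1 v2 v3 v4 Q f. ideal_quadrilateral v1 v2 v3 v4 Q \<and>
           isometry_between f (ideal_hull {y1, y2, y3, y4}) Q \<and>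
           f ` geodesic_line y1 y3 = geodesic_line v1 v3 \<and>
           f ` geodesic_line y2 y4 = geodesic_line v2 v4"
proof -
  interpret star_space "TYPE('a)" by (rule X)
  obtain k \<gamma> \<eta> where k: "-1 < k" "k < 1" and j: "joins \<gamma> y1 y3" "joins \<eta> y2 y4"
    and cross: "\<And>s t. cosh (dist (\<gamma> s) (\<eta> t)) = cosh s * cosh t - k * (sinh s * sinh t)"
    by (rule ptolemy_equality_crossing[OF y dis eq]) (rule that)
  have l: "line \<gamma>" "line \<eta>" using j by (simp_all add: joins_def)
  interpret cl: crossing_lines "TYPE('a)" \<gamma> \<eta> k
    using l k cross by unfold_locales simp_all
  interpret angle k using k by unfold_locales
  obtain F where F: "\<And>Z Z'. Z \<in> cone_cl \<Longrightarrow> bform k Z Z = 1 \<Longrightarrow> Z' \<in> cone_cl \<Longrightarrow> bform k Z' Z' = 1 \<Longrightarrow>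
      cosh (dist (F Z) (F Z')) = bform k Z Z'"
    and FU: "\<And>s. F (mU s) = \<gamma> s" and FW: "\<And>t. F (mW t) = \<eta> t"
    using cl.rigid_extension by blast
  define G where "G z = F (co k z)" for z
  have iso: "dist (G z) (G w) = dist z w" if "z \<in> region" "w \<in> region" for z w
  proof -
    have "cosh (dist (G z) (G w)) = cosh (dist z w)"
      unfolding G_def cosh_dist_co using that by (intro F) (simp_all add: region_def)
    then show ?thesis by simp
  qed
  then have isometry: "\<forall>z\<in>region. \<forall>w\<in>region. dist (G z) (G w) = dist z w" by blast
  \<comment> \<open>The null vectors of the ends, scaled so that \<open>nvec N1 N3\<close> and
    \<open>nvec N2 N4\<close> reproduce \<open>mU\<close> and \<open>mW\<close>.\<close>
  define N1 N2 N3 N4 :: "real \<times> real \<times> real"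
    where "N1 = (1, -1, 0)" and "N2 = (1, 0, -1)" and "N3 = (1, 1, 0)" and "N4 = (1, 0, 1)"
  note Nd = N1_def N2_def N3_def N4_def
  have N: "ideal_vector N1" "ideal_vector N2" "ideal_vector N3" "ideal_vector N4"
    by (simp_all add: ideal_vector_def Nd cone_cl_def bform_def)
  have B: "bform k N1 N2 = 1 - k" "bform k N1 N3 = 2" "bform k N1 N4 = 1 + k"
    "bform k N2 N3 = 1 + k" "bform k N2 N4 = 2" "bform k N3 N4 = 1 - k"
    by (simp_all add: Nd bform_def)
  have Bpos: "0 < bform k N1 N2" "0 < bform k N1 N3" "0 < bform k N1 N4"
    "0 < bform k N2 N3" "0 < bform k N2 N4" "0 < bform k N3 N4"
    using k by (simp_all add: B)
  have Bpos': "0 < bform k N3 N1" "0 < bform k N4 N2"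
    using Bpos by (simp_all add: bform_commute[of k N3 N1] bform_commute[of k N4 N2])
  have "nvec N1 N3 t = mU t" "nvec N2 N4 t = mW t" for t
    unfolding nvec_def B by (simp_all add: Nd mU_def mW_def cosh_field_def sinh_field_def)
  then have G: "G (nline N1 N3 t) = \<gamma> t" "G (nline N2 N4 t) = \<eta> t" for t
    by (simp_all add: G_def co_nline N Bpos FU FW)
  have G': "G (nline N3 N1 t) = \<gamma> (- t)" "G (nline N4 N2 t) = \<eta> (- t)" for t
    using G(1)[of "- t"] G(2)[of "- t"] by (simp_all add: nline_uminus)
  obtain v1 where c1: "vertex G N1 v1 y1"
    by (rule vertex_exists[OF X isometry N(1,3) Bpos'(1) y(1)]) (use j in \<open>simp_all add: G' joins_def\<close>)
  obtain v2 where c2: "vertex G N2 v2 y2"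
    by (rule vertex_exists[OF X isometry N(2,4) Bpos'(2) y(2)]) (use j in \<open>simp_all add: G' joins_def\<close>)
  obtain v3 where c3: "vertex G N3 v3 y3"
    by (rule vertex_exists[OF X isometry N(3,1) Bpos(2) y(3)]) (use j in \<open>simp_all add: G joins_def\<close>)
  obtain v4 where c4: "vertex G N4 v4 y4"
    by (rule vertex_exists[OF X isometry N(4,2) Bpos(5) y(4)]) (use j in \<open>simp_all add: G joins_def\<close>)
  have yne: "y1 \<noteq> y2" "y1 \<noteq> y3" "y1 \<noteq> y4" "y2 \<noteq> y3" "y2 \<noteq> y4" "y3 \<noteq> y4" using dis by auto
  note p12 = vertex_pair[OF X isometry c1 c2 Bpos(1) yne(1)]
  note p13 = vertex_pair[OF X isometry c1 c3 Bpos(2) yne(2)]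
  note p14 = vertex_pair[OF X isometry c1 c4 Bpos(3) yne(3)]
  note p23 = vertex_pair[OF X isometry c2 c3 Bpos(4) yne(4)]
  note p24 = vertex_pair[OF X isometry c2 c4 Bpos(5) yne(5)]
  note p34 = vertex_pair[OF X isometry c3 c4 Bpos(6) yne(6)]
  have vdis: "distinct [v1, v2, v3, v4]" using p12(1) p13(1) p14(1) p23(1) p24(1) p34(1) by simp
  define Q where "Q = ideal_hull {v1, v2, v3, v4}"
  define S where "S = \<Union>{geodesic_line v w | v w. v \<in> {v1, v2, v3, v4} \<and> w \<in> {v1, v2, v3, v4} \<and> v \<noteq> w}"
  have S_eq: "S = \<Union>{geodesic_line v1 v2, geodesic_line v1 v3, geodesic_line v1 v4,
      geodesic_line v2 v3, geodesic_line v2 v4, geodesic_line v3 v4}"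
    unfolding S_def pairs_of_four[OF vdis] p12(5) p13(5) p14(5) p23(5) p24(5) p34(5) by auto
  have S_y: "\<Union>{geodesic_line v w | v w. v \<in> {y1, y2, y3, y4} \<and> w \<in> {y1, y2, y3, y4} \<and> v \<noteq> w}
     = \<Union>{geodesic_line y1 y2, geodesic_line y1 y3, geodesic_line y1 y4,
      geodesic_line y2 y3, geodesic_line y2 y4, geodesic_line y3 y4}"
    unfolding pairs_of_four[OF dis] p12(6) p13(6) p14(6) p23(6) p24(6) p34(6) by auto
  have S_region: "S \<subseteq> region"
    unfolding S_eq using p12(3) p13(3) p14(3) p23(3) p24(3) p34(3) by blast
  have Q_S: "Q = geodesically_convex hull S" by (simp only: Q_def S_def ideal_hull_def)
  \<comment> \<open>The six lines between the points \<open>y1\<close> to \<open>y4\<close> are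
    images of those between \<open>v1\<close> to \<open>v4\<close>, so the hulls correspond.\<close>
  have "ideal_hull {y1, y2, y3, y4} = geodesically_convex hull (G ` S)"
    unfolding ideal_hull_def S_y S_eq p12(4) p13(4) p14(4) p23(4) p24(4) p34(4) by (simp add: image_Un)
  also have "\<dots> = G ` Q"
    unfolding Q_S by (rule hull_isometric_image[OF X hyp.star_space_axioms iso convex_region S_region])
  finally have hull_y: "ideal_hull {y1, y2, y3, y4} = G ` Q" .
  have Q_region: "Q \<subseteq> region"
    unfolding Q_S by (rule hull_minimal[where S = geodesically_convex, OF S_region convex_region])
  have S_Q: "S \<subseteq> Q" unfolding Q_S by (rule hull_subset)
  have gl_Q: "geodesic_line v1 v2 \<subseteq> Q" "geodesic_line v1 v3 \<subseteq> Q" "geodesic_line v1 v4 \<subseteq> Q"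
      "geodesic_line v2 v3 \<subseteq> Q" "geodesic_line v2 v4 \<subseteq> Q" "geodesic_line v3 v4 \<subseteq> Q"
    using S_Q unfolding S_eq by blast+
  have inj: "inj_on G Q"
  proof (rule inj_onI)
    fix z w assume "z \<in> Q" "w \<in> Q" "G z = G w"
    then show "z = w" using iso[of z w] Q_region by (auto simp: subset_iff)
  qed
  have bd: "v1 \<in> boundary_at_infinity" "v2 \<in> boundary_at_infinity" "v3 \<in> boundary_at_infinity" "v4 \<in> boundary_at_infinity"
    using c1 c2 c3 c4 by (simp_all add: vertex_def)
  have "geodesic_line v1 v2 \<subseteq> frontier Q"
    using N Bpos p12(2) gl_Q(1) Q_region unfolding Nd
    by (intro side_in_frontier[of "-1" "-1"]) simp_all
  moreover have "geodesic_line v2 v3 \<subseteq> frontier Q"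
  proof -
    \<comment> \<open>\<open>side_in_frontier\<close> takes the vertex on the first diagonal first,
      hence \<open>N3\<close> before \<open>N2\<close>.\<close>
    have pos: "0 < bform k N3 N2" using Bpos(4) by (simp add: bform_commute)
    show ?thesis
      unfolding p23(5)[symmetric]
      using N pos vertex_pair(2)[OF X isometry c3 c2 pos yne(4)[symmetric]] gl_Q(4) Q_region unfolding p23(5) Nd
      by (intro side_in_frontier[of "1" "-1"]) simp_all
  qed
  moreover have "geodesic_line v3 v4 \<subseteq> frontier Q"
    using N Bpos p34(2) gl_Q(6) Q_region unfolding Nd
    by (intro side_in_frontier[of "1" "1"]) simp_all
  moreover have "geodesic_line v4 v1 \<subseteq> frontier Q"
    unfolding p14(5) using N Bpos p14(2) gl_Q(3) Q_region unfolding Nd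
    by (intro side_in_frontier[of "-1" "1"]) simp_all
  ultimately have quad: "ideal_quadrilateral v1 v2 v3 v4 Q"
    unfolding ideal_quadrilateral_def using bd vdis Q_def by simp
  define f where "f = inv_into Q G"
  have "bij_betw f (G ` Q) Q" unfolding f_def by (intro bij_betw_inv_into inj_on_imp_bij_betw inj)
  moreover have "dist (f x) (f x') = dist x x'" if "x \<in> G ` Q" "x' \<in> G ` Q" for x x'
  proof -
    from that obtain z w where z: "x = G z" "x' = G w" "z \<in> Q" "w \<in> Q" by blast
    then show ?thesis using iso[of z w] Q_region inj by (simp add: f_def subset_iff)
  qed
  ultimately have "isometry_between f (ideal_hull {y1, y2, y3, y4}) Q"
    unfolding isometry_between_def hull_y by blast
  moreover have "f ` geodesic_line y1 y3 = geodesic_line v1 v3" "f ` geodesic_line y2 y4 = geodesic_line v2 v4"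
    unfolding f_def p13(4) p24(4) by (intro inv_into_image_cancel inj gl_Q)+
  ultimately show ?thesis using quad by blast
qed

section \<open>Four ideal points of the hyperbolic plane\<close>

text \<open>Subtracting the exponential combination with the same values at 0 and 1 leaves a
  solution of the identity that vanishes at both; the identity for 0, 1 and \<open>t\<close> then
  annihilates it.\<close>

lemma three_point_exponential:
  fixes \<phi> :: "real \<Rightarrow> real"
  assumes tp: "\<And>s t u. s \<le> t \<Longrightarrow> t \<le> u \<Longrightarrow> \<phi> t * sinh (u - s) = sinh (u - t) * \<phi> s + sinh (t - s) * \<phi> u"
  obtains \<alpha> \<beta> where "\<And>t. \<phi> t = \<alpha> * exp t + \<beta> * exp (- t)"
proof -
  define c where "c = (\<phi> 1 - \<phi> 0 * cosh 1) / sinh 1"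
  define \<alpha> \<beta> where "\<alpha> = (\<phi> 0 + c) / 2" and "\<beta> = (\<phi> 0 - c) / 2"
  define \<psi> where "\<psi> t = \<phi> t - (\<alpha> * exp t + \<beta> * exp (- t))" for t
  have ep: "exp t * sinh (u - s) = sinh (u - t) * exp s + sinh (t - s) * exp u" for s t u :: real
    by (simp add: sinh_field_def field_simps mult_exp_exp)
  have en: "exp (- t) * sinh (u - s) = sinh (u - t) * exp (- s) + sinh (t - s) * exp (- u)" for s t u :: real
    by (simp add: sinh_field_def field_simps mult_exp_exp)
  have \<psi>: "\<psi> t * sinh (u - s) = sinh (u - t) * \<psi> s + sinh (t - s) * \<psi> u" if "s \<le> t" "t \<le> u" for s t u
  proof -
    have "\<psi> t * sinh (u - s) = \<phi> t * sinh (u - s) - \<alpha> * (exp t * sinh (u - s)) - \<beta> * (exp (- t) * sinh (u - s))"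
      by (simp add: \<psi>_def algebra_simps)
    also have "\<dots> = sinh (u - t) * \<psi> s + sinh (t - s) * \<psi> u"
      unfolding tp[OF that] ep[of t u s] en[of t u s] by (simp add: \<psi>_def algebra_simps)
    finally show ?thesis .
  qed
  have s1: "0 < sinh (1 :: real)" by simp
  have \<psi>0: "\<psi> 0 = 0" by (simp add: \<psi>_def \<alpha>_def \<beta>_def field_simps)
  have \<psi>1: "\<psi> 1 = 0"
  proof -
    have "\<alpha> * exp 1 + \<beta> * exp (- 1) = \<phi> 0 * cosh 1 + c * sinh 1"
      by (simp add: \<alpha>_def \<beta>_def cosh_field_def sinh_field_def field_simps)
    also have "\<dots> = \<phi> 1" using s1 by (simp add: c_def)
    finally show ?thesis by (simp add: \<psi>_def)
  qed
  have "\<psi> t = 0" for t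
  proof -
    consider "t < 0" | "0 \<le> t" "t \<le> 1" | "1 < t" by linarith
    then show ?thesis
    proof cases
      case 1
      then show ?thesis using \<psi>[of t 0 1] \<psi>0 \<psi>1 s1 by simp
    next
      case 2
      then show ?thesis using \<psi>[of 0 t 1] \<psi>0 \<psi>1 s1 by simp
    next
      case 3
      then show ?thesis using \<psi>[of 0 1 t] \<psi>0 \<psi>1 s1 by simp
    qed
  qed
  then show ?thesis by (intro that) (simp add: \<psi>_def)
qed

lemma hyp_line_exponential:
  fixes \<delta> :: "real \<Rightarrow> hyp_plane"
  assumes l: "line \<delta>"
  obtains p p' q q' r r' where "\<And>t. hP (\<delta> t) = p * exp t + p' * exp (- t)"
    "\<And>t. hQ (\<delta> t) = q * exp t + q' * exp (- t)" "\<And>t. hR (\<delta> t) = r * exp t + r' * exp (- t)"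
proof -
  have tp: "hP (\<delta> t) * sinh (u - s) = sinh (u - t) * hP (\<delta> s) + sinh (t - s) * hP (\<delta> u) \<and>
      hQ (\<delta> t) * sinh (u - s) = sinh (u - t) * hQ (\<delta> s) + sinh (t - s) * hQ (\<delta> u) \<and>
      hR (\<delta> t) * sinh (u - s) = sinh (u - t) * hR (\<delta> s) + sinh (t - s) * hR (\<delta> u)"
    if "s \<le> t" "t \<le> u" for s t u
  proof -
    have d: "dist (\<delta> s) (\<delta> t) = t - s" "dist (\<delta> t) (\<delta> u) = u - t" "dist (\<delta> s) (\<delta> u) = u - s"
      using that by (simp_all add: line_dist[OF l])
    have "dist (\<delta> s) (\<delta> t) + dist (\<delta> t) (\<delta> u) = dist (\<delta> s) (\<delta> u)" unfolding d by simp
    then obtain a b where ab: "0 \<le> a" "0 \<le> b" 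
      "sinh (dist (\<delta> s) (\<delta> t)) = b * sinh (dist (\<delta> s) (\<delta> u))" "sinh (dist (\<delta> t) (\<delta> u)) = a * sinh (dist (\<delta> s) (\<delta> u))"
      and v: "hP (\<delta> t) = a * hP (\<delta> s) + b * hP (\<delta> u)" "hQ (\<delta> t) = a * hQ (\<delta> s) + b * hQ (\<delta> u)"
        "hR (\<delta> t) = a * hR (\<delta> s) + b * hR (\<delta> u)"
      by (rule hyp_between_coords)
    show ?thesis unfolding v ab(3,4)[unfolded d] by (simp add: algebra_simps)
  qed
  obtain p p' where P: "\<And>t. hP (\<delta> t) = p * exp t + p' * exp (- t)"
    using three_point_exponential[of "\<lambda>t. hP (\<delta> t)"] tp by blast
  obtain q q' where Q: "\<And>t. hQ (\<delta> t) = q * exp t + q' * exp (- t)"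
    using three_point_exponential[of "\<lambda>t. hQ (\<delta> t)"] tp by blast
  obtain r r' where R: "\<And>t. hR (\<delta> t) = r * exp t + r' * exp (- t)"
    using three_point_exponential[of "\<lambda>t. hR (\<delta> t)"] tp by blast
  show ?thesis by (rule that[OF P Q R])
qed

section \<open>Determinants and the Pluecker relation\<close>

lemma null_vector_spinor:
  fixes p q r :: real
  assumes "0 \<le> p" "0 \<le> q" "p * q = r\<^sup>2"
  obtains a b where "p = a\<^sup>2" "q = b\<^sup>2" "r = a * b"
proof -
  have "sqrt p * sqrt q = \<bar>r\<bar>" using assms(3) by (simp flip: real_sqrt_mult)
  then have "r = sqrt p * (if 0 \<le> r then sqrt q else - sqrt q)" by auto
  then show ?thesis using assms(1,2) that[of "sqrt p" "if 0 \<le> r then sqrt q else - sqrt q"] by auto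
qed

lemma nonneg_leading_coefficient:
  fixes p p' :: real
  assumes "\<And>t. 0 < p * exp t + p' * exp (- t)"
  shows "0 \<le> p"
proof (rule LIMSEQ_le_const)
  have "filterlim (\<lambda>n. 2 * real n) at_top sequentially"
    by (intro filterlim_tendsto_pos_mult_at_top[OF tendsto_const _ filterlim_real_sequentially]) simp
  then have "(\<lambda>n. exp (- (2 * real n))) \<longlonglongrightarrow> 0" by (simp only: exp_uminus_tendsto_0_iff)
  then have "(\<lambda>n. p + p' * exp (- (2 * real n))) \<longlonglongrightarrow> p + p' * 0" by (intro tendsto_intros)
  then show "(\<lambda>n. p + p' * exp (- (2 * real n))) \<longlonglongrightarrow> p" by simp
  have "0 \<le> p + p' * exp (- (2 * real n))" for n
  proof -
    have "0 < exp (- real n) * (p * exp (real n) + p' * exp (- real n))" using assms[of "real n"] by simp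
    also have "\<dots> = p * (exp (- real n) * exp (real n)) + p' * (exp (- real n) * exp (- real n))"
      by (simp only: algebra_simps)
    also have "\<dots> = p + p' * exp (- (2 * real n))" by (simp add: mult_exp_exp)
    finally show ?thesis by simp
  qed
  then show "\<exists>N. \<forall>n\<ge>N. 0 \<le> p + p' * exp (- (2 * real n))" by blast
qed

text \<open>A null vector $(p, q, r)$ with $pq = r^2$ is $(a^2, b^2, ab)$, and the product of two of them
  is half the square of a determinant. So the distances between ideal points become absolute
  values of determinants.\<close>

definition spinor_line :: "(real \<Rightarrow> hyp_plane) \<Rightarrow> real \<Rightarrow> real \<Rightarrow> real \<Rightarrow> real \<Rightarrow> bool" where
  "spinor_line \<delta> a b c d \<longleftrightarrow> (\<forall>t. hP (\<delta> t) = a\<^sup>2 * exp t + c\<^sup>2 * exp (- t) \<and>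
     hQ (\<delta> t) = b\<^sup>2 * exp t + d\<^sup>2 * exp (- t) \<and> hR (\<delta> t) = (a * b) * exp t + (c * d) * exp (- t))"

lemma spinor_line_reverse: "spinor_line \<delta> a b c d \<Longrightarrow> spinor_line (\<lambda>t. \<delta> (- t)) c d a b"
  by (simp add: spinor_line_def add.commute)

lemma spinor_line_exists:
  assumes l: "line \<delta>"
  obtains a b c d where "spinor_line \<delta> a b c d" "\<bar>a * d - b * c\<bar> = 1"
proof -
  obtain p p' q q' r r' where P: "\<And>t. hP (\<delta> t) = p * exp t + p' * exp (- t)"
    and Q: "\<And>t. hQ (\<delta> t) = q * exp t + q' * exp (- t)" and R: "\<And>t. hR (\<delta> t) = r * exp t + r' * exp (- t)"
    using hyp_line_exponential[OF l] by blast
  have nn: "0 \<le> p" "0 \<le> p'" "0 \<le> q" "0 \<le> q'"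
  proof -
    show "0 \<le> p" using hP_pos[of "\<delta> _"] unfolding P by (rule nonneg_leading_coefficient)
    show "0 \<le> q" using hQ_pos[of "\<delta> _"] unfolding Q by (rule nonneg_leading_coefficient)
    show "0 \<le> p'" using hP_pos[of "\<delta> (- _)"] unfolding P
      by (intro nonneg_leading_coefficient[of p' p]) (simp add: add.commute)
    show "0 \<le> q'" using hQ_pos[of "\<delta> (- _)"] unfolding Q
      by (intro nonneg_leading_coefficient[of q' q]) (simp add: add.commute)
  qed
  \<comment> \<open>With u = exp t the determinant condition along the line is an identity of
    Laurent polynomials in \<open>u\<close>; the values at 1, 2 and 3 determine its
    coefficients.\<close>
  define A B C where "A = p * q - r\<^sup>2" and "B = p * q' + p' * q - 2 * (r * r')" and "C = p' * q' - r'\<^sup>2"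
  have poly: "A * u\<^sup>2 + B + C / u\<^sup>2 = 1" if u: "0 < u" for u
  proof -
    have e: "exp (ln u) = u" "exp (- ln u) = 1 / u" using u by (simp_all add: exp_minus inverse_eq_divide)
    have id: "(p * u + p' * z) * (q * u + q' * z) - (r * u + r' * z)\<^sup>2
        = A * u\<^sup>2 + B * (u * z) + C * z\<^sup>2" for z
      unfolding A_def B_def C_def by (simp add: power2_eq_square algebra_simps)
    have "A * u\<^sup>2 + B * (u * (1 / u)) + C * (1 / u)\<^sup>2 = 1"
      using hPQR[of "\<delta> (ln u)"] unfolding P Q R e id .
    then show ?thesis using u by (simp add: power_divide)
  qed
  have "A + B + C = 1" "4 * A + B + C / 4 = 1" "9 * A + B + C / 9 = 1"
    using poly[of 1] poly[of 2] poly[of 3] by simp_all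
  then have "A = 0" "B = 1" "C = 0" by (simp_all add: field_simps)
  then have n: "p * q = r\<^sup>2" "p' * q' = r'\<^sup>2" and B1: "p * q' + p' * q - 2 * (r * r') = 1"
    by (simp_all add: A_def B_def C_def)
  obtain a b where ab: "p = a\<^sup>2" "q = b\<^sup>2" "r = a * b" by (rule null_vector_spinor[OF nn(1,3) n(1)])
  obtain c d where cd: "p' = c\<^sup>2" "q' = d\<^sup>2" "r' = c * d" by (rule null_vector_spinor[OF nn(2,4) n(2)])
  have "spinor_line \<delta> a b c d" unfolding spinor_line_def P Q R ab cd by simp
  moreover have "(a * d - b * c)\<^sup>2 = 1"
    using B1 unfolding ab cd by (simp add: power2_eq_square algebra_simps)
  then have "a * d - b * c = 1 \<or> a * d - b * c = -1" by (simp only: power2_eq_1_iff)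
  then have "\<bar>a * d - b * c\<bar> = 1" by linarith
  ultimately show ?thesis by (rule that)
qed

text \<open>The leading coefficient of twice the hyperbolic cosine of the distance is the squared
  determinant of the two forward ends. Reversing lines gives the other pairs of ends.\<close>

lemma spinor_limit:
  assumes s: "spinor_line \<gamma> a b c d" "spinor_line \<eta> a' b' c' d'"
  shows "(\<lambda>n. exp (dist (\<gamma> (real n)) (\<eta> (real n)) / 2 - real n)) \<longlonglongrightarrow> \<bar>a * b' - b * a'\<bar>"
proof -
  define K where "K = (a * b' - b * a')\<^sup>2"
  define K1 where "K1 = a\<^sup>2 * d'\<^sup>2 + c\<^sup>2 * b'\<^sup>2 + b\<^sup>2 * c'\<^sup>2 + d\<^sup>2 * a'\<^sup>2 - 2 * (a * b) * (c' * d') - 2 * (c * d) * (a' * b')"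
  define K2 where "K2 = (c * d' - d * c')\<^sup>2"
  have C: "2 * cosh (dist (\<gamma> t) (\<eta> t)) = K * (exp t * exp t) + K1 * (exp t * exp (- t)) + K2 * (exp (- t) * exp (- t))" for t
  proof -
    have g: "hP (\<gamma> t) = a\<^sup>2 * exp t + c\<^sup>2 * exp (- t)" "hQ (\<gamma> t) = b\<^sup>2 * exp t + d\<^sup>2 * exp (- t)"
      "hR (\<gamma> t) = (a * b) * exp t + (c * d) * exp (- t)"
      "hP (\<eta> t) = a'\<^sup>2 * exp t + c'\<^sup>2 * exp (- t)" "hQ (\<eta> t) = b'\<^sup>2 * exp t + d'\<^sup>2 * exp (- t)"
      "hR (\<eta> t) = (a' * b') * exp t + (c' * d') * exp (- t)"
      using s by (simp_all add: spinor_line_def)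
    have "2 * cosh (dist (\<gamma> t) (\<eta> t)) = hP (\<gamma> t) * hQ (\<eta> t) + hQ (\<gamma> t) * hP (\<eta> t) - 2 * (hR (\<gamma> t) * hR (\<eta> t))"
      by (simp add: cosh_dist_hyp)
    also have "\<dots> = K * (exp t * exp t) + K1 * (exp t * exp (- t)) + K2 * (exp (- t) * exp (- t))"
      unfolding g K_def K1_def K2_def power2_eq_square by (simp only: algebra_simps)
    finally show ?thesis .
  qed
  have two: "filterlim (\<lambda>n. 2 * real n) at_top sequentially"
    by (intro filterlim_tendsto_pos_mult_at_top[OF tendsto_const _ filterlim_real_sequentially]) simp
  then have e0: "(\<lambda>n. exp (- (2 * real n))) \<longlonglongrightarrow> 0" by (simp only: exp_uminus_tendsto_0_iff)
  have "(\<lambda>n. exp (- (2 * real n)) * exp (- dist (\<gamma> (real n)) (\<eta> (real n)))) \<longlonglongrightarrow> 0"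
    by (rule tendsto_sandwich[OF _ _ tendsto_const e0]) (simp_all add: mult_left_le)
  then have "(\<lambda>n. K + K1 * exp (- (2 * real n)) + K2 * (exp (- (2 * real n)) * exp (- (2 * real n)))
      - exp (- (2 * real n)) * exp (- dist (\<gamma> (real n)) (\<eta> (real n)))) \<longlonglongrightarrow> K + K1 * 0 + K2 * (0 * 0) - 0"
    by (intro tendsto_intros e0)
  moreover have "K + K1 * exp (- (2 * real n)) + K2 * (exp (- (2 * real n)) * exp (- (2 * real n)))
      - exp (- (2 * real n)) * exp (- dist (\<gamma> (real n)) (\<eta> (real n)))
      = exp (dist (\<gamma> (real n)) (\<eta> (real n)) - 2 * real n)" for n
  proof -
    have F: "exp (dist (\<gamma> (real n)) (\<eta> (real n))) = K * (exp (real n) * exp (real n))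
        + K1 * (exp (real n) * exp (- real n)) + K2 * (exp (- real n) * exp (- real n))
        - exp (- dist (\<gamma> (real n)) (\<eta> (real n)))"
      unfolding C[symmetric] by (simp add: cosh_field_def field_simps)
    have "exp (- (2 * real n)) * exp (dist (\<gamma> (real n)) (\<eta> (real n)))
      = K * (exp (- (2 * real n)) * (exp (real n) * exp (real n))) + K1 * (exp (- (2 * real n)) * (exp (real n) * exp (- real n)))
        + K2 * (exp (- (2 * real n)) * (exp (- real n) * exp (- real n)))
        - exp (- (2 * real n)) * exp (- dist (\<gamma> (real n)) (\<eta> (real n)))"
      unfolding F by (simp only: algebra_simps)
    then show ?thesis by (simp add: mult_exp_exp)
  qed
  ultimately have "(\<lambda>n. exp (dist (\<gamma> (real n)) (\<eta> (real n)) - 2 * real n)) \<longlonglongrightarrow> K" by simp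
  then have "(\<lambda>n. sqrt (exp (dist (\<gamma> (real n)) (\<eta> (real n)) - 2 * real n))) \<longlonglongrightarrow> sqrt K" by (rule tendsto_real_sqrt)
  moreover have "sqrt (exp (dist (\<gamma> (real n)) (\<eta> (real n)) - 2 * real n)) = exp (dist (\<gamma> (real n)) (\<eta> (real n)) / 2 - real n)" for n
    by (intro real_sqrt_unique) (simp_all add: power2_eq_square mult_exp_exp)
  ultimately show ?thesis by (simp add: K_def)
qed

text \<open>The Pluecker relation between the four null directions turns into one of the three
  additive relations between the products of opposite distances.\<close>

lemma hyp_ptolemy_cases:
  fixes v1 v2 v3 v4 :: "hyp_plane ideal_point" and p :: hyp_plane
  assumes v: "v1 \<in> boundary_at_infinity" "v2 \<in> boundary_at_infinity" "v3 \<in> boundary_at_infinity" "v4 \<in> boundary_at_infinity"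
    and ne: "v1 \<noteq> v3" "v2 \<noteq> v4"
  defines "r \<equiv> bourdon_metric p"
  obtains "r v1 v3 * r v2 v4 = r v1 v2 * r v3 v4 + r v2 v3 * r v4 v1"
  | "r v1 v2 * r v3 v4 = r v1 v3 * r v2 v4 + r v2 v3 * r v4 v1"
  | "r v2 v3 * r v4 v1 = r v1 v3 * r v2 v4 + r v1 v2 * r v3 v4"
proof -
  obtain \<gamma> where \<gamma>: "joins \<gamma> v1 v3" by (rule hyp.line_exists[OF v(1,3) ne(1)])
  obtain \<eta> where \<eta>: "joins \<eta> v2 v4" by (rule hyp.line_exists[OF v(2,4) ne(2)])
  have l: "line \<gamma>" "line \<eta>" using \<gamma> \<eta> by (simp_all add: joins_def)
  obtain a b c d where s: "spinor_line \<gamma> a b c d" "\<bar>a * d - b * c\<bar> = 1" by (rule spinor_line_exists[OF l(1)])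
  obtain a' b' c' d' where s': "spinor_line \<eta> a' b' c' d'" "\<bar>a' * d' - b' * c'\<bar> = 1" by (rule spinor_line_exists[OF l(2)])
  note lims = hyp.cross_ratio_limits[OF v ne \<gamma> \<eta>, of p, folded r_def]
  have e: "exp ((x + y) / 2 - 2 * z) = exp (x / 2 - z) * exp (y / 2 - z)" for x y z :: real
    by (simp add: mult_exp_exp add_divide_distrib)
  have "(\<lambda>n. exp ((dist (\<gamma> (- real n)) (\<eta> (- real n)) + dist (\<gamma> (real n)) (\<eta> (real n))) / 2 - 2 * real n))
      \<longlonglongrightarrow> \<bar>c * d' - d * c'\<bar> * \<bar>a * b' - b * a'\<bar>"
    unfolding e by (intro tendsto_mult spinor_limit[OF s(1) s'(1)]
        spinor_limit[OF spinor_line_reverse[OF s(1)] spinor_line_reverse[OF s'(1)]])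
  then have A: "r v1 v2 * r v3 v4 / (r v1 v3 * r v2 v4) = \<bar>c * d' - d * c'\<bar> * \<bar>a * b' - b * a'\<bar>"
    using lims(1) LIMSEQ_unique by blast
  have "(\<lambda>n. exp ((dist (\<gamma> (real n)) (\<eta> (- real n)) + dist (\<gamma> (- real n)) (\<eta> (real n))) / 2 - 2 * real n))
      \<longlonglongrightarrow> \<bar>a * d' - b * c'\<bar> * \<bar>c * b' - d * a'\<bar>"
    unfolding e by (intro tendsto_mult spinor_limit[OF s(1) spinor_line_reverse[OF s'(1)]]
        spinor_limit[OF spinor_line_reverse[OF s(1)] s'(1)])
  then have B: "r v2 v3 * r v4 v1 / (r v1 v3 * r v2 v4) = \<bar>a * d' - b * c'\<bar> * \<bar>c * b' - d * a'\<bar>"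
    using lims(2) LIMSEQ_unique by blast
  define C where "C = r v1 v3 * r v2 v4"
  have C: "0 < C" unfolding C_def r_def using v ne by (intro mult_pos_pos hyp.bourdon_pos)
  \<comment> \<open>The normalisation of both lines gives |w| = 1, and the signs of \<open>x\<close>
    and \<open>y\<close> in w = x - y select the case.\<close>
  define x y w where "x = (c * d' - d * c') * (a * b' - b * a')" and "y = (a * d' - b * c') * (c * b' - d * a')"
    and "w = (a * d - b * c) * (a' * d' - b' * c')"
  have "w = x - y" unfolding w_def x_def y_def by (simp add: algebra_simps)
  moreover have "\<bar>w\<bar> = 1" using s(2) s'(2) by (simp add: w_def abs_mult)
  ultimately have "\<bar>x\<bar> + \<bar>y\<bar> = 1 \<or> \<bar>x\<bar> = 1 + \<bar>y\<bar> \<or> \<bar>y\<bar> = 1 + \<bar>x\<bar>" by linarith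
  moreover have "r v1 v2 * r v3 v4 = \<bar>x\<bar> * C" "r v2 v3 * r v4 v1 = \<bar>y\<bar> * C"
    using A B C by (simp_all add: x_def y_def abs_mult divide_eq_eq flip: C_def)
  ultimately show ?thesis
  proof (elim disjE)
    assume "\<bar>x\<bar> + \<bar>y\<bar> = 1" and *: "r v1 v2 * r v3 v4 = \<bar>x\<bar> * C" "r v2 v3 * r v4 v1 = \<bar>y\<bar> * C"
    then have "C = \<bar>x\<bar> * C + \<bar>y\<bar> * C" by (metis distrib_right mult_1)
    then show ?thesis using that(1) * by (simp add: C_def)
  next
    assume "\<bar>x\<bar> = 1 + \<bar>y\<bar>" and *: "r v1 v2 * r v3 v4 = \<bar>x\<bar> * C" "r v2 v3 * r v4 v1 = \<bar>y\<bar> * C"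
    then have "\<bar>x\<bar> * C = C + \<bar>y\<bar> * C" by (metis distrib_right mult_1)
    then show ?thesis using that(2) * by (simp add: C_def)
  next
    assume "\<bar>y\<bar> = 1 + \<bar>x\<bar>" and *: "r v1 v2 * r v3 v4 = \<bar>x\<bar> * C" "r v2 v3 * r v4 v1 = \<bar>y\<bar> * C"
    then have "\<bar>y\<bar> * C = C + \<bar>x\<bar> * C" by (metis distrib_right mult_1)
    then show ?thesis using that(3) * by (simp add: C_def)
  qed
qed

section \<open>A crossing point is an interior point\<close>

text \<open>The polar form of the determinant; \<open>bform\<close> is the same form in a basis
  adapted to two crossing lines.\<close>

definition lorentz :: "real \<times> real \<times> real \<Rightarrow> real \<times> real \<times> real \<Rightarrow> real" where
  "lorentz U V = (fst U * fst (snd V) + fst (snd U) * fst V) / 2 - snd (snd U) * snd (snd V)"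

definition hvec :: "hyp_plane \<Rightarrow> real \<times> real \<times> real" where
  "hvec z = (hP z, hQ z, hR z)"

lemma lorentz_linear:
  "lorentz (U + U') V = lorentz U V + lorentz U' V" "lorentz V (U + U') = lorentz V U + lorentz V U'"
  "lorentz (c *\<^sub>R U) V = c * lorentz U V" "lorentz V (c *\<^sub>R U) = c * lorentz V U"
  "lorentz (U - U') V = lorentz U V - lorentz U' V"
  by (simp_all add: lorentz_def algebra_simps add_divide_distrib diff_divide_distrib)

lemma lorentz_commute: "lorentz U V = lorentz V U"
  by (simp add: lorentz_def)

lemma cosh_dist_lorentz: "cosh (dist z w) = lorentz (hvec z) (hvec w)"
  by (simp add: cosh_dist_hyp lorentz_def hvec_def)

text \<open>The Gram determinant of \<open>M\<close>, \<open>E\<close>, \<open>F\<close> is 1 - k^2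
  and hence nonzero, so they form a basis, and Cramer's rule annihilates a vector orthogonal to all
  three.\<close>

lemma lorentz_basis_orthogonal:
  assumes M: "lorentz M M = 1" "lorentz M E = 0" "lorentz M F = 0" "lorentz E E = -1" "lorentz F F = -1"
      "lorentz E F = -k" and k: "k\<^sup>2 < 1"
    and D: "lorentz D M = 0" "lorentz D E = 0" "lorentz D F = 0"
  shows "D = 0"
proof -
  obtain m1 m2 m3 e1 e2 e3 f1 f2 f3 d1 d2 d3 where [simp]:
    "M = (m1, m2, m3)" "E = (e1, e2, e3)" "F = (f1, f2, f3)" "D = (d1, d2, d3)"
    by (cases M, cases E, cases F, cases D) blast
  define T where "T = m1 * (e2 * f3 - e3 * f2) - m2 * (e1 * f3 - e3 * f1) + m3 * (e1 * f2 - e2 * f1)"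
  have gram: "T * T = 4 * (lorentz M M * (lorentz E E * lorentz F F - lorentz E F * lorentz E F)
     - lorentz M E * (lorentz M E * lorentz F F - lorentz E F * lorentz M F)
     + lorentz M F * (lorentz M E * lorentz E F - lorentz E E * lorentz M F))"
    unfolding T_def lorentz_def by (simp add: field_simps)
  then have "T * T = 4 * (1 - k\<^sup>2)" unfolding M by (simp add: power2_eq_square)
  then have T: "T \<noteq> 0" using k by auto
  \<comment> \<open>The components of \<open>lorentz D\<close> as a linear functional.\<close>
  define u1 u2 u3 where "u1 = d2 / 2" and "u2 = d1 / 2" and "u3 = - d3"
  have m: "m1 * u1 + m2 * u2 + m3 * u3 = 0" and e: "e1 * u1 + e2 * u2 + e3 * u3 = 0" and f: "f1 * u1 + f2 * u2 + f3 * u3 = 0"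
    using D by (simp_all add: lorentz_def u1_def u2_def u3_def field_simps)
  have "T * u1 = (e2 * f3 - e3 * f2) * (m1 * u1 + m2 * u2 + m3 * u3) + (f2 * m3 - f3 * m2) * (e1 * u1 + e2 * u2 + e3 * u3)
      + (m2 * e3 - m3 * e2) * (f1 * u1 + f2 * u2 + f3 * u3)"
    unfolding T_def by (simp add: algebra_simps)
  moreover have "T * u2 = (e3 * f1 - e1 * f3) * (m1 * u1 + m2 * u2 + m3 * u3) + (f3 * m1 - f1 * m3) * (e1 * u1 + e2 * u2 + e3 * u3)
      + (m3 * e1 - m1 * e3) * (f1 * u1 + f2 * u2 + f3 * u3)"
    unfolding T_def by (simp add: algebra_simps)
  moreover have "T * u3 = (e1 * f2 - e2 * f1) * (m1 * u1 + m2 * u2 + m3 * u3) + (f1 * m2 - f2 * m1) * (e1 * u1 + e2 * u2 + e3 * u3)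
      + (m1 * e2 - m2 * e1) * (f1 * u1 + f2 * u2 + f3 * u3)"
    unfolding T_def by (simp add: algebra_simps)
  ultimately have "u1 = 0" "u2 = 0" "u3 = 0" using T unfolding m e f by simp_all
  then show ?thesis by (simp add: u1_def u2_def u3_def zero_prod_def)
qed

lemma hyp_line_vector:
  fixes \<delta> :: "real \<Rightarrow> hyp_plane"
  assumes l: "line \<delta>"
  obtains E where "\<And>t. hvec (\<delta> t) = cosh t *\<^sub>R hvec (\<delta> 0) + sinh t *\<^sub>R E"
proof -
  obtain p p' q q' r r' where P: "\<And>t. hP (\<delta> t) = p * exp t + p' * exp (- t)"
    and Q: "\<And>t. hQ (\<delta> t) = q * exp t + q' * exp (- t)" and R: "\<And>t. hR (\<delta> t) = r * exp t + r' * exp (- t)"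
    using hyp_line_exponential[OF l] by blast
  have "hvec (\<delta> t) = cosh t *\<^sub>R hvec (\<delta> 0) + sinh t *\<^sub>R (p - p', q - q', r - r')" for t
    unfolding hvec_def P Q R by (simp add: cosh_field_def sinh_field_def field_simps)
  then show ?thesis by (rule that)
qed

text \<open>The norm of \<open>hvec z\<close> is one, which is the normalisation of barycentric
  coordinates; so \<open>z\<close> lies on the segment.\<close>

lemma hyp_combination_in_convex:
  fixes x y z :: hyp_plane
  assumes C: "geodesically_convex C" "x \<in> C" "y \<in> C" and lm: "0 \<le> l" "0 \<le> m"
    and z: "hvec z = l *\<^sub>R hvec x + m *\<^sub>R hvec y"
  shows "z \<in> C"
proof -
  have "1 = lorentz (hvec z) (hvec z)" using cosh_dist_lorentz[of z z] by simp
  also have "\<dots> = l\<^sup>2 * lorentz (hvec x) (hvec x) + m\<^sup>2 * lorentz (hvec y) (hvec y) + 2 * l * m * lorentz (hvec x) (hvec y)"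
    unfolding z by (simp add: lorentz_linear lorentz_commute[of "hvec y" "hvec x"] power2_eq_square algebra_simps)
  finally have n: "l\<^sup>2 + m\<^sup>2 + 2 * l * m * cosh (dist x y) = 1" by (simp flip: cosh_dist_lorentz)
  obtain r where r: "0 \<le> r" "r \<le> dist x y" "cosh r = l + m * cosh (dist x y)"
    "cosh (dist x y - r) = l * cosh (dist x y) + m"
    by (rule barycentric_param[OF zero_le_dist lm n])
  have "cosh (dist x z) = cosh r"
    unfolding r(3) cosh_dist_lorentz z lorentz_linear by (simp flip: cosh_dist_lorentz)
  then have xz: "dist x z = r" using r(1) by simp
  have "cosh (dist y z) = cosh (dist x y - r)"
    unfolding r(4) cosh_dist_lorentz z lorentz_linear by (simp add: dist_commute[of y x] flip: cosh_dist_lorentz)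
  then have zy: "dist z y = dist x y - r" using r(2) by (simp add: dist_commute)
  have b: "dist x z + dist z y = dist x y" unfolding xz zy by simp
  obtain \<gamma>1 \<gamma>2 where g: "geodesic_path \<gamma>1 x z" "geodesic_path \<gamma>2 z y" using hyp_geodesic_exists by metis
  have "(if dist x z \<le> dist x z then \<gamma>1 (dist x z) else \<gamma>2 (dist x z - dist x z)) \<in> C"
    by (rule geodesically_convexD[OF C geodesic_path_concat[OF g b]]) (use r xz in simp)
  then show ?thesis using g(1) by (simp add: geodesic_path_def)
qed

text \<open>Vectors near that of the crossing point lie in the open cone, where
  \<open>cone_decompose\<close> writes them as combinations of a point of \<gamma> and a point of
  \<eta>. Convexity thus puts a whole neighbourhood into \<open>C\<close>.\<close>

lemma crossing_point_interior:
  fixes \<gamma> \<eta> :: "real \<Rightarrow> hyp_plane"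
  assumes l: "line \<gamma>" "line \<eta>" and k: "-1 < k" "k < 1"
    and cross: "\<And>s t. cosh (dist (\<gamma> s) (\<eta> t)) = cosh s * cosh t - k * (sinh s * sinh t)"
    and C: "geodesically_convex C" "range \<gamma> \<subseteq> C" "range \<eta> \<subseteq> C"
  shows "\<gamma> 0 \<in> interior C"
proof -
  have k2: "k\<^sup>2 < 1" using k by (simp add: abs_square_less_1)
  have "cosh (dist (\<gamma> 0) (\<eta> 0)) \<le> 1" using cross[of 0 0] by simp
  then have m: "\<eta> 0 = \<gamma> 0" by (rule cosh_dist_le_1D[symmetric])
  define M where "M = hvec (\<gamma> 0)"
  obtain E where E: "\<And>t. hvec (\<gamma> t) = cosh t *\<^sub>R M + sinh t *\<^sub>R E"
    using hyp_line_vector[OF l(1)] unfolding M_def by blast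
  obtain F where F: "\<And>t. hvec (\<eta> t) = cosh t *\<^sub>R M + sinh t *\<^sub>R F"
    using hyp_line_vector[OF l(2)] unfolding M_def m by blast
  have s1: "0 < sinh (1 :: real)" and c1: "cosh (1 :: real) * cosh 1 = 1 + sinh 1 * sinh 1"
    using cosh_square_eq[of "1 :: real"] by (simp_all add: power2_eq_square)
  have MM: "lorentz M M = 1" using cosh_dist_lorentz[of "\<gamma> 0" "\<gamma> 0"] by (simp add: M_def)
  have basis: "lorentz M V = 0 \<and> lorentz V V = -1"
    if d: "line \<delta>" and V: "\<And>t. hvec (\<delta> t) = cosh t *\<^sub>R M + sinh t *\<^sub>R V" for \<delta> V
  proof -
    have "cosh (dist (\<delta> 0) (\<delta> 1)) = cosh 1" by (simp add: line_dist[OF d])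
    then have "sinh 1 * lorentz M V = 0"
      unfolding cosh_dist_lorentz V by (simp add: lorentz_linear MM)
    then have MV: "lorentz M V = 0" using s1 by simp
    have "lorentz (hvec (\<delta> 1)) (hvec (\<delta> 1)) = 1" using cosh_dist_lorentz[of "\<delta> 1" "\<delta> 1"] by simp
    then have "cosh 1 * cosh 1 + sinh 1 * (sinh 1 * lorentz V V) = 1"
      unfolding V by (simp add: lorentz_linear MM MV lorentz_commute[of V M])
    then have "(sinh 1 * sinh 1) * (lorentz V V + 1) = 0" unfolding c1 by (simp add: algebra_simps)
    then have "lorentz V V = -1" using s1 by simp
    with MV show ?thesis by simp
  qed
  have ME: "lorentz M E = 0" "lorentz E E = -1" using basis[OF l(1) E] by blast+
  have MF: "lorentz M F = 0" "lorentz F F = -1" using basis[OF l(2) F] by blast+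
  have "cosh 1 * cosh 1 + sinh 1 * (sinh 1 * lorentz E F) = cosh 1 * cosh 1 - k * (sinh 1 * sinh 1)"
    using cross[of 1 1] unfolding cosh_dist_lorentz E F
    by (simp add: lorentz_linear MM ME MF lorentz_commute[of E M])
  then have "(sinh 1 * sinh 1) * (lorentz E F + k) = 0" by (simp add: algebra_simps)
  then have EF: "lorentz E F = - k" using s1 by simp
  \<comment> \<open>Coordinates with respect to \<open>M\<close>, \<open>E\<close>, \<open>F\<close>
    are read off from three distances and are therefore continuous: \<open>X\<close> and
    \<open>Y\<close> turn out to be minus the products with \<open>E\<close> and \<open>F\<close>,
    and \<open>x\<close>, \<open>y\<close> solve the Gram system.\<close>
  define a where "a z = cosh (dist z (\<gamma> 0))" for z
  define X where "X z = (cosh 1 * a z - cosh (dist z (\<gamma> 1))) / sinh 1" for z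
  define Y where "Y z = (cosh 1 * a z - cosh (dist z (\<eta> 1))) / sinh 1" for z
  define x where "x z = (X z - k * Y z) / (1 - k\<^sup>2)" for z
  define y where "y z = (Y z - k * X z) / (1 - k\<^sup>2)" for z
  define U where "U = {z. \<bar>x z\<bar> + \<bar>y z\<bar> < a z}"
  have cont: "continuous_on UNIV a" "continuous_on UNIV X" "continuous_on UNIV Y"
    unfolding a_def X_def Y_def using s1 by (intro continuous_intros; simp)+
  then have "continuous_on UNIV x" "continuous_on UNIV y"
    unfolding x_def y_def using k2 by (intro continuous_intros; simp)+
  then have "open U" unfolding U_def using cont by (intro open_Collect_less continuous_intros)
  moreover have "\<gamma> 0 \<in> U"
  proof -
    have "dist (\<gamma> 0) (\<eta> 1) = 1" unfolding m[symmetric] by (simp add: line_dist[OF l(2)])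
    then show ?thesis by (simp add: U_def x_def y_def X_def Y_def a_def line_dist[OF l(1)])
  qed
  moreover have "U \<subseteq> C"
  proof
    fix z assume "z \<in> U"
    then have cone: "(a z, x z, y z) \<in> cone" by (simp add: U_def cone_def)
    have az: "lorentz (hvec z) M = a z" by (simp add: a_def cosh_dist_lorentz M_def)
    have Xz: "lorentz (hvec z) E = - X z"
    proof -
      have "cosh (dist z (\<gamma> 1)) = cosh 1 * a z + sinh 1 * lorentz (hvec z) E"
        unfolding cosh_dist_lorentz E lorentz_linear az ..
      then show ?thesis using s1 by (simp add: X_def)
    qed
    have Yz: "lorentz (hvec z) F = - Y z"
    proof -
      have "cosh (dist z (\<eta> 1)) = cosh 1 * a z + sinh 1 * lorentz (hvec z) F"
        unfolding cosh_dist_lorentz F lorentz_linear az ..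
      then show ?thesis using s1 by (simp add: Y_def)
    qed
    have nz: "1 - k\<^sup>2 \<noteq> 0" using k2 by simp
    have "(1 - k\<^sup>2) * (x z + k * y z) = (1 - k\<^sup>2) * X z" "(1 - k\<^sup>2) * (k * x z + y z) = (1 - k\<^sup>2) * Y z"
    proof -
      have xx: "(1 - k\<^sup>2) * x z = X z - k * Y z" and yy: "(1 - k\<^sup>2) * y z = Y z - k * X z"
        using nz by (simp_all add: x_def y_def)
      have "(1 - k\<^sup>2) * (x z + k * y z) = (1 - k\<^sup>2) * x z + k * ((1 - k\<^sup>2) * y z)"
        "(1 - k\<^sup>2) * (k * x z + y z) = k * ((1 - k\<^sup>2) * x z) + (1 - k\<^sup>2) * y z"
        by (simp_all only: algebra_simps)
      then show "(1 - k\<^sup>2) * (x z + k * y z) = (1 - k\<^sup>2) * X z" "(1 - k\<^sup>2) * (k * x z + y z) = (1 - k\<^sup>2) * Y z"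
        unfolding xx yy by (simp_all add: power2_eq_square algebra_simps)
    qed
    then have XY: "x z + k * y z = X z" "k * x z + y z = Y z" using nz by simp_all
    define D where "D = hvec z - (a z *\<^sub>R M + x z *\<^sub>R E + y z *\<^sub>R F)"
    have "D = 0"
    proof (rule lorentz_basis_orthogonal[OF MM ME(1) MF(1) ME(2) MF(2) EF k2])
      show "lorentz D M = 0"
        unfolding D_def lorentz_linear az lorentz_commute[of E M] lorentz_commute[of F M] MM ME MF by simp
      show "lorentz D E = 0"
        unfolding D_def lorentz_linear Xz lorentz_commute[of F E] EF ME XY(1)[symmetric] by simp
      show "lorentz D F = 0"
        unfolding D_def lorentz_linear Yz EF MF XY(2)[symmetric] by simp
    qed
    then have z: "hvec z = a z *\<^sub>R M + x z *\<^sub>R E + y z *\<^sub>R F" by (simp add: D_def)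
    obtain l m s t where lm: "0 \<le> l" "0 \<le> m" and dec: "(a z, x z, y z) = l *\<^sub>R mU s + m *\<^sub>R mW t"
      using cone_decompose[OF cone] by blast
    have "a z = l * cosh s + m * cosh t" "x z = l * sinh s" "y z = m * sinh t"
      using dec by (simp_all add: mU_def mW_def)
    then have comb: "hvec z = l *\<^sub>R hvec (\<gamma> s) + m *\<^sub>R hvec (\<eta> t)"
      unfolding z E F by (simp add: algebra_simps)
    have "\<gamma> s \<in> C" "\<eta> t \<in> C" using C(2,3) by blast+
    then show "z \<in> C" by (rule hyp_combination_in_convex[OF C(1) _ _ lm comb])
  qed
  ultimately show ?thesis by (intro interiorI)
qed

lemma hyp_crossing_interior:
  fixes w1 w2 w3 w4 :: "hyp_plane ideal_point" and p :: hyp_plane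
  assumes w: "w1 \<in> boundary_at_infinity" "w2 \<in> boundary_at_infinity" "w3 \<in> boundary_at_infinity" "w4 \<in> boundary_at_infinity"
    and dis: "distinct [w1, w2, w3, w4]"
    and eq: "bourdon_metric p w1 w3 * bourdon_metric p w2 w4
      = bourdon_metric p w1 w2 * bourdon_metric p w3 w4 + bourdon_metric p w2 w3 * bourdon_metric p w4 w1"
    and C: "geodesically_convex C" "geodesic_line w1 w3 \<subseteq> C" "geodesic_line w2 w4 \<subseteq> C"
  shows "\<exists>z \<in> geodesic_line w1 w3. z \<in> interior C"
proof -
  obtain k \<gamma> \<eta> where k: "-1 < k" "k < 1" and j: "joins \<gamma> w1 w3" "joins \<eta> w2 w4"
    and cross: "\<And>s t. cosh (dist (\<gamma> s) (\<eta> t)) = cosh s * cosh t - k * (sinh s * sinh t)"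
    by (rule hyp.ptolemy_equality_crossing[OF w dis eq]) (rule that)
  have l: "line \<gamma>" "line \<eta>" using j by (simp_all add: joins_def)
  have r: "geodesic_line w1 w3 = range \<gamma>" "geodesic_line w2 w4 = range \<eta>"
    by (rule hyp.geodesic_line_eq[OF w(1,3) j(1)], rule hyp.geodesic_line_eq[OF w(2,4) j(2)])
  have "\<gamma> 0 \<in> interior C"
    by (rule crossing_point_interior[OF l k cross C(1)]) (use C r in simp_all)
  then show ?thesis unfolding r by blast
qed

lemma hyp_quadrilateral_ptolemy:
  fixes p :: hyp_plane
  assumes quad: "ideal_quadrilateral v1 v2 v3 v4 Q"
  defines "r \<equiv> bourdon_metric p"
  shows "r v1 v3 * r v2 v4 = r v1 v2 * r v3 v4 + r v2 v3 * r v4 v1"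
proof -
  have v: "v1 \<in> boundary_at_infinity" "v2 \<in> boundary_at_infinity" "v3 \<in> boundary_at_infinity" "v4 \<in> boundary_at_infinity"
    and dis: "distinct [v1, v2, v3, v4]" and Q: "Q = ideal_hull {v1, v2, v3, v4}"
    and fr: "geodesic_line v1 v2 \<subseteq> frontier Q" "geodesic_line v2 v3 \<subseteq> frontier Q"
    using quad unfolding ideal_quadrilateral_def by blast+
  have conv: "geodesically_convex Q" unfolding Q ideal_hull_def by (rule geodesically_convex_hull)
  have sub: "geodesic_line v w \<subseteq> Q" if "v \<in> {v1, v2, v3, v4}" "w \<in> {v1, v2, v3, v4}" "v \<noteq> w" for v w
  proof -
    have "geodesic_line v w \<subseteq> \<Union>{geodesic_line v w | v w. v \<in> {v1, v2, v3, v4} \<and> w \<in> {v1, v2, v3, v4} \<and> v \<noteq> w}"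
      using that by blast
    also have "\<dots> \<subseteq> Q" unfolding Q ideal_hull_def by (rule hull_subset)
    finally show ?thesis .
  qed
  note c = hyp.bourdon_commute[of _ _ p, folded r_def]
  have ne: "v1 \<noteq> v3" "v2 \<noteq> v4" using dis by auto
  show ?thesis
  proof (rule hyp_ptolemy_cases[OF v ne, of p, folded r_def])
    \<comment> \<open>Here v1 v2 and v3 v4 would be the crossing pair, which puts a point of a side
      into the interior of the hull.\<close>
    assume "r v1 v2 * r v3 v4 = r v1 v3 * r v2 v4 + r v2 v3 * r v4 v1"
    then have "r v1 v2 * r v3 v4 = r v1 v3 * r v2 v4 + r v3 v2 * r v4 v1" by (simp only: c[OF v(2,3)])
    moreover have "distinct [v1, v3, v2, v4]" using dis by auto
    ultimately have "\<exists>z \<in> geodesic_line v1 v2. z \<in> interior Q"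
      unfolding r_def by (intro hyp_crossing_interior[OF v(1,3,2,4) _ _ conv] sub) (use dis in auto)
    then show ?thesis using fr(1) unfolding frontier_def by blast
  next
    \<comment> \<open>The same for v2 v3 and v4 v1; the order v2, v4, v3, v1 makes them the
      diagonals.\<close>
    assume "r v2 v3 * r v4 v1 = r v1 v3 * r v2 v4 + r v1 v2 * r v3 v4"
    then have "r v2 v3 * r v4 v1 = r v2 v4 * r v3 v1 + r v4 v3 * r v1 v2"
      by (simp only: c[OF v(1,3)] c[OF v(3,4)] mult.commute)
    moreover have "distinct [v2, v4, v3, v1]" using dis by auto
    ultimately have "\<exists>z \<in> geodesic_line v2 v3. z \<in> interior Q"
      unfolding r_def by (intro hyp_crossing_interior[OF v(2,4,3,1) _ _ conv] sub) (use dis in auto)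
    then show ?thesis using fr(2) unfolding frontier_def by blast
  qed
qed

section \<open>Transfer of cross ratios through an isometry of hulls\<close>

lemma isometry_of_reals:
  fixes \<tau> :: "real \<Rightarrow> real"
  assumes iso: "\<And>s t. \<bar>\<tau> s - \<tau> t\<bar> = \<bar>s - t\<bar>"
  shows "(\<forall>t. \<tau> t = \<tau> 0 + t) \<or> (\<forall>t. \<tau> t = \<tau> 0 - t)"
proof (rule ccontr)
  assume "\<not> ?thesis"
  then obtain s t where st: "\<tau> s \<noteq> \<tau> 0 + s" "\<tau> t \<noteq> \<tau> 0 - t" by blast
  have "\<tau> s = \<tau> 0 - s" "\<tau> t = \<tau> 0 + t" using iso[of s 0] iso[of t 0] st by linarith+
  then have "\<bar>s + t\<bar> = \<bar>s - t\<bar>" using iso[of s t] by linarith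
  then have "s = 0 \<or> t = 0" by linarith
  then show False using st \<open>\<tau> s = \<tau> 0 - s\<close> \<open>\<tau> t = \<tau> 0 + t\<close> by auto
qed

context star_space
begin

text \<open>The change of parameter is an isometry of the real line, that is a translation or a
  reflection; a reflection interchanges the ends.\<close>

lemma line_with_same_range_joins:
  fixes \<gamma> \<delta> :: "real \<Rightarrow> 'a"
  assumes y: "y \<in> boundary_at_infinity" "y' \<in> boundary_at_infinity" and j: "joins \<gamma> y y'"
    and d: "line \<delta>" and r: "range \<delta> = range \<gamma>"
  shows "joins \<delta> y y' \<or> joins \<delta> y' y"
proof -
  have l: "line \<gamma>" using j by (simp add: joins_def)
  have "\<exists>u. \<delta> t = \<gamma> u" for t using r by (metis rangeE rangeI)
  then obtain \<tau> where \<tau>: "\<And>t. \<delta> t = \<gamma> (\<tau> t)" by metis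
  have "\<bar>\<tau> s - \<tau> t\<bar> = \<bar>s - t\<bar>" for s t
    using line_dist[OF d, of s t] unfolding \<tau> by (simp add: line_dist[OF l])
  from isometry_of_reals[OF this] show ?thesis
  proof
    assume "\<forall>t. \<tau> t = \<tau> 0 + t"
    then have "\<delta> = (\<lambda>t. \<gamma> (\<tau> 0 + t))" using \<tau> by (intro ext) metis
    then show ?thesis using joins_shift[OF y j, of "\<tau> 0"] by simp
  next
    assume "\<forall>t. \<tau> t = \<tau> 0 - t"
    then have "\<delta> = (\<lambda>t. \<gamma> (\<tau> 0 + - t))" using \<tau> by (intro ext) (metis add.commute uminus_add_conv_diff)
    then show ?thesis using joins_reverse[OF joins_shift[OF y j, of "\<tau> 0"]] by simp
  qed
qed

lemma geodesic_line_in_hull: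
  "v \<in> V \<Longrightarrow> w \<in> V \<Longrightarrow> v \<noteq> w \<Longrightarrow> geodesic_line v w \<subseteq> ideal_hull (V :: 'a ideal_point set)"
  unfolding ideal_hull_def using hull_subset[of "\<Union>{geodesic_line v w | v w. v \<in> V \<and> w \<in> V \<and> v \<noteq> w}" geodesically_convex]
  by blast

end

text \<open>The isometry is not known to carry the end \<open>y1\<close> to \<open>v1\<close>: each
  diagonal may be traversed in either direction. The four resulting labellings \<open>w1\<close> to
  \<open>w4\<close> all satisfy the same relation.\<close>

theorem quadrilateral_imp_ptolemy_equality:
  fixes y1 y2 y3 y4 :: "'a::metric_space ideal_point" and p :: 'a
  assumes X: "star_space TYPE('a)"
    and y: "y1 \<in> boundary_at_infinity" "y2 \<in> boundary_at_infinity" "y3 \<in> boundary_at_infinity"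
      "y4 \<in> boundary_at_infinity"
    and dis: "distinct [y1, y2, y3, y4]"
    and quad: "ideal_quadrilateral v1 v2 v3 v4 Q"
    and f: "isometry_between f (ideal_hull {y1, y2, y3, y4}) Q"
    and diag: "f ` geodesic_line y1 y3 = geodesic_line v1 v3" "f ` geodesic_line y2 y4 = geodesic_line v2 v4"
  shows "bourdon_metric p y1 y3 * bourdon_metric p y2 y4
      = bourdon_metric p y1 y2 * bourdon_metric p y3 y4 + bourdon_metric p y2 y3 * bourdon_metric p y4 y1"
proof -
  interpret star_space "TYPE('a)" by (rule X)
  have ne: "y1 \<noteq> y3" "y2 \<noteq> y4" using dis by auto
  obtain \<gamma> where \<gamma>: "joins \<gamma> y1 y3" by (rule line_exists[OF y(1,3) ne(1)])
  obtain \<eta> where \<eta>: "joins \<eta> y2 y4" by (rule line_exists[OF y(2,4) ne(2)])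
  have l: "line \<gamma>" "line \<eta>" using \<gamma> \<eta> by (simp_all add: joins_def)
  have gl: "geodesic_line y1 y3 = range \<gamma>" "geodesic_line y2 y4 = range \<eta>"
    by (rule geodesic_line_eq[OF y(1,3) \<gamma>], rule geodesic_line_eq[OF y(2,4) \<eta>])
  have "range \<gamma> \<subseteq> ideal_hull {y1, y2, y3, y4}" "range \<eta> \<subseteq> ideal_hull {y1, y2, y3, y4}"
    unfolding gl[symmetric] using ne by (intro geodesic_line_in_hull; simp)+
  then have in_hull: "\<gamma> t \<in> ideal_hull {y1, y2, y3, y4}" "\<eta> t \<in> ideal_hull {y1, y2, y3, y4}" for t by blast+
  have iso: "dist (f x) (f x') = dist x x'" if "x \<in> ideal_hull {y1, y2, y3, y4}" "x' \<in> ideal_hull {y1, y2, y3, y4}" for x x'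
    using f that unfolding isometry_between_def by blast
  have v: "v1 \<in> boundary_at_infinity" "v2 \<in> boundary_at_infinity" "v3 \<in> boundary_at_infinity" "v4 \<in> boundary_at_infinity"
    and vdis: "distinct [v1, v2, v3, v4]"
    using quad by (simp_all add: ideal_quadrilateral_def)
  have vne: "v1 \<noteq> v3" "v2 \<noteq> v4" using vdis by auto
  define \<gamma>' \<eta>' where "\<gamma>' t = f (\<gamma> t)" and "\<eta>' t = f (\<eta> t)" for t
  have l': "line \<gamma>'" "line \<eta>'"
    using l by (simp_all add: line_def \<gamma>'_def \<eta>'_def iso in_hull)
  have d': "dist (\<gamma>' s) (\<eta>' t) = dist (\<gamma> s) (\<eta> t)" for s t by (simp add: \<gamma>'_def \<eta>'_def iso in_hull)
  obtain \<gamma>0 where \<gamma>0: "joins \<gamma>0 v1 v3" by (rule hyp.line_exists[OF v(1,3) vne(1)])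
  obtain \<eta>0 where \<eta>0: "joins \<eta>0 v2 v4" by (rule hyp.line_exists[OF v(2,4) vne(2)])
  have "range \<gamma>' = range \<gamma>0"
    using diag(1) hyp.geodesic_line_eq[OF v(1,3) \<gamma>0] unfolding gl \<gamma>'_def by (simp add: image_image)
  then have j1: "joins \<gamma>' v1 v3 \<or> joins \<gamma>' v3 v1" by (rule hyp.line_with_same_range_joins[OF v(1,3) \<gamma>0 l'(1)])
  have "range \<eta>' = range \<eta>0"
    using diag(2) hyp.geodesic_line_eq[OF v(2,4) \<eta>0] unfolding gl \<eta>'_def by (simp add: image_image)
  then have j2: "joins \<eta>' v2 v4 \<or> joins \<eta>' v4 v2" by (rule hyp.line_with_same_range_joins[OF v(2,4) \<eta>0 l'(2)])
  define q :: hyp_plane where "q = undefined"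
  let ?r = "bourdon_metric q"
  have P: "?r v1 v3 * ?r v2 v4 = ?r v1 v2 * ?r v3 v4 + ?r v2 v3 * ?r v4 v1"
    by (rule hyp_quadrilateral_ptolemy[OF quad])
  note c = hyp.bourdon_commute[of _ _ q]
  have "\<exists>w1 w2 w3 w4. w1 \<in> boundary_at_infinity \<and> w2 \<in> boundary_at_infinity \<and> w3 \<in> boundary_at_infinity \<and>
      w4 \<in> boundary_at_infinity \<and> w1 \<noteq> w3 \<and> w2 \<noteq> w4 \<and> joins \<gamma>' w1 w3 \<and> joins \<eta>' w2 w4 \<and>
      ?r w1 w3 * ?r w2 w4 = ?r w1 w2 * ?r w3 w4 + ?r w2 w3 * ?r w4 w1"
    using j1
  proof
    assume g: "joins \<gamma>' v1 v3"
    from j2 show ?thesis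
    proof
      assume "joins \<eta>' v2 v4"
      then show ?thesis using g v vne P by blast
    next
      assume h: "joins \<eta>' v4 v2"
      have "?r v1 v3 * ?r v4 v2 = ?r v1 v4 * ?r v3 v2 + ?r v4 v3 * ?r v2 v1"
        unfolding c[OF v(4,2)] c[OF v(1,4)] c[OF v(3,2)] c[OF v(4,3)] c[OF v(2,1)] using P by (simp add: mult.commute add.commute)
      then show ?thesis using g h v vne by blast
    qed
  next
    assume g: "joins \<gamma>' v3 v1"
    from j2 show ?thesis
    proof
      assume h: "joins \<eta>' v2 v4"
      have "?r v3 v1 * ?r v2 v4 = ?r v3 v2 * ?r v1 v4 + ?r v2 v1 * ?r v4 v3"
        unfolding c[OF v(3,1)] c[OF v(1,4)] c[OF v(3,2)] c[OF v(4,3)] c[OF v(2,1)] using P by (simp add: mult.commute add.commute)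
      then show ?thesis using g h v vne by blast
    next
      assume h: "joins \<eta>' v4 v2"
      have "?r v3 v1 * ?r v4 v2 = ?r v3 v4 * ?r v1 v2 + ?r v4 v1 * ?r v2 v3"
        unfolding c[OF v(3,1)] c[OF v(4,2)] using P by (simp add: mult.commute add.commute)
      then show ?thesis using g h v vne by metis
    qed
  qed
  then obtain w1 w2 w3 w4 where w: "w1 \<in> boundary_at_infinity" "w2 \<in> boundary_at_infinity" "w3 \<in> boundary_at_infinity"
      "w4 \<in> boundary_at_infinity" and wne: "w1 \<noteq> w3" "w2 \<noteq> w4" and wj: "joins \<gamma>' w1 w3" "joins \<eta>' w2 w4"
    and wP: "?r w1 w3 * ?r w2 w4 = ?r w1 w2 * ?r w3 w4 + ?r w2 w3 * ?r w4 w1" by blast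
  \<comment> \<open>\<open>f\<close> preserves the distances between points of the diagonals, so
    both pairs of limits belong to the same sequences and the cross ratios agree.\<close>
  note lim = cross_ratio_limits[OF y ne \<gamma> \<eta>, of p]
  note lim' = hyp.cross_ratio_limits[OF w wne wj, of q, unfolded d']
  let ?b = "bourdon_metric p"
  have "?b y1 y2 * ?b y3 y4 / (?b y1 y3 * ?b y2 y4) + ?b y2 y3 * ?b y4 y1 / (?b y1 y3 * ?b y2 y4)
    = (?r w1 w2 * ?r w3 w4 + ?r w2 w3 * ?r w4 w1) / (?r w1 w3 * ?r w2 w4)"
    unfolding LIMSEQ_unique[OF lim(1) lim'(1)] LIMSEQ_unique[OF lim(2) lim'(2)] by (simp only: add_divide_distrib)
  also have "\<dots> = 1"
    unfolding wP[symmetric] using hyp.bourdon_pos[OF w(1,3) wne(1), of q] hyp.bourdon_pos[OF w(2,4) wne(2), of q] by simp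
  finally have "(?b y1 y2 * ?b y3 y4 + ?b y2 y3 * ?b y4 y1) / (?b y1 y3 * ?b y2 y4) = 1"
    by (simp only: add_divide_distrib)
  then show ?thesis by (simp add: divide_eq_1_iff)
qed

section \<open>The theorem\<close>

text \<open>The common form of both metrics: a Bourdon metric with a weight at each point, which is
  one or the reciprocal distance to \<omega>.\<close>

lemma boundary_metric_rescaling:
  fixes Y :: "'a::metric_space ideal_point set"
  assumes X: "star_space TYPE('a)"
    and Y: "(\<exists>p. Y = boundary_at_infinity \<and> \<rho> = bourdon_metric p) \<or>
         (\<exists>\<omega>\<in>boundary_at_infinity. \<exists>b. busemann_function \<omega> b \<and>
            Y = boundary_at_infinity - {\<omega>} \<and> \<rho> = hamenstaedt_metric b)"
  obtains p c w where "Y \<subseteq> boundary_at_infinity" "0 < c" "\<And>y. y \<in> Y \<Longrightarrow> 0 < w y"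
    "\<And>y y'. y \<in> Y \<Longrightarrow> y' \<in> Y \<Longrightarrow> \<rho> y y' = c * (w y * w y') * bourdon_metric p y y'"
proof -
  interpret star_space "TYPE('a)" by (rule X)
  from Y show ?thesis
  proof
    assume "\<exists>p. Y = boundary_at_infinity \<and> \<rho> = bourdon_metric p"
    then obtain p where "Y = boundary_at_infinity" "\<rho> = bourdon_metric p" by blast
    then show ?thesis by (intro that[where p = p and c = 1 and w = "\<lambda>_. 1"]) simp_all
  next
    assume "\<exists>\<omega>\<in>boundary_at_infinity. \<exists>b. busemann_function \<omega> b \<and>
            Y = boundary_at_infinity - {\<omega>} \<and> \<rho> = hamenstaedt_metric b"
    then obtain \<omega> b where \<omega>: "\<omega> \<in> boundary_at_infinity" "busemann_function \<omega> b"
      and Y: "Y = boundary_at_infinity - {\<omega>}" and \<rho>: "\<rho> = hamenstaedt_metric b" by blast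
    obtain p c where H: "\<And>y y'. y \<in> boundary_at_infinity - {\<omega>} \<Longrightarrow> y' \<in> boundary_at_infinity - {\<omega>} \<Longrightarrow>
      hamenstaedt_metric b y y'
        = exp (- c) / (bourdon_metric p \<omega> y * bourdon_metric p \<omega> y') * bourdon_metric p y y'"
      using hamenstaedt_rescaling[OF \<omega>] by metis
    show ?thesis
    proof (rule that[where p = p and c = "exp (- c)" and w = "\<lambda>y. 1 / bourdon_metric p \<omega> y"])
      show "0 < 1 / bourdon_metric p \<omega> y" if "y \<in> Y" for y
        using bourdon_pos[OF \<omega>(1), of y p] that by (auto simp: Y)
      show "\<rho> y y' = exp (- c) * (1 / bourdon_metric p \<omega> y * (1 / bourdon_metric p \<omega> y')) * bourdon_metric p y y'"
        if "y \<in> Y" "y' \<in> Y" for y y'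
        using H[of y y'] that by (simp add: Y \<rho>)
    qed (simp_all add: Y)
  qed
qed

theorem theorem1p1:
  fixes Y :: "'a::metric_space ideal_point set"
    and \<rho> :: "'a ideal_point \<Rightarrow> 'a ideal_point \<Rightarrow> real"
    and y1 y2 y3 y4 :: "'a ideal_point"
  assumes "cat_minus_one TYPE('a)"
    and "(\<exists>p. Y = boundary_at_infinity \<and> \<rho> = bourdon_metric p) \<or>
         (\<exists>\<omega>\<in>boundary_at_infinity. \<exists>b. busemann_function \<omega> b \<and>
            Y = boundary_at_infinity - {\<omega>} \<and> \<rho> = hamenstaedt_metric b)"
    and "y1 \<in> Y" "y2 \<in> Y" "y3 \<in> Y" "y4 \<in> Y"
  shows "\<rho> y1 y3 * \<rho> y2 y4 \<le> \<rho> y1 y2 * \<rho> y3 y4 + \<rho> y2 y3 * \<rho> y4 y1 \<and>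
    (distinct [y1, y2, y3, y4] \<longrightarrow>
      (\<rho> y1 y3 * \<rho> y2 y4 = \<rho> y1 y2 * \<rho> y3 y4 + \<rho> y2 y3 * \<rho> y4 y1 \<longleftrightarrow>
        (\<exists>v1 v2 v3 v4 Q f. ideal_quadrilateral v1 v2 v3 v4 Q \<and>
           isometry_between f (ideal_hull {y1, y2, y3, y4}) Q \<and>
           f ` geodesic_line y1 y3 = geodesic_line v1 v3 \<and>
           f ` geodesic_line y2 y4 = geodesic_line v2 v4)))"
proof -
  have X: "star_space TYPE('a)" by (rule cat_minus_one_imp_star_space[OF assms(1)])
  interpret star_space "TYPE('a)" by (rule X)
  obtain p c w where Y: "Y \<subseteq> boundary_at_infinity" and c: "0 < c" and w: "\<And>y. y \<in> Y \<Longrightarrow> 0 < w y"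
    and \<rho>: "\<And>y y'. y \<in> Y \<Longrightarrow> y' \<in> Y \<Longrightarrow> \<rho> y y' = c * (w y * w y') * bourdon_metric p y y'"
    by (rule boundary_metric_rescaling[OF X assms(2)]) (rule that)
  \<comment> \<open>Every product of opposite distances contains each of the four points once, so
    all three products carry the same factor.\<close>
  define W where "W = c * c * (w y1 * w y2 * w y3 * w y4)"
  have W: "0 < W" unfolding W_def using c w assms(3-6) by simp
  let ?r = "bourdon_metric p"
  have y: "y1 \<in> boundary_at_infinity" "y2 \<in> boundary_at_infinity" "y3 \<in> boundary_at_infinity" "y4 \<in> boundary_at_infinity"
    using Y assms(3-6) by blast+
  have e: "\<rho> y1 y3 * \<rho> y2 y4 = W * (?r y1 y3 * ?r y2 y4)"
    "\<rho> y1 y2 * \<rho> y3 y4 + \<rho> y2 y3 * \<rho> y4 y1 = W * (?r y1 y2 * ?r y3 y4 + ?r y2 y3 * ?r y4 y1)"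
    using assms(3-6) by (simp_all add: \<rho> W_def algebra_simps)
  have "?r y1 y3 * ?r y2 y4 \<le> ?r y1 y2 * ?r y3 y4 + ?r y2 y3 * ?r y4 y1"
    by (rule bourdon_ptolemy[OF y])
  then have le: "\<rho> y1 y3 * \<rho> y2 y4 \<le> \<rho> y1 y2 * \<rho> y3 y4 + \<rho> y2 y3 * \<rho> y4 y1"
    unfolding e using W by simp
  have eq_iff: "\<rho> y1 y3 * \<rho> y2 y4 = \<rho> y1 y2 * \<rho> y3 y4 + \<rho> y2 y3 * \<rho> y4 y1
      \<longleftrightarrow> ?r y1 y3 * ?r y2 y4 = ?r y1 y2 * ?r y3 y4 + ?r y2 y3 * ?r y4 y1"
    unfolding e using W by simp
  show ?thesis
  proof (intro conjI impI le)
    assume dis: "distinct [y1, y2, y3, y4]"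
    show "\<rho> y1 y3 * \<rho> y2 y4 = \<rho> y1 y2 * \<rho> y3 y4 + \<rho> y2 y3 * \<rho> y4 y1 \<longleftrightarrow>
        (\<exists>v1 v2 v3 v4 Q f. ideal_quadrilateral v1 v2 v3 v4 Q \<and>
           isometry_between f (ideal_hull {y1, y2, y3, y4}) Q \<and>
           f ` geodesic_line y1 y3 = geodesic_line v1 v3 \<and>
           f ` geodesic_line y2 y4 = geodesic_line v2 v4)"
      unfolding eq_iff
    proof
      assume "?r y1 y3 * ?r y2 y4 = ?r y1 y2 * ?r y3 y4 + ?r y2 y3 * ?r y4 y1"
      then show "\<exists>v1 v2 v3 v4 Q f. ideal_quadrilateral v1 v2 v3 v4 Q \<and>
           isometry_between f (ideal_hull {y1, y2, y3, y4}) Q \<and>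
           f ` geodesic_line y1 y3 = geodesic_line v1 v3 \<and>
           f ` geodesic_line y2 y4 = geodesic_line v2 v4"
        by (rule ptolemy_equality_imp_quadrilateral[OF X y dis])
    next
      assume "\<exists>v1 v2 v3 v4 Q f. ideal_quadrilateral v1 v2 v3 v4 Q \<and>
           isometry_between f (ideal_hull {y1, y2, y3, y4}) Q \<and>
           f ` geodesic_line y1 y3 = geodesic_line v1 v3 \<and>
           f ` geodesic_line y2 y4 = geodesic_line v2 v4"
      then show "?r y1 y3 * ?r y2 y4 = ?r y1 y2 * ?r y3 y4 + ?r y2 y3 * ?r y4 y1"
        by (elim exE conjE) (rule quadrilateral_imp_ptolemy_equality[OF X y dis])
    qed
  qed
qed

end
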